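(* For every $n\ge 3$, the proper parts $\mathrm{NC}^A(n)-\{e,(1\,2\cdots n)\}$ and $\mathrm{NC}^B(n)-\{e,[1,2,\dots,n]\}$ of the lattices of non-crossing partitions of types $A$ and $B$ are doubly homotopy Cohen-Macaulay.
   Context: For a finite Coxeter group $W$ with set of reflections $T$, the absolute length $\ell_T(w)$ of $w\in W$ is the smallest $k$ such that $w$ is a product of $k$ elements of $T$; the absolute order on $W$ is $u\preceq v$ iff $\ell_T(u)+\ell_T(u^{-1}v)=\ell_T(v)$. For a Coxeter element $c$, $\mathrm{NC}(W,c)=\{w\in W: e\preceq w\preceq c\}$ with the induced order. Type A: $W=S_n$ (permutations of $[n]$), $T$ = all transpositions, $c=(1\,2\cdots n)$, and $\mathrm{NC}^A(n)=\mathrm{NC}(S_n,c)$. Type B: $W=B_n$, the group of signed permutations, i.e. permutations $\tau$ of $\{\pm1,\dots,\pm n\}$ with $\tau(-i)=-\tau(i)$; $T$ consists of the balanced 1-cycles $[i]=(i\,-i)$ and the paired transpositions $((i,\pm j))=(i\,\pm j)(-i\,\mp j)$ for $1\le i<j\le n$; $c=[1,2,\dots,n]$ is the balanced $n$-cycle $(1\,2\cdots n\,-1\,-2\cdots -n)$, and $\mathrm{NC}^B(n)=\mathrm{NC}(B_n,c)$. The proper part of a bounded poset is obtained by removing its minimum and maximum. The order complex of a poset is the simplicial complex of its chains; a poset is homotopy Cohen-Macaulay if its order complex $\Delta$ is, i.e. for every face $F$ (including $\emptyset$) the link of $F$ in $\Delta$ is $(\dim \mathrm{link}_\Delta(F)-1)$-connected.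 A poset $P$ is doubly homotopy Cohen-Macaulay if $P$ is homotopy Cohen-Macaulay and for every $y\in P$ the poset $P-\{y\}$ is homotopy Cohen-Macaulay of the same rank (length of maximal chains) as $P$. *)

theory Defs
  imports
    "HOL-Algebra.Sym_Groups"
    "HOL-Analysis.Analysis"
begin

section \<open>Absolute order and non-crossing partitions\<close>

text \<open>Below, \<open>G\<close> is a group and \<open>T\<close> a generating set of \<open>G\<close> closed under inverses.\<close>

definition absolute_length :: "('a, 'b) monoid_scheme \<Rightarrow> 'a set \<Rightarrow> 'a \<Rightarrow> nat" where
  "absolute_length G T w =
     (LEAST k. \<exists>ts. length ts = k \<and> set ts \<subseteq> T \<and> foldr (\<lambda>s t. s \<otimes>\<^bsub>G\<^esub> t) ts \<one>\<^bsub>G\<^esub> = w)"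

definition absolute_le :: "('a, 'b) monoid_scheme \<Rightarrow> 'a set \<Rightarrow> 'a \<Rightarrow> 'a \<Rightarrow> bool" where
  "absolute_le G T u v \<longleftrightarrow>
     absolute_length G T u + absolute_length G T (inv\<^bsub>G\<^esub> u \<otimes>\<^bsub>G\<^esub> v) = absolute_length G T v"

definition NC :: "('a, 'b) monoid_scheme \<Rightarrow> 'a set \<Rightarrow> 'a \<Rightarrow> 'a set" where
  "NC G T c = {w \<in> carrier G. absolute_le G T \<one>\<^bsub>G\<^esub> w \<and> absolute_le G T w c}"


subsection \<open>Type A\<close>

definition refl_A :: "nat \<Rightarrow> (nat \<Rightarrow> nat) set" where
  "refl_A n = {Transposition.transpose i j | i j. 1 \<le> i \<and> i < j \<and> j \<le> n}"

definition cox_A :: "nat \<Rightarrow> nat \<Rightarrow> nat" where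
  "cox_A n = cycle_of_list [1..<Suc n]"

definition NC_A :: "nat \<Rightarrow> (nat \<Rightarrow> nat) set" where
  "NC_A n = NC (sym_group n) (refl_A n) (cox_A n)"

definition le_A :: "nat \<Rightarrow> (nat \<Rightarrow> nat) \<Rightarrow> (nat \<Rightarrow> nat) \<Rightarrow> bool" where
  "le_A n = absolute_le (sym_group n) (refl_A n)"


subsection \<open>Type B\<close>

definition signed_sym_group :: "nat \<Rightarrow> (int \<Rightarrow> int) monoid" where
  "signed_sym_group n =
     \<lparr> carrier = {p. p permutes ({- int n..int n} - {0}) \<and> (\<forall>i. p (- i) = - p i)},
       mult = (\<circ>), one = id \<rparr>"

definition refl_B :: "nat \<Rightarrow> (int \<Rightarrow> int) set" where
  "refl_B n =
     {Transposition.transpose i (- i) | i. 1 \<le> i \<and> i \<le> int n} \<union>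
     {Transposition.transpose i j \<circ> Transposition.transpose (- i) (- j) | i j.
        1 \<le> i \<and> i < j \<and> j \<le> int n} \<union>
     {Transposition.transpose i (- j) \<circ> Transposition.transpose (- i) j | i j.
        1 \<le> i \<and> i < j \<and> j \<le> int n}"

definition cox_B :: "nat \<Rightarrow> int \<Rightarrow> int" where
  "cox_B n = cycle_of_list (map int [1..<Suc n] @ map (\<lambda>i. - int i) [1..<Suc n])"

definition NC_B :: "nat \<Rightarrow> (int \<Rightarrow> int) set" where
  "NC_B n = NC (signed_sym_group n) (refl_B n) (cox_B n)"

definition le_B :: "nat \<Rightarrow> (int \<Rightarrow> int) \<Rightarrow> (int \<Rightarrow> int) \<Rightarrow> bool" where
  "le_B n = absolute_le (signed_sym_group n) (refl_B n)"

lemma signed_sym_group_is_group: "group (signed_sym_group n)"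
proof (rule groupI)
  fix p assume p: "p \<in> carrier (signed_sym_group n)"
  then have perm: "p permutes ({- int n..int n} - {0})" and odd: "\<And>i. p (- i) = - p i"
    by (auto simp: signed_sym_group_def)
  have "inv' p (- i) = - inv' p i" for i
  proof -
    have "p (- inv' p i) = - i"
      using odd permutes_inverses(1)[OF perm] by simp
    then show ?thesis
      using permutes_inverses(2)[OF perm] by metis
  qed
  then have "inv' p \<in> carrier (signed_sym_group n)"
    using permutes_inv[OF perm] by (simp add: signed_sym_group_def)
  moreover have "inv' p \<circ> p = id"
    using permutes_inv_o(2)[OF perm] .
  ultimately show "\<exists>q\<in>carrier (signed_sym_group n).
      q \<otimes>\<^bsub>signed_sym_group n\<^esub> p = \<one>\<^bsub>signed_sym_group n\<^esub>"
    by (auto simp: signed_sym_group_def)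
qed (auto simp: signed_sym_group_def permutes_id comp_assoc intro: permutes_compose)


section \<open>Simplicial complexes and connectivity\<close>

text \<open>A simplicial complex is its set of faces, including the empty face. All complexes
  considered are finite, so the geometric realization may carry the topology of pointwise
  convergence of barycentric coordinates.\<close>

definition geometric_realization :: "'a set set \<Rightarrow> ('a \<Rightarrow> real) topology" where
  "geometric_realization \<Delta> =
     subtopology (powertop_real UNIV)
       {x. (\<forall>v. 0 \<le> x v) \<and> {v. x v \<noteq> 0} \<in> \<Delta> \<and> (\<Sum>v | x v \<noteq> 0. x v) = 1}"

definition complex_dim :: "'a set set \<Rightarrow> int" where
  "complex_dim \<Delta> = Max ((\<lambda>F. int (card F) - 1) ` \<Delta>)"

definition link :: "'a set set \<Rightarrow> 'a set \<Rightarrow> 'a set set" where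
  "link \<Delta> F = {G \<in> \<Delta>. F \<inter> G = {} \<and> F \<union> G \<in> \<Delta>}"

text \<open>Usual conventions: \<open>(-1)\<close>-connected means non-empty, and every space is
  \<open>k\<close>-connected for \<open>k \<le> -2\<close>.\<close>

definition k_connected :: "int \<Rightarrow> 'a topology \<Rightarrow> bool" where
  "k_connected k X \<longleftrightarrow>
     (- 1 \<le> k \<longrightarrow> topspace X \<noteq> {}) \<and>
     (\<forall>i f. int i \<le> k \<longrightarrow> continuous_map (nsphere i) X f \<longrightarrow>
        (\<exists>a \<in> topspace X. homotopic_with (\<lambda>_. True) (nsphere i) X f (\<lambda>_. a)))"

definition homotopy_CM_complex :: "'a set set \<Rightarrow> bool" where
  "homotopy_CM_complex \<Delta> \<longleftrightarrow>
     (\<forall>F \<in> \<Delta>. k_connected (complex_dim (link \<Delta> F) - 1) (geometric_realization (link \<Delta> F)))"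


section \<open>Cohen-Macaulay posets\<close>

text \<open>A poset is given by its ground set \<open>P\<close> and a relation that is a partial order on \<open>P\<close>.\<close>

definition order_complex :: "'a set \<Rightarrow> ('a \<Rightarrow> 'a \<Rightarrow> bool) \<Rightarrow> 'a set set" where
  "order_complex P r = {C. C \<subseteq> P \<and> finite C \<and> Complete_Partial_Order.chain r C}"

definition homotopy_CM :: "'a set \<Rightarrow> ('a \<Rightarrow> 'a \<Rightarrow> bool) \<Rightarrow> bool" where
  "homotopy_CM P r \<longleftrightarrow> homotopy_CM_complex (order_complex P r)"

text \<open>The length of a chain is one less than its number of elements.\<close>

definition poset_rank :: "'a set \<Rightarrow> ('a \<Rightarrow> 'a \<Rightarrow> bool) \<Rightarrow> int" where
  "poset_rank P r = complex_dim (order_complex P r)"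

definition doubly_homotopy_CM :: "'a set \<Rightarrow> ('a \<Rightarrow> 'a \<Rightarrow> bool) \<Rightarrow> bool" where
  "doubly_homotopy_CM P r \<longleftrightarrow>
     homotopy_CM P r \<and>
     (\<forall>y \<in> P. homotopy_CM (P - {y}) r \<and> poset_rank (P - {y}) r = poset_rank P r)"

end

theory Submission
  imports Defs
begin

text \<open>Deleting a point \<open>j\<close> from the cycles of a (signed) permutation is monotone for the absolute
  order, lowers the length by at most one, and maps an interval \<open>[p, q]\<close> (translated by
  \<open>p\<^sup>-\<^sup>1\<close>) into the interval below one of its coatoms. Given \<open>y\<close> in the interval, choose \<open>j\<close>
  among the points moved by \<open>p\<^sup>-\<^sup>1 y\<close>: then \<open>y\<close> is not in the image of the deletion. So in the open
  interval without \<open>y\<close>, the fixed elements of the deletion form a cone over the coatom, and the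
  other elements can be added in order of decreasing rank. The link of an added element \<open>x\<close> is a
  cone over the deletion of \<open>x\<close>, unless \<open>x\<close> covers \<open>p\<close>; then it is handled by induction. Carrying a chain
  along in the induction covers all links at once.

  Adding a vertex with a \<open>(k - 1)\<close>-connected link to a \<open>k\<close>-connected complex gives a
  \<open>k\<close>-connected complex. This follows from the statement on unions of two open sets
  \<open>A\<close> and \<open>B\<close>: subdivide a sphere into small cubes, each mapped into \<open>A\<close> or into \<open>B\<close>,
  and construct the null-homotopy cell by cell, with values in \<open>A\<close>, \<open>B\<close> or
  \<open>A \<inter> B\<close>.\<close>

text \<open>\<open>k_connected\<close> speaks of null-homotopies of maps of spheres, so the proof
  works with homotopies in every degree and never passes to homology or the fundamental group. The
  link of a chain is a join of open intervals, and its connectivity would usually come from a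
  theorem on joins. Here only one gap \<open>[p, q]\<close> of the chain is worked on: link vertices
  outside the gap are comparable to everything inside it, so they belong to every cone that occurs,
  and the factors of the join need not be separated. The removed point \<open>y\<close> can do harm
  only inside the gap that is used. If \<open>y\<close> belongs to the link, the gap is therefore
  chosen around \<open>y\<close>, and since the deletion moves \<open>y\<close>, no apex of a cone
  is ever equal to \<open>y\<close>. A moved element \<open>x\<close> covering \<open>p\<close> is
  exceptional because its deletion is \<open>p\<close> itself, which is not a vertex. Connectivity
  is stated in terms of the rank function rather than the dimension of the complex, so that the rank
  of the poset without \<open>y\<close> can be read off from it afterwards.\<close>

section \<open>Round spheres in the infinite product of real lines\<close>

lemma continuous_on_Max:
  fixes f :: "'i \<Rightarrow> 'a::topological_space \<Rightarrow> 'b::linorder_topology"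
  assumes "finite I" "I \<noteq> {}" "\<And>i. i \<in> I \<Longrightarrow> continuous_on S (f i)"
  shows "continuous_on S (\<lambda>x. Max ((\<lambda>i. f i x) ` I))"
  using assms by (induction I rule: finite_ne_induct) (auto intro!: continuous_on_max)

definition unit_sphere :: "nat \<Rightarrow> (nat \<Rightarrow> real) set" where
  "unit_sphere n = {x. (\<Sum>i\<le>n. (x i)\<^sup>2) = 1 \<and> (\<forall>i>n. x i = 0)}"

lemma nsphere_eq_unit_sphere: "nsphere n = top_of_set (unit_sphere n)"
  by (simp add: nsphere unit_sphere_def euclidean_product_topology)

lemma abs_coord_le_1:
  assumes "x \<in> unit_sphere n" shows "\<bar>x i\<bar> \<le> 1"
proof (cases "i \<le> n")
  case True
  have "(x i)\<^sup>2 \<le> (\<Sum>i\<le>n. (x i)\<^sup>2)"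
    using True by (intro member_le_sum) auto
  then show ?thesis
    using assms by (simp add: unit_sphere_def abs_square_le_1)
qed (use assms in \<open>auto simp: unit_sphere_def\<close>)

text \<open>Tychonoff's theorem. Coordinates beyond the dimension are pinned to points, so spheres
  and cells of all dimensions live in one infinite product.\<close>

lemma compact_box:
  fixes f g :: "'a \<Rightarrow> real"
  shows "compact {x. \<forall>i. f i \<le> x i \<and> x i \<le> g i}"
proof -
  have "compactin (product_topology (\<lambda>i. euclideanreal) UNIV) (PiE UNIV (\<lambda>i. {f i..g i}))"
    by (simp add: compactin_PiE)
  moreover have "PiE UNIV (\<lambda>i. {f i..g i}) = {x. \<forall>i. f i \<le> x i \<and> x i \<le> g i}"
    by auto
  ultimately show ?thesis
    by (simp add: euclidean_product_topology)
qed

lemma compact_unit_sphere: "compact (unit_sphere n)"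
proof -
  have "closed (unit_sphere n)"
    unfolding unit_sphere_def
    by (intro closed_Collect_conj closed_Collect_all closed_Collect_imp closed_Collect_eq
        open_Collect_const continuous_intros continuous_on_product_coordinates)
  moreover have "unit_sphere n \<subseteq> {x. \<forall>i. (- 1) \<le> x i \<and> x i \<le> 1}"
    using abs_coord_le_1 by (fastforce simp: abs_le_iff)
  ultimately show ?thesis
    using compact_Int_closed[OF compact_box[of "\<lambda>_. - 1" "\<lambda>_. 1"], of "unit_sphere n"]
    by (simp add: Int_absorb1)
qed

lemma k_connected_mono:
  "k_connected k X \<Longrightarrow> k' \<le> k \<Longrightarrow> k_connected k' X"
  unfolding k_connected_def by (meson dual_order.trans)

lemma k_connected_le_minus2: "k \<le> - 2 \<Longrightarrow> k_connected k X"
  by (auto simp: k_connected_def)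


section \<open>Extension of maps over cubical cells\<close>

text \<open>The pair \<open>(a, J)\<close> stands for the product of the intervals \<open>[a j, a j + 1]\<close> for
  \<open>j \<in> J\<close> and of the points \<open>a j\<close> for \<open>j \<notin> J\<close>; its dimension is \<open>card J\<close>.\<close>

type_synonym grid_cell = "(nat \<Rightarrow> int) \<times> nat set"

definition cell :: "grid_cell \<Rightarrow> (nat \<Rightarrow> real) set" where
  "cell c = {x. \<forall>j. of_int (fst c j) \<le> x j \<and>
     x j \<le> (if j \<in> snd c then of_int (fst c j) + 1 else of_int (fst c j))}"

definition cell_boundary :: "grid_cell \<Rightarrow> (nat \<Rightarrow> real) set" where
  "cell_boundary c = {x \<in> cell c. \<exists>j\<in>snd c. x j = of_int (fst c j) \<or> x j = of_int (fst c j) + 1}"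

lemma compact_cell: "compact (cell c)"
  unfolding cell_def by (rule compact_box)

lemma closed_cell: "closed (cell c)"
proof -
  have "closedin euclidean (cell c)"
    by (rule compactin_imp_closedin) (use compact_cell in auto)
  then show ?thesis by simp
qed

section \<open>Cells as cones over spheres\<close>

text \<open>The norm on the first \<open>n + 1\<close> coordinates whose spheres are surfaces of
  cubes. Radial rescaling against the Euclidean norm relates cubes to round spheres.\<close>

definition sup_norm :: "nat \<Rightarrow> (nat \<Rightarrow> real) \<Rightarrow> real" where
  "sup_norm n x = Max ((\<lambda>i. \<bar>x i\<bar>) ` {..n})"

lemma abs_le_sup_norm: "i \<le> n \<Longrightarrow> \<bar>x i\<bar> \<le> sup_norm n x"
  by (auto simp: sup_norm_def)

lemma sup_norm_attained: obtains i where "i \<le> n" "sup_norm n x = \<bar>x i\<bar>"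
proof -
  have "sup_norm n x \<in> (\<lambda>i. \<bar>x i\<bar>) ` {..n}"
    unfolding sup_norm_def by (rule Max_in) auto
  then show ?thesis using that by auto
qed

lemma sup_norm_nonneg: "0 \<le> sup_norm n x"
  by (metis abs_ge_zero sup_norm_attained)

lemma sup_norm_eq_0_iff: "sup_norm n x = 0 \<longleftrightarrow> (\<forall>i\<le>n. x i = 0)"
  by (metis abs_eq_0 abs_le_sup_norm abs_le_zero_iff sup_norm_attained)

lemma sup_norm_pos: "x \<in> unit_sphere n \<Longrightarrow> 0 < sup_norm n x"
proof -
  assume x: "x \<in> unit_sphere n"
  have "\<not> (\<forall>i\<le>n. x i = 0)"
  proof
    assume "\<forall>i\<le>n. x i = 0"
    then have "(\<Sum>i\<le>n. (x i)\<^sup>2) = 0" by simp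
    then show False using x by (simp add: unit_sphere_def)
  qed
  then show ?thesis
    using sup_norm_eq_0_iff[of n x] sup_norm_nonneg[of n x] by (simp add: less_le)
qed

lemma sup_norm_scale:
  assumes "0 \<le> c" "\<And>i. i \<le> n \<Longrightarrow> y i = c * x i"
  shows "sup_norm n y = c * sup_norm n x"
proof -
  obtain i where i: "i \<le> n" "sup_norm n y = \<bar>y i\<bar>" by (rule sup_norm_attained)
  obtain j where j: "j \<le> n" "sup_norm n x = \<bar>x j\<bar>" by (rule sup_norm_attained)
  have "\<bar>y i\<bar> = c * \<bar>x i\<bar>" "\<bar>y j\<bar> = c * \<bar>x j\<bar>"
    using assms i j by (auto simp: abs_mult)
  moreover have "\<bar>y j\<bar> \<le> \<bar>y i\<bar>" "\<bar>x i\<bar> \<le> \<bar>x j\<bar>"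
    using abs_le_sup_norm i j by metis+
  ultimately show ?thesis
    using i j assms(1) by (metis mult_left_mono order_antisym)
qed

lemma continuous_on_sup_norm [continuous_intros]:
  assumes "continuous_on S f"
  shows "continuous_on S (\<lambda>x. sup_norm n (f x))"
  unfolding sup_norm_def
proof (rule continuous_on_Max)
  show "continuous_on S (\<lambda>x. \<bar>f x i\<bar>)" for i
    by (rule continuous_on_rabs[OF continuous_on_product_then_coordinatewise[OF assms]])
qed auto

lemma unit_sphere_normalize:
  assumes "\<And>i. i > n \<Longrightarrow> y i = 0" "\<not> (\<forall>i\<le>n. y i = 0)"
  shows "(\<lambda>i. y i / sqrt (\<Sum>i\<le>n. (y i)\<^sup>2)) \<in> unit_sphere n" "0 < sqrt (\<Sum>i\<le>n. (y i)\<^sup>2)"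
proof -
  have "0 < (\<Sum>i\<le>n. (y i)\<^sup>2)"
    using assms(2) by (auto intro!: sum_pos2)
  then show "(\<lambda>i. y i / sqrt (\<Sum>i\<le>n. (y i)\<^sup>2)) \<in> unit_sphere n" "0 < sqrt (\<Sum>i\<le>n. (y i)\<^sup>2)"
    using assms(1) by (auto simp: unit_sphere_def power_divide real_sqrt_pow2 simp flip: sum_divide_distrib)
qed

text \<open>Uniqueness of polar coordinates: \<open>u\<close> is the Euclidean norm of the common
  vector.\<close>

lemma unit_sphere_ray_unique:
  assumes "x \<in> unit_sphere n" "x' \<in> unit_sphere n" "0 \<le> u" "0 \<le> u'"
    and eq: "\<And>i. i \<le> n \<Longrightarrow> u * x i = u' * x' i"
  shows "u = u'" "u = 0 \<or> x = x'"
proof -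
  have "u\<^sup>2 = (\<Sum>i\<le>n. (u * x i)\<^sup>2)"
    using assms(1) by (simp add: unit_sphere_def power_mult_distrib flip: sum_distrib_left)
  also have "\<dots> = (\<Sum>i\<le>n. (u' * x' i)\<^sup>2)"
    using eq by simp
  also have "\<dots> = u'\<^sup>2"
    using assms(2) by (simp add: unit_sphere_def power_mult_distrib flip: sum_distrib_left)
  finally show uu: "u = u'"
    using assms by (simp add: power2_eq_iff_nonneg)
  have "x i = x' i" if "u \<noteq> 0" for i
    using eq[of i] that uu assms(1,2) by (cases "i \<le> n") (auto simp: unit_sphere_def)
  then show "u = 0 \<or> x = x'" by auto
qed

text \<open>A cell of dimension \<open>n + 1\<close> is the cone over an \<open>n\<close>-sphere, so
  extending a map from the boundary over the cell amounts to a null-homotopy of that map. In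
  dimension 0 the boundary is empty and only a point of \<open>Y\<close> is required.\<close>

lemma cell_extension:
  fixes Y :: "'b::topological_space set"
  assumes fin: "finite (snd c)" and conn: "k_connected (int (card (snd c)) - 1) (top_of_set Y)"
    and g: "continuous_on (cell_boundary c) g" "g ` cell_boundary c \<subseteq> Y"
  obtains g' where "continuous_on (cell c) g'" "g' ` cell c \<subseteq> Y"
    "\<And>x. x \<in> cell_boundary c \<Longrightarrow> g' x = g x"
proof (cases "snd c = {}")
  case True
  then have "k_connected (- 1) (top_of_set Y)" using conn by simp
  then obtain y where "y \<in> Y" by (auto simp: k_connected_def)
  moreover have "cell_boundary c = {}"
    using True by (auto simp: cell_boundary_def)
  ultimately show ?thesis
    by (intro that[of "\<lambda>_. y"]) auto
next
  case False
  obtain a J where c: "c = (a, J)" by (cases c)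
  obtain n where n: "card J = Suc n"
    using False fin c by (metis card_gt_0_iff gr0_implies_Suc snd_conv)
  obtain e where e: "bij_betw e {0..<card J} J"
    using ex_bij_betw_nat_finite fin c by (metis snd_conv)
  define d where "d = inv_into {0..<card J} e"
  have d: "d j \<le> n" "e (d j) = j" if "j \<in> J" for j
    using bij_betwE[OF bij_betw_inv_into[OF e]] bij_betw_inv_into_right[OF e] that n
    by (auto simp: d_def less_Suc_eq_le)
  have de: "e i \<in> J" "d (e i) = i" if "i \<le> n" for i
    using bij_betw_inv_into_left[OF e] bij_betwE[OF e] that n by (auto simp: d_def less_Suc_eq_le)
  define S where "S = unit_sphere n"
  \<comment> \<open>Polar coordinates on the cell, with \<open>d\<close> matching its directions to
    the coordinates \<open>0..n\<close> of the sphere. At \<open>t = 0\<close> the point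
    \<open>x\<close> is scaled to sup-norm 1/2 around the centre and so lands on the boundary;
    \<open>t = 1\<close> is the centre.\<close>
  define q :: "real \<times> (nat \<Rightarrow> real) \<Rightarrow> nat \<Rightarrow> real" where
    "q = (\<lambda>p j. of_int (a j) + (if j \<in> J then 1/2 + (1 - fst p) * snd p (d j) / (2 * sup_norm n (snd p)) else 0))"
  have pos: "0 < sup_norm n x" if "x \<in> S" for x
    using that sup_norm_pos by (simp add: S_def)
  have bd: "- (1/2) \<le> (1 - t) * x i / (2 * sup_norm n x)" "(1 - t) * x i / (2 * sup_norm n x) \<le> 1/2" if "0 \<le> t" "t \<le> 1" "x \<in> S" "i \<le> n" for t x i
  proof -
    have "(1 - t) * \<bar>x i\<bar> \<le> 1 * sup_norm n x"
      using that abs_le_sup_norm[of i n x] by (intro mult_mono) auto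
    then have "\<bar>(1 - t) * x i\<bar> \<le> sup_norm n x"
      using that by (simp add: abs_mult)
    then show "- (1/2) \<le> (1 - t) * x i / (2 * sup_norm n x)" "(1 - t) * x i / (2 * sup_norm n x) \<le> 1/2"
      using pos[OF that(3)] by (auto simp: divide_simps abs_le_iff)
  qed
  have q_cell: "q p \<in> cell c" if "p \<in> {0..1} \<times> S" for p
  proof -
    have "of_int (a j) \<le> q p j \<and> q p j \<le> (if j \<in> J then of_int (a j) + 1 else of_int (a j))" for j
      using bd[of "fst p" "snd p" "d j"] that d(1)[of j] by (auto simp: q_def)
    then show ?thesis unfolding cell_def c fst_conv snd_conv by blast
  qed
  have q_inj: "t = t' \<and> (x = x' \<or> t = 1)"
    if "q (t, x) = q (t', x')" "t \<in> {0..1}" "t' \<in> {0..1}" "x \<in> S" "x' \<in> S" for t t' x x'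
  proof -
    define u u' where "u = (1 - t) / (2 * sup_norm n x)" "u' = (1 - t') / (2 * sup_norm n x')"
    have eq: "u * x i = u' * x' i" if "i \<le> n" for i
      using fun_cong[OF \<open>q (t, x) = q (t', x')\<close>, of "e i"] de[OF that] by (simp add: q_def u_u'_def)
    have nn: "0 \<le> u" "0 \<le> u'"
      using that pos[of x] pos[of x'] by (auto simp: u_u'_def)
    have xS: "x \<in> unit_sphere n" "x' \<in> unit_sphere n" using that by (auto simp: S_def)
    note * = unit_sphere_ray_unique[OF xS nn eq]
    then show ?thesis
      using pos[of x] pos[of x'] that by (auto simp: u_u'_def)
  qed
  have q_surj: "\<exists>p\<in>{0..1} \<times> S. q p = y" if y: "y \<in> cell c" for y
  proof -
    define w where "w = (\<lambda>i. if i \<le> n then y (e i) - of_int (a (e i)) - 1/2 else 0)"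
    have yj: "of_int (a j) \<le> y j" "y j \<le> (if j \<in> J then of_int (a j) + 1 else of_int (a j))" for j
      using y unfolding cell_def c fst_conv snd_conv by blast+
    have w_le: "\<bar>w i\<bar> \<le> 1/2" for i
    proof (cases "i \<le> n")
      case True
      then have "of_int (a (e i)) \<le> y (e i)" "y (e i) \<le> of_int (a (e i)) + 1"
        using yj[of "e i"] de(1)[of i] by auto
      then have "\<bar>y (e i) - of_int (a (e i)) - 1/2\<bar> \<le> 1/2"
        unfolding abs_le_iff by auto
      then show ?thesis using True by (simp only: w_def if_True)
    qed (simp add: w_def)
    have y_eq: "y j = of_int (a j) + (if j \<in> J then 1/2 + w (d j) else 0)" for j
      using yj[of j] d[of j] by (auto simp: w_def)
    show ?thesis
    proof (cases "\<forall>i\<le>n. w i = 0")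
      \<comment> \<open>The whole sphere at \<open>t = 1\<close> lies over the centre; any of its
        points serves.\<close>
      case True
      have "(\<lambda>n. if n = 0 then 1 else 0) \<in> S"
        using in_topspace_nsphere[of n] by (simp add: S_def nsphere_eq_unit_sphere)
      moreover have "q (1, \<lambda>n. if n = 0 then 1 else 0) = y"
        using True d(1) by (auto simp: q_def y_eq fun_eq_iff)
      ultimately show ?thesis by (intro bexI[of _ "(1, \<lambda>n. if n = 0 then 1 else 0)"]) auto
    next
      case False
      define s where "s = sqrt (\<Sum>i\<le>n. (w i)\<^sup>2)"
      define x where "x = (\<lambda>i. w i / s)"
      have x: "x \<in> S" "0 < s"
        using unit_sphere_normalize[of n w] False by (auto simp: w_def x_def s_def S_def)
      \<comment> \<open>The solution of \<open>(1 - t) / 2 = sup_norm n w\<close>, where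
        \<open>w\<close> is the position of \<open>y\<close> relative to the centre.\<close>
      define t where "t = 1 - 2 * sup_norm n w"
      have sn: "sup_norm n x = 1 / s * sup_norm n w"
        using x by (intro sup_norm_scale) (auto simp: x_def)
      have sw: "0 < sup_norm n w"
        using False sup_norm_eq_0_iff[of n w] sup_norm_nonneg[of n w] by (simp add: less_le)
      have "sup_norm n w \<le> 1/2"
        using w_le by (metis sup_norm_attained)
      then have "t \<in> {0..1}" using sw by (auto simp: t_def)
      moreover have "(1 - t) * x i / (2 * sup_norm n x) = w i" for i
        using x(2) sw unfolding sn t_def by (simp add: x_def)
      then have "q (t, x) = y"
        by (auto simp: q_def y_eq fun_eq_iff)
      ultimately show ?thesis using x by (intro bexI[of _ "(t, x)"]) auto
    qed
  qed
  have q_boundary: "q (0, x) \<in> cell_boundary c" if "x \<in> S" for x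
  proof -
    obtain i where i: "i \<le> n" "sup_norm n x = \<bar>x i\<bar>" by (rule sup_norm_attained)
    have "x i / (2 * \<bar>x i\<bar>) = 1/2 \<or> x i / (2 * \<bar>x i\<bar>) = - (1/2)"
      using pos[OF that] i by (auto simp: abs_if)
    then have "q (0, x) (e i) = of_int (a (e i)) \<or> q (0, x) (e i) = of_int (a (e i)) + 1"
      using i de[of i] by (auto simp: q_def)
    then show ?thesis
      using q_cell[of "(0, x)"] that de[OF i(1)] by (auto simp: cell_boundary_def c)
  qed
  have boundary_q: "\<exists>x\<in>S. q (0, x) = y" if y: "y \<in> cell_boundary c" for y
  proof -
    obtain t x where p: "t \<in> {0..1}" "x \<in> S" "q (t, x) = y"
      using q_surj[of y] y by (auto simp: cell_boundary_def)
    obtain j where j: "j \<in> J" "y j = of_int (a j) \<or> y j = of_int (a j) + 1"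
      using y by (auto simp: cell_boundary_def c)
    moreover have "y j = of_int (a j) + (1/2 + (1 - t) * x (d j) / (2 * sup_norm n x))"
      using p(3) j(1) by (auto simp: q_def)
    ultimately have "(1 - t) * x (d j) / (2 * sup_norm n x) = 1/2 \<or> (1 - t) * x (d j) / (2 * sup_norm n x) = - (1/2)"
      by linarith
    then have "\<bar>(1 - t) * x (d j) / (2 * sup_norm n x)\<bar> = 1/2"
      by linarith
    then have eq: "(1 - t) * \<bar>x (d j)\<bar> = sup_norm n x"
      using pos[OF p(2)] p(1) by (simp add: abs_mult divide_simps)
    have "t = 0"
    proof (rule ccontr)
      assume "t \<noteq> 0"
      then have "t > 0" using p by auto
      moreover have "\<bar>x (d j)\<bar> > 0"
        using eq pos[OF p(2)] by (cases "x (d j) = 0") auto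
      ultimately have "(1 - t) * \<bar>x (d j)\<bar> < \<bar>x (d j)\<bar>"
        by (simp add: algebra_simps)
      then show False
        using eq abs_le_sup_norm[OF d(1)[OF j(1)], of x] by linarith
    qed
    then show ?thesis using p by auto
  qed
  have q_cont: "continuous_on ({0..1} \<times> S) q"
  proof (intro continuous_on_coordinatewise_then_product)
    fix j
    have nz: "\<forall>p\<in>{0..1::real} \<times> S. 2 * sup_norm n (snd p) \<noteq> 0"
      using pos by fastforce
    have "continuous_on ({0..1} \<times> S) (\<lambda>p. of_int (a j) + (1/2 + (1 - fst p) * snd p (d j) / (2 * sup_norm n (snd p))))"
      using nz by (intro continuous_intros continuous_on_product_then_coordinatewise[where f = snd]) auto
    then show "continuous_on ({0..1} \<times> S) (\<lambda>p. q p j)"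
      by (cases "j \<in> J") (auto simp: q_def)
  qed
  have "continuous_on S (\<lambda>x. q (0, x))"
    by (rule continuous_on_compose2[OF q_cont]) (auto intro: continuous_on_Pair continuous_on_id)
  then have "continuous_on S (\<lambda>x. g (q (0, x)))"
    by (rule continuous_on_compose2[OF g(1)]) (use q_boundary in blast)
  then have "continuous_map (nsphere n) (top_of_set Y) (\<lambda>x. g (q (0, x)))"
    unfolding nsphere_eq_unit_sphere S_def[symmetric] continuous_map_subtopology_eu
    using q_boundary g(2) by blast
  moreover have "\<forall>f. continuous_map (nsphere n) (top_of_set Y) f \<longrightarrow>
        (\<exists>a \<in> topspace (top_of_set Y). homotopic_with (\<lambda>_. True) (nsphere n) (top_of_set Y) f (\<lambda>_. a))"
    using conn n unfolding k_connected_def by (simp add: c)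
  ultimately obtain b where "homotopic_with (\<lambda>_. True) (nsphere n) (top_of_set Y) (\<lambda>x. g (q (0, x))) (\<lambda>_. b)"
    by blast
  then obtain h :: "real \<times> (nat \<Rightarrow> real) \<Rightarrow> 'b" where h: "continuous_map (prod_topology (top_of_set {0..1}) (nsphere n)) (top_of_set Y) h"
    "\<And>x. h (0, x) = g (q (0, x))" "\<And>x. h (1, x) = b"
    by (auto simp: homotopic_with_def)
  have h1: "continuous_map (top_of_set ({0..1} \<times> S)) (top_of_set Y) h"
    using h(1) by (simp only: nsphere_eq_unit_sphere S_def prod_topology_subtopology_eu)
  have q_im: "q ` ({0..1} \<times> S) = cell c"
    using q_cell q_surj by (intro equalityI image_subsetI subsetI; blast)
  \<comment> \<open>A continuous surjection from a compact space to a Hausdorff space is a quotient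
    map. The null-homotopy \<open>h\<close> descends along it, being constant at
    \<open>t = 1\<close>, the only level at which \<open>q\<close> identifies points.\<close>
  have qm: "quotient_map (top_of_set ({0..1} \<times> S)) (top_of_set (cell c)) q"
  proof (rule continuous_imp_quotient_map)
    show "compact_space (top_of_set ({0..1::real} \<times> S))"
      by (rule compact_space_subtopology)
        (use compact_Times[OF compact_Icc compact_unit_sphere, of "0::real" 1 n] in \<open>simp add: S_def\<close>)
    show "Hausdorff_space (top_of_set (cell c))"
      by (simp add: Hausdorff_space_subtopology)
    show "continuous_map (top_of_set ({0..1} \<times> S)) (top_of_set (cell c)) q"
      unfolding continuous_map_subtopology_eu using q_cont q_cell by blast
    show "q ` topspace (top_of_set ({0..1} \<times> S)) = topspace (top_of_set (cell c))"
      unfolding topspace_euclidean_subtopology by (rule q_im)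
  qed
  have h_q: "h p = h p'" if "p \<in> {0..1} \<times> S" "p' \<in> {0..1} \<times> S" "q p = q p'" for p p'
  proof -
    obtain t x t' x' where p: "p = (t, x)" "p' = (t', x')" by (cases p; cases p')
    then have "t = t' \<and> (x = x' \<or> t = 1)" using q_inj that by blast
    then show ?thesis unfolding p by (elim conjE disjE) (simp_all only: h(3))
  qed
  have "\<exists>g'. continuous_map (top_of_set (cell c)) (top_of_set Y) g' \<and>
    (\<forall>p\<in>{0..1} \<times> S. g' (q p) = h p)"
  proof (rule quotient_map_lift_exists[OF qm h1])
    show "h p = h p'" if "p \<in> topspace (top_of_set ({0..1} \<times> S))"
      "p' \<in> topspace (top_of_set ({0..1} \<times> S))" "q p = q p'" for p p'
      using that(1,2) unfolding topspace_euclidean_subtopology by (rule h_q[OF _ _ that(3)])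
  next
    fix g' assume "continuous_map (top_of_set (cell c)) (top_of_set Y) g'"
      "\<And>p. p \<in> topspace (top_of_set ({0..1} \<times> S)) \<Longrightarrow> g' (q p) = h p"
    then show ?thesis unfolding topspace_euclidean_subtopology by blast
  qed
  then obtain g' where g': "continuous_map (top_of_set (cell c)) (top_of_set Y) g'"
    "\<And>p. p \<in> {0..1} \<times> S \<Longrightarrow> g' (q p) = h p"
    by blast
  show ?thesis
  proof (rule that[of g'])
    show "continuous_on (cell c) g'" "g' ` cell c \<subseteq> Y"
      using g'(1) unfolding continuous_map_subtopology_eu by blast+
    fix x assume "x \<in> cell_boundary c"
    then obtain y where y: "y \<in> S" "q (0, y) = x" using boundary_q by blast
    then show "g' x = g x"
      using g'(2)[of "(0, y)"] h(2)[of y] by simp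
  qed
qed

section \<open>Incidence of grid cells\<close>

lemma cell_corner: "(\<lambda>j. of_int (fst c j)) \<in> cell c"
  by (simp add: cell_def)

lemma cell_corner_upd: "i \<in> snd c \<Longrightarrow> (\<lambda>j. of_int (fst c j) + (if j = i then 1 else 0)) \<in> cell c"
  by (simp add: cell_def)

lemma cellD:
  assumes "x \<in> cell c"
  shows "of_int (fst c j) \<le> x j" "x j \<le> of_int (fst c j) + 1" "j \<notin> snd c \<Longrightarrow> x j = of_int (fst c j)"
proof -
  have *: "of_int (fst c j) \<le> x j" "x j \<le> (if j \<in> snd c then of_int (fst c j) + 1 else of_int (fst c j))"
    using assms unfolding cell_def by blast+
  then show "of_int (fst c j) \<le> x j" "x j \<le> of_int (fst c j) + 1"
    "j \<notin> snd c \<Longrightarrow> x j = of_int (fst c j)"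
    by (cases "j \<in> snd c"; simp)+
qed

lemma cellI:
  assumes "\<And>j. of_int (fst c j) \<le> x j" "\<And>j. x j \<le> of_int (fst c j) + 1"
    "\<And>j. j \<notin> snd c \<Longrightarrow> x j = of_int (fst c j)"
  shows "x \<in> cell c"
  using assms by (auto simp: cell_def)

text \<open>In a direction of \<open>c\<close> there are two corners whose coordinates differ by
  one, which a pinned coordinate of \<open>c'\<close> cannot accommodate.\<close>

lemma cell_subset_imp_dims:
  assumes "cell c \<subseteq> cell c'" shows "snd c \<subseteq> snd c'"
proof
  fix i assume i: "i \<in> snd c"
  show "i \<in> snd c'"
  proof (rule ccontr)
    assume "i \<notin> snd c'"
    then have "of_int (fst c i) = (of_int (fst c' i) :: real)"
      "of_int (fst c i) + 1 = (of_int (fst c' i) :: real)"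
      using cellD(3)[of _ c' i] cell_corner[of c] cell_corner_upd[OF i] assms by fastforce+
    then show False by simp
  qed
qed

lemma cell_subset_same_dims:
  assumes "cell c \<subseteq> cell c'" "snd c = snd c'" shows "c = c'"
proof -
  have "fst c j = fst c' j" for j
  proof (cases "j \<in> snd c")
    case True
    have "(\<lambda>j. of_int (fst c j)) \<in> cell c'" "(\<lambda>k. of_int (fst c k) + (if k = j then 1 else 0)) \<in> cell c'"
      using cell_corner[of c] cell_corner_upd[OF True] assms by auto
    then show ?thesis
      using cellD(1)[of "\<lambda>j. of_int (fst c j)" c' j] 
        cellD(2)[of "\<lambda>k. of_int (fst c k) + (if k = j then 1 else 0)" c' j] by simp
  next
    case False
    then show ?thesis
      using cellD(3)[of "\<lambda>j. of_int (fst c j)" c' j] cell_corner[of c] assms by auto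
  qed
  then show ?thesis using assms(2) by (simp add: prod_eq_iff fun_eq_iff)
qed

lemma cell_facet:
  assumes x: "x \<in> cell_boundary c"
  obtains c' where "cell c' \<subseteq> cell c" "c' \<noteq> c" "x \<in> cell c'"
proof -
  obtain a J where c: "c = (a, J)" by (cases c)
  obtain j where j: "j \<in> J" "x j = of_int (a j) \<or> x j = of_int (a j) + 1" and xc: "x \<in> cell c"
    using x by (auto simp: cell_boundary_def c)
  define b where "b = (if x j = of_int (a j) then a j else a j + 1)"
  define c' where "c' = (a(j := b), J - {j})"
  have b: "x j = of_int b" "a j \<le> b" "b \<le> a j + 1"
    using j by (auto simp: b_def)
  show ?thesis
  proof
    show "cell c' \<subseteq> cell c"
    proof
      fix y assume y: "y \<in> cell c'"
      have yj: "y j = of_int b"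
        using cellD(3)[OF y, of j] by (simp add: c'_def)
      have b': "of_int (a j) \<le> (of_int b :: real)" "of_int b \<le> (of_int (a j) + 1 :: real)"
        using b by linarith+
      show "y \<in> cell c"
      proof (rule cellI)
        fix i
        show "of_int (fst c i) \<le> y i" "y i \<le> of_int (fst c i) + 1"
          using cellD(1,2)[OF y, of i] yj b' by (cases "i = j"; simp add: c c'_def)+
        show "y i = of_int (fst c i)" if "i \<notin> snd c"
          using cellD(3)[OF y, of i] that j by (cases "i = j") (auto simp: c c'_def)
      qed
    qed
    show "c' \<noteq> c" using j by (auto simp: c'_def c)
    show "x \<in> cell c'"
    proof (rule cellI)
      fix i
      show "of_int (fst c' i) \<le> x i" "x i \<le> of_int (fst c' i) + 1"
        using cellD(1,2)[OF xc, of i] b by (cases "i = j"; simp add: c c'_def)+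
      show "x i = of_int (fst c' i)" if "i \<notin> snd c'"
        using cellD(3)[OF xc, of i] that b by (cases "i = j") (auto simp: c c'_def)
    qed
  qed
qed

text \<open>An interior point lies strictly between consecutive integers in the directions of
  \<open>c\<close>, so \<open>c'\<close> must have the same unit interval there; in the other
  coordinates all of \<open>c\<close> agrees with \<open>x\<close>. Hence distinct cells overlap
  only along faces.\<close>

lemma cell_interior_meets:
  assumes x: "x \<in> cell c" "x \<notin> cell_boundary c" and x': "x \<in> cell c'"
  shows "cell c \<subseteq> cell c'"
proof
  have int: "of_int (fst c j) < x j" "x j < of_int (fst c j) + 1" if "j \<in> snd c" for j
    using x cellD(1,2)[OF x(1), of j] that by (auto simp: cell_boundary_def less_le)
  fix y assume y: "y \<in> cell c"
  show "y \<in> cell c'"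
  proof (rule cellI)
    fix j
    show "y j = of_int (fst c' j)" if j: "j \<notin> snd c'"
    proof (cases "j \<in> snd c")
      case True
      then have "of_int (fst c j) < (of_int (fst c' j) :: real)" "of_int (fst c' j) < (of_int (fst c j) + 1 :: real)"
        using int[OF True] cellD(3)[OF x' j] by auto
      then have "fst c j < fst c' j" "fst c' j < fst c j + 1"
        by (simp, metis of_int_1 of_int_add of_int_less_iff)
      then show ?thesis by simp
    next
      case False
      then show ?thesis using cellD(3)[OF x(1)] cellD(3)[OF x' j] cellD(3)[OF y] by simp
    qed
    show "of_int (fst c' j) \<le> y j" "y j \<le> of_int (fst c' j) + 1"
    proof -
      consider "j \<in> snd c" | "j \<notin> snd c" by blast
      then have "of_int (fst c' j) \<le> y j \<and> y j \<le> of_int (fst c' j) + 1"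
      proof cases
        case 1
        have "of_int (fst c' j) < (of_int (fst c j) + 1 :: real)" "of_int (fst c j) < (of_int (fst c' j) + 1 :: real)"
          using int[OF 1] cellD(1,2)[OF x', of j] by linarith+
        then have "fst c' j = fst c j" by linarith
        then show ?thesis using cellD(1,2)[OF y, of j] by simp
      next
        case 2
        then show ?thesis using cellD(3)[OF x(1)] cellD(1,2)[OF x', of j] cellD(3)[OF y] by simp
      qed
      then show "of_int (fst c' j) \<le> y j" "y j \<le> of_int (fst c' j) + 1" by auto
    qed
  qed
qed

text \<open>The set \<open>Y c\<close> carries the image of the cell \<open>c\<close>.\<close>

lemma carrier_extension:
  fixes Y :: "grid_cell \<Rightarrow> 'b::topological_space set"
  assumes "finite K" "L \<subseteq> K"
    and K_faces: "\<And>c c'. c \<in> K \<Longrightarrow> cell c' \<subseteq> cell c \<Longrightarrow> c' \<in> K"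
    and L_faces: "\<And>c c'. c \<in> L \<Longrightarrow> cell c' \<subseteq> cell c \<Longrightarrow> c' \<in> L"
    and mono: "\<And>c c'. c \<in> K \<Longrightarrow> cell c' \<subseteq> cell c \<Longrightarrow> Y c' \<subseteq> Y c"
    and fin: "\<And>c. c \<in> K \<Longrightarrow> finite (snd c)"
    and conn: "\<And>c. c \<in> K - L \<Longrightarrow> k_connected (int (card (snd c)) - 1) (top_of_set (Y c))"
    and g: "continuous_on (\<Union>c\<in>L. cell c) g" "\<And>c. c \<in> L \<Longrightarrow> g ` cell c \<subseteq> Y c"
  shows "\<exists>g'. continuous_on (\<Union>c\<in>K. cell c) g' \<and> (\<forall>c\<in>K. g' ` cell c \<subseteq> Y c) \<and>
    (\<forall>c\<in>L. \<forall>x\<in>cell c. g' x = g x)"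
  using assms(1,2) K_faces mono fin conn
proof (induction "card (K - L)" arbitrary: K)
  case 0
  then have "K = L" by auto
  then show ?case using g by (intro exI[of _ g]) blast
next
  case (Suc m)
  have ne: "finite (K - L)" "K - L \<noteq> {}" using Suc.hyps(2) Suc.prems(1) by (simp, metis card.empty nat.distinct(1))
  \<comment> \<open>A cell of top dimension outside \<open>L\<close> is taken away. It is a proper
    face of no cell of \<open>K\<close>, so the remaining cells are still closed under
    faces.\<close>
  define d where "d = Max ((\<lambda>c. card (snd c)) ` (K - L))"
  have "d \<in> (\<lambda>c. card (snd c)) ` (K - L)"
    unfolding d_def by (rule Max_in) (use ne in auto)
  then obtain c where c: "c \<in> K" "c \<notin> L" "card (snd c) = d" by auto
  have d: "card (snd c') \<le> card (snd c)" if "c' \<in> K" "c' \<notin> L" for c'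
    using that ne c(3) by (simp add: d_def)
  have c_max: "c' = c" if "c' \<in> K" "cell c \<subseteq> cell c'" for c'
  proof -
    have "c' \<notin> L" using L_faces[OF _ that(2)] c by auto
    then have "card (snd c') \<le> card (snd c)" using d that by auto
    then have "snd c = snd c'"
      using cell_subset_imp_dims[OF that(2)] Suc.prems(5)[OF that(1)] by (metis card_seteq)
    then show ?thesis using cell_subset_same_dims[OF that(2)] by simp
  qed
  define K' where "K' = K - {c}"
  have "\<exists>g'. continuous_on (\<Union>c\<in>K'. cell c) g' \<and> (\<forall>c\<in>K'. g' ` cell c \<subseteq> Y c) \<and>
    (\<forall>c\<in>L. \<forall>x\<in>cell c. g' x = g x)"
  proof (rule Suc.hyps(1))
    have "K' - L = (K - L) - {c}" by (auto simp: K'_def)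
    then show "m = card (K' - L)" using Suc.hyps(2) c ne by simp
    show "finite K'" "L \<subseteq> K'" using Suc.prems(1,2) c by (auto simp: K'_def)
    show "c'' \<in> K'" if "c' \<in> K'" "cell c'' \<subseteq> cell c'" for c' c''
      using Suc.prems(3)[of c' c''] c_max[of c'] that by (auto simp: K'_def)
    show "Y c'' \<subseteq> Y c'" if "c' \<in> K'" "cell c'' \<subseteq> cell c'" for c' c''
      using Suc.prems(4) that by (auto simp: K'_def)
    show "finite (snd c')" if "c' \<in> K'" for c'
      using Suc.prems(5) that by (auto simp: K'_def)
    show "k_connected (int (card (snd c')) - 1) (top_of_set (Y c'))" if "c' \<in> K' - L" for c'
      using Suc.prems(6) that by (auto simp: K'_def)
  qed
  then obtain g1 where g1: "continuous_on (\<Union>c\<in>K'. cell c) g1" "\<And>c. c\<in>K' \<Longrightarrow> g1 ` cell c \<subseteq> Y c"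
    "\<And>c x. c \<in> L \<Longrightarrow> x\<in>cell c \<Longrightarrow> g1 x = g x" by blast
  have bdry: "x \<in> (\<Union>c\<in>K'. cell c) \<and> g1 x \<in> Y c" if x: "x \<in> cell_boundary c" for x
  proof -
    obtain c' where c': "cell c' \<subseteq> cell c" "c' \<noteq> c" "x \<in> cell c'"
      using cell_facet[OF x] by metis
    then have "c' \<in> K'" using Suc.prems(3)[OF c(1)] by (auto simp: K'_def)
    then show ?thesis
      using c' g1(2)[of c'] Suc.prems(4)[OF c(1) c'(1)] by blast
  qed
  have "continuous_on (cell_boundary c) g1"
    by (rule continuous_on_subset[OF g1(1)]) (use bdry in blast)
  moreover have "g1 ` cell_boundary c \<subseteq> Y c" using bdry by blast
  moreover have "k_connected (int (card (snd c)) - 1) (top_of_set (Y c))" using Suc.prems(6) c by blast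
  ultimately obtain g2 where g2: "continuous_on (cell c) g2" "g2 ` cell c \<subseteq> Y c"
    "\<And>x. x \<in> cell_boundary c \<Longrightarrow> g2 x = g1 x"
    using cell_extension Suc.prems(5)[OF c(1)] by metis
  define S where "S = (\<Union>c\<in>K'. cell c)"
  define g' where "g' x = (if x \<in> S then g1 x else g2 x)" for x
  \<comment> \<open>The two pieces overlap only on the boundary of \<open>c\<close>: an interior
    point of \<open>c\<close> in another cell would put \<open>c\<close> inside that cell, against
    its maximality.\<close>
  have agree: "g1 x = g2 x" if "x \<in> S" "x \<in> cell c" for x
  proof -
    obtain c' where c': "c' \<in> K'" "x \<in> cell c'" using \<open>x \<in> S\<close> unfolding S_def by blast
    have "x \<in> cell_boundary c"
    proof (rule ccontr)
      assume "x \<notin> cell_boundary c"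
      then have "cell c \<subseteq> cell c'" using cell_interior_meets that(2) c'(2) by blast
      then show False using c_max[of c'] c'(1) by (auto simp: K'_def)
    qed
    then show ?thesis using g2(3) by simp
  qed
  have "closed S" unfolding S_def
    by (rule closed_UN) (use Suc.prems(1) in \<open>auto simp: K'_def closed_cell\<close>)
  then have "continuous_on (S \<union> cell c) g'"
    unfolding g'_def using closed_cell g1(1) g2(1) agree
    by (intro continuous_on_cases) (auto simp: S_def)
  moreover have "(\<Union>c\<in>K. cell c) = S \<union> cell c" using c by (auto simp: S_def K'_def)
  moreover have "g' ` cell c' \<subseteq> Y c'" if "c' \<in> K" for c'
  proof (cases "c' = c")
    case True
    have "g' x = g2 x" if "x \<in> cell c" for x using agree that by (auto simp: g'_def)
    then show ?thesis using True g2(2) by auto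
  next
    case False
    then have "c' \<in> K'" using that by (auto simp: K'_def)
    moreover from this have "g' x = g1 x" if "x \<in> cell c'" for x
      using that by (auto simp: g'_def S_def)
    ultimately show ?thesis using g1(2) by auto
  qed
  moreover have "g' x = g x" if "c' \<in> L" "x \<in> cell c'" for c' x
  proof -
    have "c' \<in> K'" using that(1) Suc.prems(2) c(2) by (auto simp: K'_def)
    then show ?thesis using g1(3)[OF that] that(2) by (auto simp: g'_def S_def)
  qed
  ultimately show ?case by metis
qed


section \<open>Connectivity of a union of two open sets\<close>

text \<open>Coordinates above \<open>n\<close> are dropped because the map is applied to points of a
  prism whose coordinate \<open>Suc n\<close> is the homotopy parameter.\<close>

definition normalize_vec :: "nat \<Rightarrow> (nat \<Rightarrow> real) \<Rightarrow> nat \<Rightarrow> real" where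
  "normalize_vec n x = (\<lambda>i. if i \<le> n then x i / sqrt (\<Sum>i\<le>n. (x i)\<^sup>2) else 0)"

lemma normalize_vec_in_unit_sphere:
  assumes "sup_norm n x \<noteq> 0" shows "normalize_vec n x \<in> unit_sphere n"
proof -
  define y where "y = (\<lambda>i. if i \<le> n then x i else 0)"
  have "\<not> (\<forall>i\<le>n. y i = 0)" using assms by (auto simp: sup_norm_eq_0_iff y_def)
  then have "(\<lambda>i. y i / sqrt (\<Sum>i\<le>n. (y i)\<^sup>2)) \<in> unit_sphere n"
    by (intro unit_sphere_normalize(1)) (auto simp: y_def)
  also have "(\<lambda>i. y i / sqrt (\<Sum>i\<le>n. (y i)\<^sup>2)) = normalize_vec n x"
    by (auto simp: y_def normalize_vec_def fun_eq_iff)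
  finally show ?thesis .
qed

lemma normalize_vec_scale:
  assumes "c > 0" "\<And>i. i \<le> n \<Longrightarrow> y i = c * x i"
  shows "normalize_vec n y = normalize_vec n x"
proof -
  have "(\<Sum>i\<le>n. (y i)\<^sup>2) = c\<^sup>2 * (\<Sum>i\<le>n. (x i)\<^sup>2)"
    using assms(2) by (simp add: power_mult_distrib sum_distrib_left)
  then have "sqrt (\<Sum>i\<le>n. (y i)\<^sup>2) = c * sqrt (\<Sum>i\<le>n. (x i)\<^sup>2)"
    using assms(1) by (simp add: real_sqrt_mult)
  then show ?thesis
    using assms by (auto simp: normalize_vec_def fun_eq_iff)
qed

lemma normalize_vec_unit_sphere: "x \<in> unit_sphere n \<Longrightarrow> normalize_vec n x = x"
  by (auto simp: normalize_vec_def unit_sphere_def fun_eq_iff)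

lemma continuous_on_normalize_vec: "continuous_on {x. sup_norm n x \<noteq> 0} (normalize_vec n)"
proof (rule continuous_on_coordinatewise_then_product)
  fix i
  have coord: "continuous_on S (\<lambda>x. x i :: real)" for S and i :: nat
    by (rule continuous_on_subset[OF continuous_on_product_coordinates]) simp
  have "sqrt (\<Sum>i\<le>n. (x i)\<^sup>2) \<noteq> 0" if "sup_norm n x \<noteq> 0" for x :: "nat \<Rightarrow> real"
    using that by (auto simp: sup_norm_eq_0_iff sum_nonneg_eq_0_iff)
  then have "continuous_on {x. sup_norm n x \<noteq> 0} (\<lambda>x. x i / sqrt (\<Sum>i\<le>n. (x i)\<^sup>2))"
    by (intro continuous_on_divide continuous_on_real_sqrt continuous_on_sum continuous_on_power coord) auto
  then show "continuous_on {x. sup_norm n x \<noteq> 0} (\<lambda>x. normalize_vec n x i)"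
    by (cases "i \<le> n") (auto simp: normalize_vec_def)
qed

text \<open>The distance of functions is a sum over the coordinates with weights that are powers of
  1/2: \<open>2 * e\<close> accounts for an initial segment and \<open>(1/2) ^ N\<close> for the
  tail.\<close>

lemma dist_fun_le:
  fixes x y :: "nat \<Rightarrow> real"
  assumes "\<And>j. \<bar>x j - y j\<bar> \<le> e"
  shows "dist x y \<le> 2 * e + (1/2) ^ N"
proof -
  have "Max {dist (x (from_nat m)) (y (from_nat m)) | m. m \<le> N} \<le> e"
    using assms by (subst Max_le_iff) (auto simp: dist_real_def)
  then show ?thesis
    using dist_fun_le_dist_first_terms[of x y N] by linarith
qed

text \<open>A Lebesgue number argument on the surface of the unit cube. Instead of making the grid
  finer, the cube is enlarged to sup-norm \<open>M\<close>, so that the cells keep side one and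
  integral corners.\<close>

lemma fine_subdivision:
  fixes f :: "(nat \<Rightarrow> real) \<Rightarrow> 'b::topological_space"
  assumes f: "continuous_on (unit_sphere n) f" "f ` unit_sphere n \<subseteq> A \<union> B"
    and A: "openin (top_of_set (A \<union> B)) A" and B: "openin (top_of_set (A \<union> B)) B"
  obtains M :: nat where "M > 0"
    "\<And>T. (\<And>x. x \<in> T \<Longrightarrow> sup_norm n x = real M) \<Longrightarrow>
       (\<And>x y j. x \<in> T \<Longrightarrow> y \<in> T \<Longrightarrow> \<bar>x j - y j\<bar> \<le> 1) \<Longrightarrow>
       (\<forall>x\<in>T. f (normalize_vec n x) \<in> A) \<or> (\<forall>x\<in>T. f (normalize_vec n x) \<in> B)"
proof -
  define C where "C = {x. sup_norm n x = 1 \<and> (\<forall>j>n. x j = 0)}"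
  define \<phi> where "\<phi> = (\<lambda>x. f (normalize_vec n x))"
  have coord: "continuous_on UNIV (\<lambda>x. x i :: real)" for i :: nat
    by (rule continuous_on_product_coordinates)
  have "closed C"
    unfolding C_def
    by (intro closed_Collect_conj closed_Collect_all closed_Collect_imp closed_Collect_eq
        open_Collect_const continuous_on_sup_norm continuous_on_id continuous_on_const coord)
  moreover have "C \<subseteq> {x. \<forall>i. (- 1) \<le> x i \<and> x i \<le> 1}"
  proof
    fix x assume x: "x \<in> C"
    have "\<bar>x i\<bar> \<le> 1" for i
      using x abs_le_sup_norm[of i n x] by (cases "i \<le> n") (auto simp: C_def)
    then show "x \<in> {x. \<forall>i. (- 1) \<le> x i \<and> x i \<le> 1}"
      by (simp add: abs_le_iff minus_le_iff)
  qed
  ultimately have "compact C"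
    using compact_Int_closed[OF compact_box[of "\<lambda>_. - 1" "\<lambda>_. 1"], of C]
    by (simp add: Int_absorb1)
  have phi: "continuous_on C \<phi>" unfolding \<phi>_def
    by (rule continuous_on_compose2[OF f(1)])
      (auto intro!: continuous_on_subset[OF continuous_on_normalize_vec] normalize_vec_in_unit_sphere simp: C_def)
  have phi_im: "\<phi> \<in> C \<rightarrow> A \<union> B"
    using f(2) normalize_vec_in_unit_sphere[of n] by (auto simp: \<phi>_def C_def image_subset_iff)
  have "openin (top_of_set C) (C \<inter> \<phi> -` A)" "openin (top_of_set C) (C \<inter> \<phi> -` B)"
    using continuous_openin_preimage[OF phi phi_im] A B by auto
  then obtain UA UB where UA: "open UA" "C \<inter> \<phi> -` A = C \<inter> UA" and UB: "open UB" "C \<inter> \<phi> -` B = C \<inter> UB"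
    by (auto simp: openin_open)
  have "C \<subseteq> \<Union>{UA, UB}"
  proof
    fix x assume "x \<in> C"
    then have "x \<in> C \<inter> \<phi> -` A \<or> x \<in> C \<inter> \<phi> -` B" using phi_im by auto
    then show "x \<in> \<Union>{UA, UB}" unfolding UA(2) UB(2) by auto
  qed
  then obtain \<epsilon> where eps: "0 < \<epsilon>" "\<And>x. x \<in> C \<Longrightarrow> \<exists>G\<in>{UA, UB}. ball x \<epsilon> \<subseteq> G"
    using Heine_Borel_lemma[OF \<open>compact C\<close>, of "{UA, UB}"] UA(1) UB(1) by auto
  obtain N where N: "(1/2::real) ^ N < \<epsilon> / 2"
    using real_arch_pow_inv[of "\<epsilon> / 2" "1/2"] eps(1) by auto
  \<comment> \<open>The constant 4 makes \<open>2 * (1 / M)\<close> less than half of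
    \<open>\<epsilon>\<close>; the other half is left for the tail \<open>(1/2) ^ N\<close>.\<close>
  obtain M :: nat where M: "real M > 4 / \<epsilon>" using reals_Archimedean2 by blast
  have M0: "M > 0" using M eps(1) by (metis divide_pos_pos gr0I less_asym of_nat_0 zero_less_numeral)
  have small: "2 * (1 / real M) + (1/2) ^ N < \<epsilon>"
  proof -
    have "2 * (1 / real M) < \<epsilon> / 2"
      using M eps(1) M0 by (simp add: field_simps)
    then show ?thesis using N by linarith
  qed
  show ?thesis
  proof (rule that[OF M0])
    fix T :: "(nat \<Rightarrow> real) set"
    assume T: "\<And>x. x \<in> T \<Longrightarrow> sup_norm n x = real M"
      and T_small: "\<And>x y j. x \<in> T \<Longrightarrow> y \<in> T \<Longrightarrow> \<bar>x j - y j\<bar> \<le> 1"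
    define r where "r = (\<lambda>x j. if j \<le> n then 1 / real M * x j else (0::real))"
    have rC: "r x \<in> C" if "x \<in> T" for x
    proof -
      have "sup_norm n (r x) = 1 / real M * sup_norm n x"
        by (rule sup_norm_scale) (auto simp: r_def)
      then show ?thesis using T[OF that] M0 by (simp add: C_def r_def)
    qed
    have phi_r: "\<phi> (r x) = f (normalize_vec n x)" for x
      unfolding \<phi>_def by (subst normalize_vec_scale[of "1 / real M" n "r x" x]) (use M0 in \<open>auto simp: r_def\<close>)
    have close: "dist (r x) (r y) < \<epsilon>" if "x \<in> T" "y \<in> T" for x y
    proof -
      have "\<bar>r x j - r y j\<bar> \<le> 1 / real M" for j
      proof (cases "j \<le> n")
        case True
        then have "r x j - r y j = 1 / real M * (x j - y j)" by (simp add: r_def diff_divide_distrib)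
        then show ?thesis using T_small[OF that, of j] M0 by (simp add: abs_mult divide_simps)
      qed (auto simp: r_def)
      then have "dist (r x) (r y) \<le> 2 * (1 / real M) + (1/2) ^ N" by (rule dist_fun_le)
      then show ?thesis using small by linarith
    qed
    show "(\<forall>x\<in>T. f (normalize_vec n x) \<in> A) \<or> (\<forall>x\<in>T. f (normalize_vec n x) \<in> B)"
    proof (cases "T = {}")
      case False
      then obtain x where x: "x \<in> T" by blast
      have ball: "r y \<in> ball (r x) \<epsilon>" if "y \<in> T" for y using close[OF x that] by simp
      have "ball (r x) \<epsilon> \<subseteq> UA \<or> ball (r x) \<epsilon> \<subseteq> UB" using eps(2)[OF rC[OF x]] by simp
      then show ?thesis
      proof
        assume "ball (r x) \<epsilon> \<subseteq> UA"
        then have "r y \<in> C \<inter> \<phi> -` A" if "y \<in> T" for y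
          unfolding UA(2) using ball[OF that] rC[OF that] by blast
        then show ?thesis by (auto simp: phi_r)
      next
        assume "ball (r x) \<epsilon> \<subseteq> UB"
        then have "r y \<in> C \<inter> \<phi> -` B" if "y \<in> T" for y
          unfolding UB(2) using ball[OF that] rC[OF that] by blast
        then show ?thesis by (auto simp: phi_r)
      qed
    qed simp
  qed
qed

section \<open>Null-homotopies over a prism\<close>

text \<open>A cell of dimension \<open>m\<close> needs an \<open>(m - 1)\<close>-connected target,
  and the prism over the \<open>n\<close>-sphere has cells of dimension at most
  \<open>n + 1 \<le> k + 1\<close>. The intersection \<open>A \<inter> B\<close> is one degree worse
  than \<open>A\<close> and \<open>B\<close>, but it is the target only of proper faces of other
  cells, whose dimension is at least one smaller.\<close>

lemma k_connected_open_Un: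
  fixes A B :: "'b::topological_space set"
  assumes oA: "openin (top_of_set (A \<union> B)) A" and oB: "openin (top_of_set (A \<union> B)) B"
    and A: "k_connected k (top_of_set A)" and B: "k_connected k (top_of_set B)"
    and AB: "k_connected (k - 1) (top_of_set (A \<inter> B))"
  shows "k_connected k (top_of_set (A \<union> B))"
  unfolding k_connected_def
proof (intro conjI impI allI)
  assume "- 1 \<le> k"
  then show "topspace (top_of_set (A \<union> B)) \<noteq> {}"
    using A by (auto simp: k_connected_def)
next
  fix n f assume nk: "int n \<le> k" and "continuous_map (nsphere n) (top_of_set (A \<union> B)) f"
  then have f: "continuous_on (unit_sphere n) f" "f ` unit_sphere n \<subseteq> A \<union> B"
    by (auto simp: nsphere_eq_unit_sphere)
  obtain b where b: "b \<in> A" "b \<in> B" using AB nk by (auto simp: k_connected_def)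
  obtain M :: nat where M: "M > 0" and M_small:
    "\<And>T. (\<And>x. x \<in> T \<Longrightarrow> sup_norm n x = real M) \<Longrightarrow>
       (\<And>x y j. x \<in> T \<Longrightarrow> y \<in> T \<Longrightarrow> \<bar>x j - y j\<bar> \<le> 1) \<Longrightarrow>
       (\<forall>x\<in>T. f (normalize_vec n x) \<in> A) \<or> (\<forall>x\<in>T. f (normalize_vec n x) \<in> B)"
    using fine_subdivision[OF f oA oB] by blast
  define F where "F = (\<lambda>x. f (normalize_vec n x))"
  \<comment> \<open>The prism over the surface of the cube of half-side \<open>M\<close>; coordinate
    \<open>Suc n\<close> is the height, which \<open>F\<close> ignores. The null-homotopy sought is
    an extension to \<open>P\<close> of the map that is \<open>F\<close> at height 0 and
    \<open>b\<close> at height 1.\<close>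
  define P where "P = {x. sup_norm n x = real M \<and> 0 \<le> x (Suc n) \<and> x (Suc n) \<le> 1 \<and> (\<forall>j>Suc n. x j = 0)}"
  define K where "K = {c. cell c \<subseteq> P}"
  define L where "L = {c \<in> K. Suc n \<notin> snd c}"
  \<comment> \<open>For cells of \<open>K\<close> this is \<open>B\<close> if the cell is not sent
    into \<open>A\<close>, \<open>A \<inter> B\<close> if it is but some larger cell is not, and
    \<open>A\<close> otherwise. Quantifying over the cells above \<open>c\<close> makes
    \<open>Y\<close> monotone.\<close>
  define Y where "Y c = {y \<in> A \<union> B. (F ` cell c \<subseteq> A \<longrightarrow> y \<in> A) \<and>
    ((\<exists>c'\<in>K. cell c \<subseteq> cell c' \<and> \<not> F ` cell c' \<subseteq> A) \<longrightarrow> y \<in> B)}" for c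
  define g where "g x = (if x (Suc n) = 0 then F x else b)" for x
  have F_P: "F x \<in> A \<union> B" if "x \<in> P" for x
    using normalize_vec_in_unit_sphere[of n x] f(2) that M by (auto simp: F_def P_def)
  have F_cont: "continuous_on P F" unfolding F_def
    by (rule continuous_on_compose2[OF f(1)])
      (use M in \<open>auto intro!: continuous_on_subset[OF continuous_on_normalize_vec]
         normalize_vec_in_unit_sphere simp: P_def\<close>)
  have F_cell: "F ` cell c \<subseteq> A \<or> F ` cell c \<subseteq> B" if "c \<in> K" for c
  proof -
    have "(\<forall>x\<in>cell c. f (normalize_vec n x) \<in> A) \<or> (\<forall>x\<in>cell c. f (normalize_vec n x) \<in> B)"
    proof (rule M_small)
      show "sup_norm n x = real M" if "x \<in> cell c" for x
        using that \<open>c \<in> K\<close> by (auto simp: K_def P_def)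
      show "\<bar>x j - y j\<bar> \<le> 1" if "x \<in> cell c" "y \<in> cell c" for x y j
        using cellD(1,2)[OF that(1), of j] cellD(1,2)[OF that(2), of j] by (auto simp: abs_le_iff)
    qed
    then show ?thesis by (auto simp: F_def)
  qed
  have corner: "(\<lambda>j. of_int (fst c j)) \<in> P" if "c \<in> K" for c
    using that cell_corner[of c] by (auto simp: K_def)
  have corner_upd: "(\<lambda>j. of_int (fst c j) + (if j = i then 1 else 0)) \<in> P" if "c \<in> K" "i \<in> snd c" for c i
    using that cell_corner_upd[of i c] unfolding K_def by blast
  have K_dims: "snd c \<subseteq> {..Suc n}" if "c \<in> K" for c
  proof
    fix i assume i: "i \<in> snd c"
    show "i \<in> {..Suc n}"
    proof (rule ccontr)
      assume "i \<notin> {..Suc n}"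
      then have "i > Suc n" by simp
      then have "of_int (fst c i) = (0::real)" "of_int (fst c i) + 1 = (0::real)"
        using corner[OF that] corner_upd[OF that i] by (auto simp: P_def)
      then show False by simp
    qed
  qed
  have K_fin: "finite (snd c)" if "c \<in> K" for c
    using K_dims[OF that] finite_subset by blast
  have K_card: "card (snd c) \<le> Suc n" if "c \<in> K" for c
  proof -
    \<comment> \<open>The surface of the cube has dimension \<open>n\<close>: a cell extended in all
      directions up to \<open>n\<close> would contain a midpoint with half-integral coordinates
      there, whose sup-norm cannot be \<open>M\<close>.\<close>
    have "\<exists>i\<le>n. i \<notin> snd c"
    proof (rule ccontr)
      assume H: "\<not> (\<exists>i\<le>n. i \<notin> snd c)"
      define x where "x = (\<lambda>j. of_int (fst c j) + (if j \<in> snd c then 1/2 else 0 :: real))"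
      have "x \<in> cell c" by (auto simp: x_def cell_def)
      then have "sup_norm n x = real M" using that by (auto simp: K_def P_def)
      then obtain i where i: "i \<le> n" "\<bar>x i\<bar> = real M" by (metis sup_norm_attained)
      then have "\<bar>2 * of_int (fst c i) + 1\<bar> = 2 * real M" using H by (auto simp: x_def)
      then have "of_int \<bar>2 * fst c i + 1\<bar> = (of_int (2 * int M) :: real)" by simp
      then have "\<bar>2 * fst c i + 1\<bar> = 2 * int M" by linarith
      then show False by presburger
    qed
    then obtain i where "i \<le> n" "i \<notin> snd c" by blast
    then have "snd c \<subseteq> {..Suc n} - {i}" "card ({..Suc n} - {i}) = Suc n"
      using K_dims[OF that] by auto
    then show ?thesis by (metis card_mono finite_Diff finite_atMost)
  qed
  have "finite K"
  proof (rule finite_subset)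
    let ?Z = "{a :: nat \<Rightarrow> int. \<forall>j. (j \<in> {..Suc n} \<longrightarrow> a j \<in> {- int M - 1..int M + 1}) \<and> (j \<notin> {..Suc n} \<longrightarrow> a j = 0)}"
    show "K \<subseteq> ?Z \<times> Pow {..Suc n}"
    proof
      fix c assume c: "c \<in> K"
      have "fst c \<in> ?Z"
      proof (intro CollectI allI conjI impI)
        fix j
        have "\<bar>of_int (fst c j)\<bar> \<le> real M" if "j \<le> n"
          using corner[OF c] abs_le_sup_norm[OF that, of "\<lambda>j. of_int (fst c j)"] by (simp add: P_def)
        then have "\<bar>fst c j\<bar> \<le> int M" if "j \<le> n" using that by linarith
        moreover have "0 \<le> fst c (Suc n)" "fst c (Suc n) \<le> 1"
          using corner[OF c] by (auto simp: P_def)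
        ultimately show "fst c j \<in> {- int M - 1..int M + 1}" if "j \<in> {..Suc n}"
          using that by (cases "j = Suc n") (auto simp: abs_le_iff)
        show "fst c j = 0" if "j \<notin> {..Suc n}"
          using corner[OF c] that by (auto simp: P_def)
      qed
      then show "c \<in> ?Z \<times> Pow {..Suc n}" using K_dims[OF c] by (cases c) auto
    qed
    show "finite (?Z \<times> Pow {..Suc n})"
      by (intro finite_cartesian_product finite_set_of_finite_funs) auto
  qed
  have K_faces: "c' \<in> K" if "c \<in> K" "cell c' \<subseteq> cell c" for c c'
    using that by (auto simp: K_def)
  have L_faces: "c' \<in> L" if "c \<in> L" "cell c' \<subseteq> cell c" for c c'
    using that K_faces[of c c'] cell_subset_imp_dims[of c' c] unfolding L_def by blast
  have Y_mono: "Y c' \<subseteq> Y c" if "c \<in> K" "cell c' \<subseteq> cell c" for c c'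
    using that unfolding Y_def by blast
  have Y_conn: "k_connected (int (card (snd c)) - 1) (top_of_set (Y c))" if c: "c \<in> K - L" for c
  proof -
    have cK: "c \<in> K" using c by simp
    show ?thesis
    proof (cases "F ` cell c \<subseteq> A")
      case True
      show ?thesis
      proof (cases "\<exists>c'\<in>K. cell c \<subseteq> cell c' \<and> \<not> F ` cell c' \<subseteq> A")
        case True
        then obtain c' where c': "c' \<in> K" "cell c \<subseteq> cell c'" "\<not> F ` cell c' \<subseteq> A" by blast
        have "Y c = A \<inter> B" using True \<open>F ` cell c \<subseteq> A\<close> unfolding Y_def by blast
        moreover have "snd c \<noteq> snd c'" using cell_subset_same_dims[OF c'(2)] c'(3) \<open>F ` cell c \<subseteq> A\<close> by auto
        then have "card (snd c) < card (snd c')"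
          using cell_subset_imp_dims[OF c'(2)] K_fin[OF c'(1)] by (simp add: psubset_card_mono psubset_eq)
        then have "int (card (snd c)) - 1 \<le> k - 1" using K_card[OF c'(1)] nk by linarith
        ultimately show ?thesis using k_connected_mono[OF AB] by simp
      next
        case False
        then have "Y c = A" using \<open>F ` cell c \<subseteq> A\<close> unfolding Y_def by blast
        moreover have "int (card (snd c)) - 1 \<le> k" using K_card[OF cK] nk by linarith
        ultimately show ?thesis using k_connected_mono[OF A] by simp
      qed
    next
      case False
      then have "Y c = B" using cK unfolding Y_def by blast
      moreover have "int (card (snd c)) - 1 \<le> k" using K_card[OF cK] nk by linarith
      ultimately show ?thesis using k_connected_mono[OF B] by simp
    qed
  qed
  have LP: "cell c \<subseteq> P" if "c \<in> L" for c using that by (auto simp: L_def K_def)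
  have g_cont: "continuous_on (\<Union>c\<in>L. cell c) g"
  proof (rule continuous_on_closed_Union)
    show "finite L" using \<open>finite K\<close> by (auto simp: L_def)
    fix c assume c: "c \<in> L"
    show "closed (cell c)" by (rule closed_cell)
    have cn: "x (Suc n) = of_int (fst c (Suc n))" if "x \<in> cell c" for x
      using cellD(3)[OF that, of "Suc n"] c by (auto simp: L_def)
    show "continuous_on (cell c) g"
    proof (cases "fst c (Suc n) = 0")
      case True
      then have "g x = F x" if "x \<in> cell c" for x using cn[OF that] by (simp add: g_def)
      moreover have "continuous_on (cell c) F" using F_cont LP[OF c] continuous_on_subset by blast
      ultimately show ?thesis by (simp cong: continuous_on_cong)
    next
      case False
      then have "g x = b" if "x \<in> cell c" for x using cn[OF that] by (simp add: g_def)
      then show ?thesis by (simp cong: continuous_on_cong)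
    qed
  qed
  have g_Y: "g ` cell c \<subseteq> Y c" if c: "c \<in> L" for c
  proof -
    \<comment> \<open>If a cell above \<open>c\<close> is not sent into \<open>A\<close>, then
      \<open>F_cell\<close> sends it into \<open>B\<close>, and \<open>x\<close> with it.\<close>
    have "F x \<in> Y c" if x: "x \<in> cell c" for x
      using F_P[of x] LP[OF c] x F_cell unfolding Y_def by blast
    moreover have "b \<in> Y c" using b by (auto simp: Y_def)
    ultimately show ?thesis by (auto simp: g_def)
  qed
  have "\<exists>G. continuous_on (\<Union>c\<in>K. cell c) G \<and> (\<forall>c\<in>K. G ` cell c \<subseteq> Y c) \<and>
    (\<forall>c\<in>L. \<forall>x\<in>cell c. G x = g x)"
    by (rule carrier_extension[OF \<open>finite K\<close>]; (fact K_faces L_faces Y_mono K_fin Y_conn g_cont g_Y)?)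
      (auto simp: L_def)
  then obtain G where G: "continuous_on (\<Union>c\<in>K. cell c) G" "\<forall>c\<in>K. G ` cell c \<subseteq> Y c"
    "\<forall>c\<in>L. \<forall>x\<in>cell c. G x = g x"
    by blast
  have P_cell: "\<exists>c\<in>K. x \<in> cell c \<and> (x (Suc n) \<in> {0, 1} \<longrightarrow> c \<in> L)" if x: "x \<in> P" for x
  proof -
    \<comment> \<open>The smallest grid cell around \<open>x\<close>: integral coordinates are
      pinned. At heights 0 and 1 the coordinate \<open>Suc n\<close> is integral, so the cell lies
      in \<open>L\<close>.\<close>
    define c where "c = ((\<lambda>j. \<lfloor>x j\<rfloor>), {j. x j \<notin> \<int>})"
    have fix_int: "y j = x j" if "y \<in> cell c" "x j \<in> \<int>" for y j
      using cellD(3)[OF that(1), of j] that(2) by (auto simp: c_def elim: Ints_cases)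
    have between: "of_int a \<le> y j \<and> y j \<le> of_int b'"
      if "y \<in> cell c" "of_int a \<le> x j" "x j \<le> of_int b'" for y j a b'
    proof (cases "x j \<in> \<int>")
      case True
      then show ?thesis using fix_int[OF that(1)] that by simp
    next
      case False
      then have "x j < of_int b'" using that(3) by (metis Ints_of_int less_eq_real_def)
      then have "a \<le> \<lfloor>x j\<rfloor>" "\<lfloor>x j\<rfloor> + 1 \<le> b'" using that(2) by linarith+
      then show ?thesis using cellD(1,2)[OF that(1), of j] unfolding c_def fst_conv by linarith
    qed
    have "cell c \<subseteq> P"
    proof
      fix y assume y: "y \<in> cell c"
      obtain i where i: "i \<le> n" "\<bar>x i\<bar> = real M" using x by (metis (mono_tags) P_def mem_Collect_eq sup_norm_attained)
      then have "x i \<in> \<int>" by (metis Ints_of_nat Ints_minus abs_if minus_minus)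
      then have yi: "\<bar>y i\<bar> = real M" using fix_int[OF y] i by simp
      have "\<bar>y j\<bar> \<le> real M" if "j \<le> n" for j
      proof -
        have "\<bar>x j\<bar> \<le> real M" using abs_le_sup_norm[OF that, of x] x by (simp add: P_def)
        then show ?thesis using between[OF y, of "- int M" j "int M"] by (simp add: abs_le_iff)
      qed
      then have "sup_norm n y = real M"
        using yi i(1) by (metis abs_le_sup_norm order_antisym sup_norm_attained)
      moreover have "0 \<le> y (Suc n) \<and> y (Suc n) \<le> 1"
        using between[OF y, of 0 "Suc n" 1] x by (simp add: P_def)
      moreover have "y j = 0" if "j > Suc n" for j
        using fix_int[OF y, of j] x that by (simp add: P_def)
      ultimately show "y \<in> P" by (simp add: P_def)
    qed
    moreover have "x \<in> cell c"
      by (rule cellI) (auto simp: c_def elim: Ints_cases intro: real_of_int_floor_add_one_ge)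
    ultimately show ?thesis by (intro bexI[of _ c]) (auto simp: K_def L_def c_def)
  qed
  \<comment> \<open>Scales the round sphere to sup-norm \<open>M\<close>, which
    \<open>normalize_vec\<close> undoes, and uses \<open>t\<close> as the height.\<close>
  define \<psi> where "\<psi> = (\<lambda>(t, x) j. if j \<le> n then real M / sup_norm n x * x j else if j = Suc n then t else (0::real))"
  have psi_P: "\<psi> (t, x) \<in> P" if "x \<in> unit_sphere n" "t \<in> {0..1}" for t x
  proof -
    have "sup_norm n (\<psi> (t, x)) = real M / sup_norm n x * sup_norm n x"
      by (rule sup_norm_scale) (auto simp: \<psi>_def sup_norm_nonneg)
    then show ?thesis using sup_norm_pos[OF that(1)] that(2) by (auto simp: P_def \<psi>_def)
  qed
  have psi_cont: "continuous_on ({0..1} \<times> unit_sphere n) \<psi>"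
  proof (rule continuous_on_coordinatewise_then_product)
    fix j
    have nz: "\<forall>p\<in>{0..1::real} \<times> unit_sphere n. sup_norm n (snd p) \<noteq> 0"
      using sup_norm_pos by fastforce
    have "continuous_on ({0..1::real} \<times> unit_sphere n) (\<lambda>p. real M / sup_norm n (snd p) * snd p j)"
      using nz by (intro continuous_on_mult continuous_on_divide continuous_on_const continuous_on_sup_norm
          continuous_on_product_then_coordinatewise[where f = snd] continuous_on_snd continuous_on_id)
    moreover have "continuous_on ({0..1::real} \<times> unit_sphere n) fst"
      by (intro continuous_on_fst continuous_on_id)
    ultimately show "continuous_on ({0..1} \<times> unit_sphere n) (\<lambda>p. \<psi> p j)"
      unfolding \<psi>_def case_prod_unfold by (cases "j \<le> n"; cases "j = Suc n"; simp)
  qed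
  have PK: "P \<subseteq> (\<Union>c\<in>K. cell c)" using P_cell by blast
  have "continuous_on ({0..1} \<times> unit_sphere n) (\<lambda>p. G (\<psi> p))"
    by (rule continuous_on_compose2[OF G(1) psi_cont]) (use psi_P PK in blast)
  moreover have "G (\<psi> p) \<in> A \<union> B" if "p \<in> {0..1} \<times> unit_sphere n" for p
  proof -
    have "\<psi> p \<in> P" using psi_P that by auto
    then obtain c where "c \<in> K" "\<psi> p \<in> cell c" using PK by blast
    then have "G (\<psi> p) \<in> Y c" using G(2) by blast
    then show ?thesis by (simp add: Y_def)
  qed
  ultimately have "continuous_map (prod_topology (top_of_set {0..1}) (nsphere n)) (top_of_set (A \<union> B)) (\<lambda>p. G (\<psi> p))"
    unfolding nsphere_eq_unit_sphere prod_topology_subtopology_eu continuous_map_subtopology_eu by blast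
  moreover have "G (\<psi> (0, x)) = f x" if x: "x \<in> unit_sphere n" for x
  proof -
    have "\<psi> (0, x) (Suc n) = 0" by (simp add: \<psi>_def)
    then have "G (\<psi> (0, x)) = F (\<psi> (0, x))"
      using P_cell[OF psi_P[OF x, of 0]] G(3) by (auto simp: g_def)
    also have "\<dots> = f x"
      unfolding F_def using sup_norm_pos[OF x] M
      by (subst normalize_vec_scale[of "real M / sup_norm n x" n _ x])
        (auto simp: \<psi>_def normalize_vec_unit_sphere[OF x])
    finally show ?thesis .
  qed
  moreover have "G (\<psi> (1, x)) = b" if x: "x \<in> unit_sphere n" for x
  proof -
    have "\<psi> (1, x) (Suc n) = 1" by (simp add: \<psi>_def)
    then show ?thesis
      using P_cell[OF psi_P[OF x, of 1]] G(3) by (auto simp: g_def)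
  qed
  ultimately have "homotopic_with (\<lambda>_. True) (nsphere n) (top_of_set (A \<union> B)) f (\<lambda>_. b)"
    by (subst homotopic_with) (auto simp: nsphere_eq_unit_sphere)
  then show "\<exists>a\<in>topspace (top_of_set (A \<union> B)). homotopic_with (\<lambda>_. True) (nsphere n) (top_of_set (A \<union> B)) f (\<lambda>_. a)"
    using b by auto
qed

section \<open>Connectivity of simplicial complexes\<close>

text \<open>A null-homotopy of \<open>r \<circ> f\<close> is carried back by \<open>s\<close>, and
  \<open>s \<circ> r \<circ> f\<close> is homotopic to \<open>f\<close>.\<close>

lemma k_connected_dominated:
  assumes r: "continuous_map X Y r" and s: "continuous_map Y X s"
    and hom: "homotopic_with (\<lambda>_. True) X X id (s \<circ> r)" and Y: "k_connected k Y"
  shows "k_connected k X"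
  unfolding k_connected_def
proof (intro conjI impI allI)
  assume "- 1 \<le> k"
  then show "topspace X \<noteq> {}"
    using Y continuous_map_image_subset_topspace[OF s] unfolding k_connected_def by blast
next
  fix i f assume i: "int i \<le> k" and f: "continuous_map (nsphere i) X f"
  obtain a where a: "a \<in> topspace Y" "homotopic_with (\<lambda>_. True) (nsphere i) Y (r \<circ> f) (\<lambda>_. a)"
    using Y i continuous_map_compose[OF f r] unfolding k_connected_def by blast
  have "homotopic_with (\<lambda>_. True) (nsphere i) X (id \<circ> f) (s \<circ> r \<circ> f)"
    by (rule homotopic_with_compose_continuous_map_right[OF hom f]) simp
  moreover have "homotopic_with (\<lambda>_. True) (nsphere i) X (s \<circ> (r \<circ> f)) (s \<circ> (\<lambda>_. a))"
    by (rule homotopic_with_compose_continuous_map_left[OF a(2) s]) simp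
  ultimately have "homotopic_with (\<lambda>_. True) (nsphere i) X f (\<lambda>_. s a)"
    unfolding o_def id_def by (rule homotopic_with_trans)
  then show "\<exists>a\<in>topspace X. homotopic_with (\<lambda>_. True) (nsphere i) X f (\<lambda>_. a)"
    using a(1) s by (auto simp: continuous_map_def)
qed

lemma k_connected_contractible:
  assumes "a \<in> topspace X" and hom: "homotopic_with (\<lambda>_. True) X X id (\<lambda>_. a)"
  shows "k_connected k X"
  unfolding k_connected_def
proof (intro conjI impI allI)
  show "topspace X \<noteq> {}" using assms(1) by blast
next
  fix i f assume f: "continuous_map (nsphere i) X f"
  have "homotopic_with (\<lambda>_. True) (nsphere i) X (id \<circ> f) ((\<lambda>_. a) \<circ> f)"
    by (rule homotopic_with_compose_continuous_map_right[OF hom f]) simp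
  then show "\<exists>a\<in>topspace X. homotopic_with (\<lambda>_. True) (nsphere i) X f (\<lambda>_. a)"
    using assms(1) by (auto simp: o_def)
qed

section \<open>Realizations and straight-line homotopies\<close>

definition realization :: "'a set set \<Rightarrow> ('a \<Rightarrow> real) set" where
  "realization \<Delta> = {x. (\<forall>v. 0 \<le> x v) \<and> {v. x v \<noteq> 0} \<in> \<Delta> \<and> (\<Sum>v | x v \<noteq> 0. x v) = 1}"

lemma geometric_realization_eq: "geometric_realization \<Delta> = top_of_set (realization \<Delta>)"
  by (simp add: geometric_realization_def realization_def euclidean_product_topology)

definition simplicial :: "'a set set \<Rightarrow> bool" where
  "simplicial \<Delta> \<longleftrightarrow> (\<forall>F\<in>\<Delta>. finite F \<and> (\<forall>G\<subseteq>F. G \<in> \<Delta>))"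

lemma sum_support: "finite U \<Longrightarrow> {v. x v \<noteq> 0} \<subseteq> U \<Longrightarrow> (\<Sum>v | x v \<noteq> 0. x v) = (\<Sum>v\<in>U. x v :: real)"
  by (rule sum.mono_neutral_left) auto

definition mix :: "real \<Rightarrow> ('a \<Rightarrow> real) \<Rightarrow> ('a \<Rightarrow> real) \<Rightarrow> 'a \<Rightarrow> real" where
  "mix t x y = (\<lambda>v. (1 - t) * x v + t * y v)"

text \<open>The union of the two supports is a face, and every point of the segment is supported in
  it.\<close>

lemma mix_in_realization:
  assumes \<Delta>: "simplicial \<Delta>" and x: "x \<in> realization \<Delta>" and y: "y \<in> realization \<Delta>"
    and U: "{v. x v \<noteq> 0} \<union> {v. y v \<noteq> 0} \<in> \<Delta>" and t: "t \<in> {0..1}"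
  shows "mix t x y \<in> realization \<Delta>"
proof -
  let ?U = "{v. x v \<noteq> 0} \<union> {v. y v \<noteq> 0}"
  have fin: "finite ?U" using U \<Delta> unfolding simplicial_def by blast
  have supp: "{v. mix t x y v \<noteq> 0} \<subseteq> ?U" by (auto simp: mix_def)
  then have "{v. mix t x y v \<noteq> 0} \<in> \<Delta>" using U \<Delta> unfolding simplicial_def by blast
  moreover have "(\<Sum>v | mix t x y v \<noteq> 0. mix t x y v) = 1"
  proof -
    have "(\<Sum>v | mix t x y v \<noteq> 0. mix t x y v) = (\<Sum>v\<in>?U. mix t x y v)"
      by (rule sum_support[OF fin supp])
    also have "\<dots> = (1 - t) * (\<Sum>v\<in>?U. x v) + t * (\<Sum>v\<in>?U. y v)"
      by (simp add: mix_def sum.distrib sum_distrib_left)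
    also have "\<dots> = 1"
      using sum_support[OF fin, of x] sum_support[OF fin, of y] x y by (auto simp: realization_def)
    finally show ?thesis .
  qed
  moreover have "0 \<le> mix t x y v" for v
    using x y t by (auto simp: mix_def realization_def)
  ultimately show ?thesis by (simp add: realization_def)
qed

lemma homotopic_with_mix:
  fixes f g :: "'b::topological_space \<Rightarrow> 'a \<Rightarrow> real"
  assumes f: "continuous_on S f" and g: "continuous_on S g"
    and S: "\<And>x t. x \<in> S \<Longrightarrow> t \<in> {0..1} \<Longrightarrow> mix t (f x) (g x) \<in> T"
  shows "homotopic_with (\<lambda>_. True) (top_of_set S) (top_of_set T) f g"
proof -
  have coord: "continuous_on ({0..1} \<times> S) (\<lambda>p. h (snd p) v)" if "continuous_on S h"
    for h :: "'b \<Rightarrow> 'a \<Rightarrow> real" and v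
    by (rule continuous_on_compose2[OF continuous_on_product_then_coordinatewise[OF that]])
      (auto intro: continuous_on_snd continuous_on_id)
  have "continuous_on ({0..1} \<times> S) (\<lambda>p. mix (fst p) (f (snd p)) (g (snd p)))"
    unfolding mix_def
    by (rule continuous_on_coordinatewise_then_product)
      (intro continuous_on_add continuous_on_mult continuous_on_diff continuous_on_const
        continuous_on_fst continuous_on_id coord f g)
  moreover have "(\<lambda>p. mix (fst p) (f (snd p)) (g (snd p))) \<in> {0..1} \<times> S \<rightarrow> T"
    using S by auto
  ultimately have "continuous_map (prod_topology (top_of_set {0..1}) (top_of_set S)) (top_of_set T)
      (\<lambda>p. mix (fst p) (f (snd p)) (g (snd p)))"
    unfolding prod_topology_subtopology_eu continuous_map_subtopology_eu by blast
  then show ?thesis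
    unfolding homotopic_with_def
    by (intro exI[of _ "\<lambda>p. mix (fst p) (f (snd p)) (g (snd p))"]) (simp add: mix_def)
qed

definition vertex_point :: "'a \<Rightarrow> 'a \<Rightarrow> real" where
  "vertex_point v = (\<lambda>u. if u = v then 1 else 0)"

lemma vertex_point_in_realization: "{v} \<in> \<Delta> \<Longrightarrow> vertex_point v \<in> realization \<Delta>"
  by (simp add: realization_def vertex_point_def if_distrib cong: if_cong)

lemma supp_vertex_point: "{u. vertex_point v u \<noteq> 0} = {v}"
  by (simp add: vertex_point_def)

lemma k_connected_cone:
  assumes \<Delta>: "simplicial \<Delta>" and v: "{v} \<in> \<Delta>" and cone: "\<And>F. F \<in> \<Delta> \<Longrightarrow> insert v F \<in> \<Delta>"
  shows "k_connected k (geometric_realization \<Delta>)"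
  unfolding geometric_realization_eq
proof (rule k_connected_contractible)
  have vp: "vertex_point v \<in> realization \<Delta>" by (rule vertex_point_in_realization[OF v])
  then show "vertex_point v \<in> topspace (top_of_set (realization \<Delta>))" by simp
  show "homotopic_with (\<lambda>_. True) (top_of_set (realization \<Delta>)) (top_of_set (realization \<Delta>)) id (\<lambda>_. vertex_point v)"
  proof (rule homotopic_with_mix)
    fix x t assume x: "x \<in> realization \<Delta>" and t: "t \<in> {0..1::real}"
    have "{u. x u \<noteq> 0} \<union> {u. vertex_point v u \<noteq> 0} \<in> \<Delta>"
      using cone[of "{u. x u \<noteq> 0}"] x unfolding supp_vertex_point by (simp add: realization_def)
    then show "mix t (id x) (vertex_point v) \<in> realization \<Delta>"
      using mix_in_realization[OF \<Delta> x vp _ t] by simp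
  next
    show "continuous_on (realization \<Delta>) id" unfolding id_def by (rule continuous_on_id)
    show "continuous_on (realization \<Delta>) (\<lambda>_. vertex_point v)" by (rule continuous_on_const)
  qed
qed

section \<open>Deletion and link of a vertex\<close>

definition deletion :: "'a set set \<Rightarrow> 'a \<Rightarrow> 'a set set" where
  "deletion \<Delta> v = {F \<in> \<Delta>. v \<notin> F}"

text \<open>The open sets \<open>x v < 1\<close> and \<open>0 < x v\<close> cover the realization. The first one retracts onto
  the deletion of \<open>v\<close>, the second one contracts to \<open>v\<close>, and their intersection is a product of
  the link with an interval.\<close>

lemma k_connected_vertex:
  assumes \<Delta>: "simplicial \<Delta>" and v: "{v} \<in> \<Delta>"
    and del: "k_connected k (geometric_realization (deletion \<Delta> v))"
    and lk: "k_connected (k - 1) (geometric_realization (link \<Delta> {v}))"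
  shows "k_connected k (geometric_realization \<Delta>)"
proof -
  define A where "A = {x \<in> realization \<Delta>. x v < 1}"
  define B where "B = {x \<in> realization \<Delta>. 0 < x v}"
  have AB: "realization \<Delta> = A \<union> B" by (auto simp: A_def B_def realization_def)
  have coord: "continuous_on S (\<lambda>x. x u :: real)" for S :: "('a \<Rightarrow> real) set" and u
    by (rule continuous_on_subset[OF continuous_on_product_coordinates]) simp
  have op: "openin (top_of_set (A \<union> B)) A" "openin (top_of_set (A \<union> B)) B"
  proof -
    have "open {x :: 'a \<Rightarrow> real. x v < 1}" "open {x :: 'a \<Rightarrow> real. 0 < x v}"
      by (intro open_Collect_less continuous_on_const coord)+
    moreover have "A = realization \<Delta> \<inter> {x. x v < 1}" "B = realization \<Delta> \<inter> {x. 0 < x v}"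
      by (auto simp: A_def B_def)
    ultimately show "openin (top_of_set (A \<union> B)) A" "openin (top_of_set (A \<union> B)) B"
      unfolding AB[symmetric] by (auto simp: openin_open)
  qed
  \<comment> \<open>Projection away from \<open>v\<close>: the coordinate at \<open>v\<close> is
    discarded and the others are rescaled to sum 1, which \<open>x v < 1\<close> permits.\<close>
  define drop where "drop = (\<lambda>(x :: 'a \<Rightarrow> real) u. if u = v then 0 else x u / (1 - x v))"
  have drop_cont: "continuous_on S drop" if "S \<subseteq> A" for S
  proof (rule continuous_on_coordinatewise_then_product)
    fix u
    have "\<forall>x\<in>S. 1 - x v \<noteq> 0" using that by (auto simp: A_def)
    then have "continuous_on S (\<lambda>x. x u / (1 - x v))"
      by (intro continuous_on_divide continuous_on_diff continuous_on_const coord) auto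
    then show "continuous_on S (\<lambda>x. drop x u)"
      by (cases "u = v") (auto simp: drop_def)
  qed
  have supp_drop: "{u. drop x u \<noteq> 0} = {u. x u \<noteq> 0} - {v}" if "x \<in> A" for x
    using that by (auto simp: drop_def A_def)
  have drop_sum: "(\<Sum>u | drop x u \<noteq> 0. drop x u) = 1" "\<And>u. 0 \<le> drop x u" if x: "x \<in> A" for x
  proof -
    have fin: "finite {u. x u \<noteq> 0}" using x \<Delta> by (auto simp: A_def realization_def simplicial_def)
    have s: "(\<Sum>u | x u \<noteq> 0. x u) = 1" and x1: "x v < 1" using x by (auto simp: A_def realization_def)
    have "(\<Sum>u | drop x u \<noteq> 0. drop x u) = (\<Sum>u\<in>{u. x u \<noteq> 0} - {v}. x u / (1 - x v))"
      unfolding supp_drop[OF x] by (rule sum.cong) (auto simp: drop_def)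
    also have "\<dots> = (\<Sum>u\<in>{u. x u \<noteq> 0} - {v}. x u) / (1 - x v)"
      by (simp add: sum_divide_distrib)
    also have "(\<Sum>u\<in>{u. x u \<noteq> 0} - {v}. x u) = 1 - x v"
      using s fin by (simp add: sum_diff1)
    finally show "(\<Sum>u | drop x u \<noteq> 0. drop x u) = 1" using x1 by simp
    show "0 \<le> drop x u" for u
      using x x1 by (auto simp: drop_def A_def realization_def)
  qed
  have down: "G \<in> \<Delta>" if "F \<in> \<Delta>" "G \<subseteq> F" for F G
    using that \<Delta> by (auto simp: simplicial_def)
  have drop_del: "drop x \<in> realization (deletion \<Delta> v)" if x: "x \<in> A" for x
  proof -
    have "{u. x u \<noteq> 0} - {v} \<in> \<Delta>" using x by (auto simp: A_def realization_def intro: down)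
    then show ?thesis
      unfolding realization_def deletion_def mem_Collect_eq supp_drop[OF x, symmetric]
      using drop_sum[OF x] by (auto simp: drop_def)
  qed
  have del_sub: "realization (deletion \<Delta> v) \<subseteq> A"
    by (auto simp: A_def realization_def deletion_def)
  have "k_connected k (top_of_set A)"
  proof (rule k_connected_dominated)
    show "continuous_map (top_of_set A) (top_of_set (realization (deletion \<Delta> v))) drop"
      unfolding continuous_map_subtopology_eu using drop_cont[of A] drop_del by blast
    show "continuous_map (top_of_set (realization (deletion \<Delta> v))) (top_of_set A) id"
      unfolding continuous_map_subtopology_eu id_def using del_sub continuous_on_id by blast
    show "k_connected k (top_of_set (realization (deletion \<Delta> v)))"
      using del by (simp add: geometric_realization_eq)
    show "homotopic_with (\<lambda>_. True) (top_of_set A) (top_of_set A) id (id \<circ> drop)"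
    proof (rule homotopic_with_mix)
      fix x t assume x: "x \<in> A" and t: "t \<in> {0..1::real}"
      have xr: "x \<in> realization \<Delta>" "drop x \<in> realization \<Delta>"
        using x drop_del[OF x] del_sub by (auto simp: A_def)
      have "{u. x u \<noteq> 0} \<union> {u. drop x u \<noteq> 0} \<in> \<Delta>"
        unfolding supp_drop[OF x] using xr(1) by (auto simp: realization_def intro: down)
      then have "mix t x (drop x) \<in> realization \<Delta>"
        by (rule mix_in_realization[OF \<Delta> xr _ t])
      moreover have "mix t x (drop x) v \<le> x v"
      proof -
        have "0 \<le> x v" using xr(1) by (simp add: realization_def)
        then show ?thesis using t by (simp add: mix_def drop_def mult_left_le_one_le)
      qed
      ultimately show "mix t (id x) ((id \<circ> drop) x) \<in> A"
        using x by (simp add: A_def)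
    next
      show "continuous_on A id" unfolding id_def by (rule continuous_on_id)
      show "continuous_on A (id \<circ> drop)" unfolding id_o by (rule drop_cont) simp
    qed
  qed
  moreover have "k_connected k (top_of_set B)"
  proof (rule k_connected_contractible)
    have vp: "vertex_point v \<in> realization \<Delta>" by (rule vertex_point_in_realization[OF v])
    then show "vertex_point v \<in> topspace (top_of_set B)" by (simp add: B_def vertex_point_def)
    show "homotopic_with (\<lambda>_. True) (top_of_set B) (top_of_set B) id (\<lambda>_. vertex_point v)"
    proof (rule homotopic_with_mix)
      fix x t assume x: "x \<in> B" and t: "t \<in> {0..1::real}"
      have xr: "x \<in> realization \<Delta>" "0 < x v" using x by (auto simp: B_def)
      have "{u. x u \<noteq> 0} \<union> {u. vertex_point v u \<noteq> 0} = {u. x u \<noteq> 0}"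
        unfolding supp_vertex_point using xr(2) by auto
      then have "{u. x u \<noteq> 0} \<union> {u. vertex_point v u \<noteq> 0} \<in> \<Delta>"
        using xr(1) by (simp add: realization_def)
      then have "mix t x (vertex_point v) \<in> realization \<Delta>"
        by (rule mix_in_realization[OF \<Delta> xr(1) vp _ t])
      moreover have "0 < mix t x (vertex_point v) v"
        using xr(2) t by (cases "t = 1") (auto simp: mix_def vertex_point_def intro: add_pos_nonneg)
      ultimately show "mix t (id x) (vertex_point v) \<in> B"
        by (simp add: B_def)
    next
      show "continuous_on B id" unfolding id_def by (rule continuous_on_id)
      show "continuous_on B (\<lambda>_. vertex_point v)" by (rule continuous_on_const)
    qed
  qed
  moreover have "k_connected (k - 1) (top_of_set (A \<inter> B))"
  proof (rule k_connected_dominated)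
    \<comment> \<open>Places the link halfway between \<open>v\<close> and the deletion, inside both
      open sets. The support of \<open>s (drop x)\<close> is that of \<open>x\<close>, so the
      segment joining them stays within one face.\<close>
    define s where "s = (\<lambda>(y :: 'a \<Rightarrow> real) u. if u = v then 1/2 else y u / 2)"
    have drop_lk: "drop x \<in> realization (link \<Delta> {v})" if x: "x \<in> A \<inter> B" for x
    proof -
      have xA: "x \<in> A" using x by simp
      have "{u. x u \<noteq> 0} \<in> \<Delta>" "v \<in> {u. x u \<noteq> 0}" using x by (auto simp: A_def B_def realization_def)
      then have "{u. x u \<noteq> 0} - {v} \<in> link \<Delta> {v}"
        using down[of "{u. x u \<noteq> 0}"] by (auto simp: link_def insert_absorb)
      then show ?thesis
        unfolding realization_def mem_Collect_eq supp_drop[OF xA, symmetric]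
        using drop_sum[OF xA] by blast
    qed
    have s_supp: "{u. s y u \<noteq> 0} = insert v {u. y u \<noteq> 0}" for y
      by (auto simp: s_def)
    have s_AB: "s y \<in> A \<inter> B" if y: "y \<in> realization (link \<Delta> {v})" for y
    proof -
      have yl: "{u. y u \<noteq> 0} \<in> link \<Delta> {v}" "(\<Sum>u | y u \<noteq> 0. y u) = 1" "\<And>u. 0 \<le> y u"
        using y by (auto simp: realization_def)
      have v0: "v \<notin> {u. y u \<noteq> 0}" and fin: "finite {u. y u \<noteq> 0}" and ins: "insert v {u. y u \<noteq> 0} \<in> \<Delta>"
        using yl(1) \<Delta> by (auto simp: link_def simplicial_def)
      have "(\<Sum>u | s y u \<noteq> 0. s y u) = s y v + (\<Sum>u | y u \<noteq> 0. s y u)"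
        unfolding s_supp using v0 fin by simp
      also have "(\<Sum>u | y u \<noteq> 0. s y u) = (\<Sum>u | y u \<noteq> 0. y u / 2)"
        by (rule sum.cong) (use v0 in \<open>auto simp: s_def\<close>)
      also have "\<dots> = 1/2" using yl(2) by (simp flip: sum_divide_distrib)
      finally have "(\<Sum>u | s y u \<noteq> 0. s y u) = 1" by (simp add: s_def)
      then have "s y \<in> realization \<Delta>"
        using ins yl(3) by (simp only: realization_def mem_Collect_eq s_supp) (auto simp: s_def)
      then show ?thesis by (simp add: A_def B_def s_def)
    qed
    have s_cont: "continuous_on S s" for S
    proof (rule continuous_on_coordinatewise_then_product)
      fix u
      have "continuous_on S (\<lambda>y. y u / 2)" by (intro continuous_on_divide continuous_on_const coord) auto
      then show "continuous_on S (\<lambda>y. s y u)" by (cases "u = v") (auto simp: s_def)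
    qed
    show "continuous_map (top_of_set (A \<inter> B)) (top_of_set (realization (link \<Delta> {v}))) drop"
      unfolding continuous_map_subtopology_eu using drop_cont[of "A \<inter> B"] drop_lk by blast
    show "continuous_map (top_of_set (realization (link \<Delta> {v}))) (top_of_set (A \<inter> B)) s"
      unfolding continuous_map_subtopology_eu using s_cont s_AB by blast
    show "k_connected (k - 1) (top_of_set (realization (link \<Delta> {v})))"
      using lk by (simp add: geometric_realization_eq)
    show "homotopic_with (\<lambda>_. True) (top_of_set (A \<inter> B)) (top_of_set (A \<inter> B)) id (s \<circ> drop)"
    proof (rule homotopic_with_mix)
      fix x t assume x: "x \<in> A \<inter> B" and t: "t \<in> {0..1::real}"
      have xr: "x \<in> realization \<Delta>" "0 < x v" "x v < 1" using x by (auto simp: A_def B_def)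
      have sr: "s (drop x) \<in> realization \<Delta>" using s_AB[OF drop_lk[OF x]] by (simp add: A_def)
      have "x \<in> A" using x by simp
      then have "{u. x u \<noteq> 0} \<union> {u. s (drop x) u \<noteq> 0} = {u. x u \<noteq> 0}"
        unfolding s_supp supp_drop[OF \<open>x \<in> A\<close>] using xr(2) by auto
      then have "{u. x u \<noteq> 0} \<union> {u. s (drop x) u \<noteq> 0} \<in> \<Delta>"
        using xr(1) by (simp add: realization_def)
      then have "mix t x (s (drop x)) \<in> realization \<Delta>"
        by (rule mix_in_realization[OF \<Delta> xr(1) sr _ t])
      moreover have "0 < mix t x (s (drop x)) v" "mix t x (s (drop x)) v < 1"
      proof -
        have eq: "mix t x (s (drop x)) v = (1 - t) * x v + t * (1/2)" by (simp add: mix_def s_def)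
        show "0 < mix t x (s (drop x)) v" unfolding eq
          using xr(2) t by (cases "t = 0") (auto intro: add_nonneg_pos)
        have "(1 - t) * x v \<le> 1 - t" using xr t by (simp add: mult_left_le)
        moreover have "(1 - t) * x v < 1 - t" if "t = 0" using that xr by simp
        ultimately show "mix t x (s (drop x)) v < 1" unfolding eq
          using t by (cases "t = 0") auto
      qed
      ultimately show "mix t (id x) ((s \<circ> drop) x) \<in> A \<inter> B"
        by (simp add: A_def B_def)
    next
      show "continuous_on (A \<inter> B) id" by (simp add: id_def continuous_on_id)
      show "continuous_on (A \<inter> B) (s \<circ> drop)"
        by (rule continuous_on_compose[OF drop_cont s_cont]) simp
    qed
  qed
  ultimately show ?thesis
    unfolding geometric_realization_eq AB using k_connected_open_Un op by blast
qed

section \<open>Order complexes\<close>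

lemma chain_iff: "Complete_Partial_Order.chain r C \<longleftrightarrow> (\<forall>x\<in>C. \<forall>y\<in>C. r x y \<or> r y x)"
  by (simp add: Complete_Partial_Order.chain_def)

lemma simplicial_order_complex: "simplicial (order_complex P r)"
  unfolding simplicial_def order_complex_def chain_iff
  by (auto intro: finite_subset)

lemma deletion_order_complex: "deletion (order_complex P r) v = order_complex (P - {v}) r"
  by (auto simp: deletion_def order_complex_def)

text \<open>Being a chain is a condition on pairs, so the link is again an order complex, on the
  elements comparable to all of \<open>F\<close>.\<close>

lemma link_order_complex:
  assumes "F \<in> order_complex P r"
  shows "link (order_complex P r) F = order_complex {z \<in> P - F. \<forall>f\<in>F. r z f \<or> r f z} r"
  using assms unfolding link_def order_complex_def chain_iff by blast

lemma k_connected_order_complex_cone: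
  assumes "v \<in> P" "r v v" "\<And>z. z \<in> P \<Longrightarrow> r z v \<or> r v z"
  shows "k_connected k (geometric_realization (order_complex P r))"
proof (rule k_connected_cone[OF simplicial_order_complex])
  show "{v} \<in> order_complex P r" using assms by (simp add: order_complex_def chain_iff)
  show "insert v F \<in> order_complex P r" if "F \<in> order_complex P r" for F
    using that assms unfolding order_complex_def chain_iff by blast
qed

lemma k_connected_order_complex_vertex:
  assumes v: "v \<in> P" "r v v"
    and "k_connected k (geometric_realization (order_complex (P - {v}) r))"
    and "k_connected (k - 1) (geometric_realization (order_complex {z \<in> P - {v}. r z v \<or> r v z} r))"
  shows "k_connected k (geometric_realization (order_complex P r))"
proof (rule k_connected_vertex[OF simplicial_order_complex, of v])
  show V: "{v} \<in> order_complex P r" using v by (simp add: order_complex_def chain_iff)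
  show "k_connected k (geometric_realization (deletion (order_complex P r) v))"
    using assms by (simp add: deletion_order_complex)
  show "k_connected (k - 1) (geometric_realization (link (order_complex P r) {v}))"
    using assms(4) by (simp add: link_order_complex[OF V])
qed

text \<open>Turns connectivity of a link into an element by which a chain can be extended.\<close>

lemma k_connected_realization_nonempty:
  assumes "k_connected k (geometric_realization (order_complex P r))" "- 1 \<le> k"
  shows "P \<noteq> {}"
proof
  assume "P = {}"
  then have "order_complex P r \<subseteq> {{}}" by (auto simp: order_complex_def)
  then have "realization (order_complex P r) = {}" by (auto simp: realization_def)
  then show False using assms by (simp add: k_connected_def geometric_realization_eq)
qed

text \<open>In the non-crossing partition lattices, \<open>\<rho>\<close> deletes from the cycles of \<open>p\<^sup>-\<^sup>1 x\<close> a point moved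
  by \<open>p\<^sup>-\<^sup>1 y\<close>.\<close>

locale reducible_poset =
  fixes L :: "'a set" and le :: "'a \<Rightarrow> 'a \<Rightarrow> bool" and rk :: "'a \<Rightarrow> nat" and l u :: 'a
  assumes finite_L: "finite L"
    and le_refl: "x \<in> L \<Longrightarrow> le x x"
    and le_trans: "\<lbrakk>x \<in> L; y \<in> L; z \<in> L; le x y; le y z\<rbrakk> \<Longrightarrow> le x z"
    and bounds: "l \<in> L" "u \<in> L" "x \<in> L \<Longrightarrow> le l x" "x \<in> L \<Longrightarrow> le x u" "l \<noteq> u"
    and rk_less: "\<lbrakk>x \<in> L; y \<in> L; le x y; x \<noteq> y\<rbrakk> \<Longrightarrow> rk x < rk y"
    and reduction: "\<lbrakk>p \<in> L; q \<in> L; y \<in> L; le p y; y \<noteq> p; le y q\<rbrakk> \<Longrightarrow>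
      \<exists>\<rho>. (\<forall>x\<in>L. le p x \<longrightarrow> le x q \<longrightarrow>
             \<rho> x \<in> L \<and> le p (\<rho> x) \<and> le (\<rho> x) x \<and> rk x \<le> rk (\<rho> x) + 1 \<and> \<rho> (\<rho> x) = \<rho> x) \<and>
           (\<forall>x\<in>L. \<forall>x'\<in>L. le p x \<longrightarrow> le x x' \<longrightarrow> le x' q \<longrightarrow> le (\<rho> x) (\<rho> x')) \<and>
           \<rho> y \<noteq> y \<and> \<rho> q \<noteq> q"
begin

section \<open>Connectivity of the links of chains\<close>

definition compatible :: "'a set \<Rightarrow> 'a set \<Rightarrow> 'a set" where
  "compatible Z F = {x \<in> L - {l, u} - Z - F. \<forall>f\<in>F. le x f \<or> le f x}"

lemma rk_bounds: "x \<in> L - {l, u} \<Longrightarrow> rk l < rk x \<and> rk x < rk u"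
  using rk_less bounds by (metis DiffD1 DiffD2 insertCI)

text \<open>The degree is one less than the expected dimension of the link: a maximal chain of the
  proper part should have \<open>rk u - rk l - 1\<close> elements, of which \<open>F\<close> uses
  \<open>card F\<close>. Expressed through \<open>rk\<close>, the bound does not presuppose chains
  of that length; their existence is deduced from it later. The induction is on the room that
  \<open>F\<close> leaves between the bounds.\<close>

lemma k_connected_compatible:
  assumes "Z = {} \<or> Z = {y}" and "F \<in> order_complex (L - {l, u} - Z) le"
  shows "k_connected (int (rk u) - int (rk l) - 3 - int (card F))
    (geometric_realization (order_complex (compatible Z F) le))"
  using assms(2)
proof (induction "rk u - rk l - card F" arbitrary: F rule: less_induct)
  case less
  let ?k = "int (rk u) - int (rk l) - 3 - int (card F)"
  have F: "F \<subseteq> L - {l, u} - Z" "finite F" "\<And>x y. x \<in> F \<Longrightarrow> y \<in> F \<Longrightarrow> le x y \<or> le y x"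
    using less.prems by (auto simp: order_complex_def chain_iff)
  define G where "G = insert l (insert u F)"
  have G: "G \<subseteq> L" "finite G" "l \<in> G" "u \<in> G" using F bounds by (auto simp: G_def)
  have G_chain: "le x y \<or> le y x" if "x \<in> G" "y \<in> G" for x y
    using that F bounds unfolding G_def by blast
  have comp_G: "le x f \<or> le f x" if "x \<in> L" "\<And>f. f \<in> F \<Longrightarrow> le x f \<or> le f x" "f \<in> G" for x f
    using that bounds unfolding G_def by blast
  show ?case
  proof (cases "?k \<le> - 2")
    case True
    then show ?thesis by (rule k_connected_le_minus2)
  next
    case False
    then have small: "card F + 2 + rk l \<le> rk u" by linarith
    define y_in where "y_in \<longleftrightarrow> Z = {y} \<and> y \<in> compatible {} F"
    \<comment> \<open>A rank strictly inside the bounds that the chain misses. If \<open>y\<close>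
      has been removed from the link, the rank of \<open>y\<close> is taken. Otherwise one exists by
      counting: \<open>G\<close> uses at most \<open>card F + 2\<close> ranks, and
      \<open>small\<close> provides more.\<close>
    have "\<exists>r. r \<notin> rk ` G \<and> rk l < r \<and> r < rk u \<and> (y_in \<longrightarrow> r = rk y)"
    proof (cases y_in)
      case True
      then have y: "y \<in> L - {l, u}" "y \<notin> F" "\<And>f. f \<in> F \<Longrightarrow> le y f \<or> le f y"
        by (auto simp: y_in_def compatible_def)
      have "rk y \<noteq> rk f" if "f \<in> G" for f
      proof -
        have "y \<noteq> f" "f \<in> L" using that y G by (auto simp: G_def)
        then show ?thesis
          using comp_G[OF _ y(3) that] y(1) rk_less[of y f] rk_less[of f y] by fastforce
      qed
      then show ?thesis using rk_bounds[OF y(1)] by (intro exI[of _ "rk y"]) auto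
    next
      case False
      have "card (rk ` G) \<le> card F + 2"
        using card_image_le[OF G(2), of rk] card_insert_le_m1 F(2) unfolding G_def
        by (metis (no_types, lifting) add_2_eq_Suc' card_insert_if dual_order.trans finite_insert le_SucI le_refl Suc_le_mono)
      also have "\<dots> < card {rk l..rk u}" using small by simp
      finally have "\<not> {rk l..rk u} \<subseteq> rk ` G"
        using card_mono[of "rk ` G" "{rk l..rk u}"] G(2) by auto
      then obtain r where "r \<in> {rk l..rk u}" "r \<notin> rk ` G" by blast
      moreover from this have "r \<noteq> rk l" "r \<noteq> rk u" using G by auto
      ultimately show ?thesis using False by (intro exI[of _ r]) auto
    qed
    then obtain r where r: "r \<notin> rk ` G" "rk l < r" "r < rk u" "y_in \<Longrightarrow> r = rk y" by blast
    \<comment> \<open>The gap of the chain around the missed rank: \<open>p\<close> and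
      \<open>q\<close> are the elements of \<open>G\<close> next to \<open>r\<close>.\<close>
    have "\<exists>p\<in>{f \<in> G. rk f < r}. \<forall>f\<in>{f \<in> G. rk f < r}. rk f \<le> rk p"
    proof -
      let ?A = "rk ` {f \<in> G. rk f < r}"
      have "Max ?A \<in> ?A" by (rule Max_in) (use G r in auto)
      moreover have "\<forall>f\<in>{f \<in> G. rk f < r}. rk f \<le> Max ?A" using G(2) by auto
      ultimately show ?thesis by (metis (no_types, lifting) imageE)
    qed
    then obtain p where p: "p \<in> G" "rk p < r" "\<And>f. f \<in> G \<Longrightarrow> rk f < r \<Longrightarrow> rk f \<le> rk p" by blast
    have "\<exists>q\<in>{f \<in> G. r < rk f}. \<forall>f\<in>{f \<in> G. r < rk f}. rk q \<le> rk f"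
    proof -
      let ?A = "rk ` {f \<in> G. r < rk f}"
      have "Min ?A \<in> ?A" by (rule Min_in) (use G r in auto)
      moreover have "\<forall>f\<in>{f \<in> G. r < rk f}. Min ?A \<le> rk f" using G(2) by auto
      ultimately show ?thesis by (metis (no_types, lifting) imageE)
    qed
    then obtain q where q: "q \<in> G" "r < rk q" "\<And>f. f \<in> G \<Longrightarrow> r < rk f \<Longrightarrow> rk q \<le> rk f" by blast
    have pq: "p \<in> L" "q \<in> L" using p q G by auto
    have le_rk: "le a b" if "a \<in> L" "b \<in> L" "le a b \<or> le b a" "rk a \<le> rk b" for a b
      using that rk_less[of b a] le_refl by (metis leD)
    have le_rk_le: "rk a \<le> rk b" if "a \<in> L" "b \<in> L" "le a b" for a b
      using that rk_less[of a b] by (cases "a = b") auto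
    have G_split: "le f p \<or> le q f" if f: "f \<in> G" for f
    proof -
      have "f \<in> L" "rk f \<noteq> r" using f G r by auto
      then show ?thesis
        using p q f G_chain le_rk pq by (metis linorder_neqE_nat)
    qed
    define I where "I = {x \<in> L. le p x \<and> le x q}"
    \<comment> \<open>The reduction must move \<open>y\<close> when \<open>y\<close> lies in the
      gap. If it does not, nothing has to be avoided and \<open>q\<close> is a harmless
      choice.\<close>
    define y0 where "y0 = (if y_in then y else q)"
    have y0: "y0 \<in> L" "le p y0" "y0 \<noteq> p" "le y0 q"
    proof -
      have ple: "le p q" using le_rk[OF pq G_chain[OF p(1) q(1)]] p(2) q(2) by simp
      have "p \<noteq> q" using p q by auto
      moreover have "y \<in> L" "le p y" "y \<noteq> p" "le y q" if y_in
      proof -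
        have y: "y \<in> L" "\<And>f. f \<in> F \<Longrightarrow> le y f \<or> le f y"
          using that by (auto simp: y_in_def compatible_def)
        show "y \<in> L" by fact
        show "le p y" using le_rk[OF pq(1) y(1)] comp_G[OF y p(1)] p r(4)[OF that] by auto
        show "le y q" using le_rk[OF y(1) pq(2)] comp_G[OF y q(1)] q r(4)[OF that] by auto
        show "y \<noteq> p" using p r(4)[OF that] by auto
      qed
      ultimately show "y0 \<in> L" "le p y0" "y0 \<noteq> p" "le y0 q"
        using ple pq le_refl by (auto simp: y0_def)
    qed
    obtain \<rho> where \<rho>: "\<And>x. x \<in> I \<Longrightarrow> \<rho> x \<in> L \<and> le p (\<rho> x) \<and> le (\<rho> x) x \<and> rk x \<le> rk (\<rho> x) + 1 \<and> \<rho> (\<rho> x) = \<rho> x"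
      "\<And>x x'. x \<in> I \<Longrightarrow> x' \<in> I \<Longrightarrow> le x x' \<Longrightarrow> le (\<rho> x) (\<rho> x')" "\<rho> y0 \<noteq> y0" "\<rho> q \<noteq> q"
      using reduction[OF pq y0] unfolding I_def by blast
    have \<rho>I: "\<rho> x \<in> I" if "x \<in> I" for x
      using \<rho>(1)[OF that] that le_trans[of "\<rho> x" x q] pq by (auto simp: I_def)
    have "le p q" using le_rk[OF pq G_chain[OF p(1) q(1)]] p(2) q(2) by simp
    then have qI: "q \<in> I" using pq le_refl by (auto simp: I_def)
    have rkG: "rk f \<le> rk p \<or> rk q \<le> rk f" if "f \<in> G" for f
      using G_split[OF that] le_rk_le pq G that by blast
    have I_comp: "x \<in> compatible {} F" if "x \<in> I" "rk p < rk x" "rk x < rk q" for x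
    proof -
      have "x \<notin> G" using rkG that by fastforce
      moreover have "le x f \<or> le f x" if "f \<in> F" for f
        using G_split[of f] that \<open>x \<in> I\<close> le_trans[of f p x] le_trans[of x q f] pq G
        by (auto simp: I_def G_def)
      ultimately show ?thesis using that by (auto simp: compatible_def G_def I_def)
    qed
    \<comment> \<open>Removing \<open>Z\<close> destroys no fixed element of the gap, because
      \<open>\<rho>\<close> moves \<open>y\<close> whenever \<open>y\<close> belongs to the
      link.\<close>
    have fixed_U: "x \<in> compatible Z F" if "x \<in> I" "rk p < rk x" "rk x < rk q" "\<rho> x = x" for x
    proof -
      have x: "x \<in> compatible {} F" using I_comp that by blast
      have "x \<notin> Z"
      proof
        assume "x \<in> Z"
        then have "Z = {y}" "x = y" using assms(1) by auto
        then have y_in using x by (simp add: y_in_def)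
        then show False using \<rho>(3) that(4) \<open>x = y\<close> by (simp add: y0_def)
      qed
      then show ?thesis using x by (auto simp: compatible_def)
    qed
    define U where "U = compatible Z F"
    have UL: "U \<subseteq> L" "finite U" using finite_L by (auto simp: U_def compatible_def intro: finite_subset[of _ L])
    have U_G: "x \<notin> G" if "x \<in> U" for x using that by (auto simp: U_def compatible_def G_def)
    have U_split: "le x p \<or> le q x" if "x \<in> U" "x \<notin> I" for x
    proof -
      have x: "x \<in> L" "\<And>f. f \<in> F \<Longrightarrow> le x f \<or> le f x"
        using that by (auto simp: U_def compatible_def)
      show ?thesis using comp_G[OF x p(1)] comp_G[OF x q(1)] that(2) x(1) by (auto simp: I_def)
    qed
    have U_I: "le x z \<or> le z x" if "x \<in> U" "x \<notin> I" "z \<in> I" for x z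
      using U_split[OF that(1,2)] that UL pq le_trans[of x p z] le_trans[of z q x] by (auto simp: I_def)
    have U_rk: "rk p < rk x" "rk x < rk q" if "x \<in> U" "x \<in> I" for x
      using that U_G[OF that(1)] p(1) q(1) rk_less[of p x] rk_less[of x q] pq by (auto simp: I_def)
    define S where "S = {x \<in> U. x \<in> I \<longrightarrow> \<rho> x = x}"
    define N where "N = {x \<in> U. x \<in> I \<and> \<rho> x \<noteq> x}"
    have SN: "U = S \<union> N" by (auto simp: S_def N_def)
    have fixed_S: "x \<in> S" if "x \<in> I" "rk p < rk x" "rk x < rk q" "\<rho> x = x" for x
      using fixed_U[OF that] that by (simp add: S_def U_def)
    \<comment> \<open>Since \<open>\<rho>\<close> lowers the rank by at most one and
      \<open>r\<close> lies strictly between the ranks of \<open>p\<close> and \<open>q\<close>, the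
      element \<open>\<rho> q\<close> is a coatom of the gap other than \<open>p\<close>, hence a
      vertex. Monotonicity puts every fixed element of the gap below it.\<close>
    have base: "k_connected k (geometric_realization (order_complex S le))" for k
    proof (rule k_connected_order_complex_cone[of "\<rho> q"])
      have m: "\<rho> q \<in> I" "\<rho> (\<rho> q) = \<rho> q" "rk q \<le> rk (\<rho> q) + 1" "le (\<rho> q) q"
        using \<rho>I[OF qI] \<rho>(1)[OF qI] by auto
      moreover have "rk (\<rho> q) < rk q" using m \<rho>(4) rk_less[of "\<rho> q" q] pq by (auto simp: I_def)
      ultimately show "\<rho> q \<in> S" using p q by (intro fixed_S) auto
      then show "le (\<rho> q) (\<rho> q)" using le_refl UL SN by blast
      fix z assume z: "z \<in> S"
      show "le z (\<rho> q) \<or> le (\<rho> q) z"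
      proof (cases "z \<in> I")
        case True
        then have "\<rho> z = z" "le z q" using z by (auto simp: S_def I_def)
        then show ?thesis using \<rho>(2)[OF True qI] by simp
      next
        case False
        then show ?thesis using U_I[OF _ False m(1)] z by (auto simp: S_def)
      qed
    qed
    \<comment> \<open>\<open>N'\<close> is an upper part of \<open>N\<close> with respect to rank.
      Its element of least rank is the last one added, when no moved element of smaller rank is
      present.\<close>
    have add: "k_connected ?k (geometric_realization (order_complex (S \<union> N') le))"
      if "N' \<subseteq> N" "\<And>x x'. x \<in> N' \<Longrightarrow> x' \<in> N \<Longrightarrow> rk x < rk x' \<Longrightarrow> x' \<in> N'" for N'
      using that
    proof (induction "card N'" arbitrary: N')
      case 0
      then have "N' = {}" using UL SN by (metis card_eq_0_iff finite_Un finite_subset)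
      then show ?case using base by simp
    next
      case (Suc c)
      have fin: "finite N'" "N' \<noteq> {}" using Suc.hyps(2) by (auto intro: card_ge_0_finite)
      have "\<exists>x\<in>N'. \<forall>z\<in>N'. rk x \<le> rk z"
      proof -
        have "Min (rk ` N') \<in> rk ` N'" by (rule Min_in) (use fin in auto)
        moreover have "\<forall>z\<in>N'. Min (rk ` N') \<le> rk z" using fin by auto
        ultimately show ?thesis by (metis (no_types, lifting) imageE)
      qed
      then obtain x where x: "x \<in> N'" "\<And>z. z \<in> N' \<Longrightarrow> rk x \<le> rk z" by blast
      have xN: "x \<in> U" "x \<in> I" "\<rho> x \<noteq> x" using x(1) Suc.prems(1) by (auto simp: N_def)
      have xS: "x \<notin> S" using xN by (simp add: S_def)
      have xL: "x \<in> L" using xN UL by auto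
      show ?case
      proof (rule k_connected_order_complex_vertex[of x])
        show "x \<in> S \<union> N'" using x by simp
        show "le x x" using le_refl xL .
        have "k_connected ?k (geometric_realization (order_complex (S \<union> (N' - {x})) le))"
        proof (rule Suc.hyps(1))
          show "c = card (N' - {x})" using Suc.hyps(2) x(1) fin by simp
          show "N' - {x} \<subseteq> N" using Suc.prems(1) by auto
          show "z' \<in> N' - {x}" if "z \<in> N' - {x}" "z' \<in> N" "rk z < rk z'" for z z'
            using Suc.prems(2)[of z z'] that x(2)[of z] by auto
        qed
        then show "k_connected ?k (geometric_realization (order_complex (S \<union> N' - {x}) le))"
          using xS by (simp add: Un_Diff)
        let ?K = "{z \<in> S \<union> N' - {x}. le z x \<or> le x z}"
        show "k_connected (?k - 1) (geometric_realization (order_complex ?K le))"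
        proof (cases "rk x = rk p + 1")
          \<comment> \<open>Here \<open>x\<close> covers \<open>p\<close> and has no vertex to serve
            as apex. Other moved elements comparable to \<open>x\<close> have larger rank and are
            already present, so the link of \<open>x\<close> is the full link of the chain
            \<open>insert x F\<close>; the longer chain accounts for the drop from \<open>?k\<close>
            to \<open>?k - 1\<close>.\<close>
          case True
          have "?K = compatible Z (insert x F)"
          proof (intro equalityI subsetI)
            fix z assume "z \<in> ?K"
            then show "z \<in> compatible Z (insert x F)"
              using Suc.prems(1) SN unfolding U_def compatible_def by blast
          next
            fix z assume z: "z \<in> compatible Z (insert x F)"
            then have zU: "z \<in> U" "z \<noteq> x" "le z x \<or> le x z" by (auto simp: U_def compatible_def)
            have "z \<in> N'" if zN: "z \<in> N"
            proof -
              have "rk p < rk z" using U_rk zN by (auto simp: N_def)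
              then have "rk x \<le> rk z" using True by simp
              then have "rk x < rk z"
                using zU rk_less[of x z] rk_less[of z x] UL xL by fastforce
              then show ?thesis using Suc.prems(2)[OF x(1) zN] by simp
            qed
            then show "z \<in> ?K" using zU SN by auto
          qed
          moreover have "k_connected (int (rk u) - int (rk l) - 3 - int (card (insert x F)))
              (geometric_realization (order_complex (compatible Z (insert x F)) le))"
          proof (rule less.hyps)
            have xF: "x \<notin> F" using xN by (auto simp: U_def compatible_def)
            then show "rk u - rk l - card (insert x F) < rk u - rk l - card F"
              using F(2) small by simp
            show "insert x F \<in> order_complex (L - {l, u} - Z) le"
              using xN(1) F le_refl[OF xL] unfolding order_complex_def chain_iff U_def compatible_def by blast
          qed
          moreover have "x \<notin> F" using xN by (auto simp: U_def compatible_def)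
          ultimately show ?thesis using F(2) by (simp add: algebra_simps)
        next
          \<comment> \<open>Now \<open>\<rho> x\<close> is strictly above \<open>p\<close> and is a
            vertex. Elements of the gap present below \<open>x\<close> are fixed, hence below
            \<open>\<rho> x\<close>; those above \<open>x\<close> are above
            \<open>\<rho> x\<close>.\<close>
          case False
          have \<rho>x: "\<rho> x \<in> I" "\<rho> (\<rho> x) = \<rho> x" "rk x \<le> rk (\<rho> x) + 1" "le (\<rho> x) x" "\<rho> x \<in> L"
            using \<rho>I[OF xN(2)] \<rho>(1)[OF xN(2)] by auto
          have rkx: "rk p < rk x" "rk x < rk q" using U_rk xN by auto
          have "rk (\<rho> x) < rk x" using rk_less[OF \<rho>x(5) xL \<rho>x(4) xN(3)] .
          then have \<rho>S: "\<rho> x \<in> S" using False rkx \<rho>x by (intro fixed_S) auto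
          show ?thesis
          proof (rule k_connected_order_complex_cone[of "\<rho> x"])
            show "\<rho> x \<in> ?K" using \<rho>S \<rho>x(4) xN(3) by auto
            show "le (\<rho> x) (\<rho> x)" using le_refl \<rho>x(5) .
            fix z assume z: "z \<in> ?K"
            then have zU: "z \<in> U" "z \<noteq> x" "z \<in> L" using Suc.prems(1) SN UL by auto
            show "le z (\<rho> x) \<or> le (\<rho> x) z"
            proof (cases "z \<in> I")
              case True
              show ?thesis
              proof (cases "le x z")
                case True
                then show ?thesis using le_trans[OF \<rho>x(5) xL zU(3) \<rho>x(4)] by simp
              next
                case False
                then have zx: "le z x" using z by auto
                then have "rk z < rk x" using rk_less zU xL by auto
                then have "z \<notin> N'" using x(2) by (meson leD)
                then have "\<rho> z = z" using z True by (auto simp: S_def)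
                then show ?thesis using \<rho>(2)[OF True xN(2) zx] by simp
              qed
            next
              case False
              then show ?thesis using U_I[OF zU(1) False \<rho>x(1)] by simp
            qed
          qed
        qed
      qed
    qed
    have "k_connected ?k (geometric_realization (order_complex (S \<union> N) le))"
      by (rule add) auto
    then show ?thesis using SN by (simp add: U_def)
  qed
qed

section \<open>Cohen-Macaulayness and rank after removing a point\<close>

lemma link_eq_compatible:
  assumes "F \<in> order_complex (L - {l, u} - Z) le"
  shows "link (order_complex (L - {l, u} - Z) le) F = order_complex (compatible Z F) le"
  using link_order_complex[OF assms] by (simp add: compatible_def)

lemma card_chain_le:
  assumes "F \<in> order_complex (L - {l, u} - Z) le"
  shows "int (card F) \<le> int (rk u) - int (rk l) - 1"
proof -
  have F: "F \<subseteq> L - {l, u}" "finite F" "\<And>x y. x \<in> F \<Longrightarrow> y \<in> F \<Longrightarrow> le x y \<or> le y x"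
    using assms by (auto simp: order_complex_def chain_iff)
  have "inj_on rk F"
  proof (rule inj_onI, rule ccontr)
    fix x y assume xy: "x \<in> F" "y \<in> F" "rk x = rk y" "x \<noteq> y"
    then show False using F(1) F(3)[OF xy(1,2)] rk_less[of x y] rk_less[of y x] by auto
  qed
  then have "card F = card (rk ` F)" by (simp add: card_image)
  also have "\<dots> \<le> card {rk l<..<rk u}"
    using rk_bounds[OF subsetD[OF F(1)]] by (intro card_mono image_subsetI) auto
  finally show ?thesis using rk_less[OF bounds(1,2) bounds(3)[OF bounds(2)] bounds(5)] by simp
qed

lemma finite_order_complex: "finite (order_complex (L - A) le)"
  by (rule finite_subset[of _ "Pow L"]) (use finite_L in \<open>auto simp: order_complex_def\<close>)

text \<open>It is enough to bound the dimension of each link from above, because connectivity in the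
  expected degree implies connectivity in every smaller one.\<close>

lemma homotopy_CM_remove:
  assumes Z: "Z = {} \<or> Z = {y}"
  shows "homotopy_CM (L - {l, u} - Z) le"
  unfolding homotopy_CM_def homotopy_CM_complex_def
proof
  let ?\<Delta> = "order_complex (L - {l, u} - Z) le"
  fix F assume F: "F \<in> ?\<Delta>"
  have finF: "finite F" using F by (auto simp: order_complex_def)
  have "complex_dim (link ?\<Delta> F) \<le> int (rk u) - int (rk l) - 2 - int (card F)"
    unfolding complex_dim_def
  proof (subst Max_le_iff)
    have "finite ?\<Delta>" using finite_order_complex[of "{l, u} \<union> Z"] by (simp add: Diff_Diff_Int set_diff_eq)
    then show "finite ((\<lambda>F. int (card F) - 1) ` link ?\<Delta> F)" by (auto simp: link_def)
    have "{} \<in> link ?\<Delta> F" using F by (auto simp: link_def order_complex_def chain_iff)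
    then show "(\<lambda>F. int (card F) - 1) ` link ?\<Delta> F \<noteq> {}" by blast
    have "int (card G) - 1 \<le> int (rk u) - int (rk l) - 2 - int (card F)" if G: "G \<in> link ?\<Delta> F" for G
    proof -
      have "F \<union> G \<in> ?\<Delta>" "F \<inter> G = {}" "finite G" using G by (auto simp: link_def order_complex_def)
      then have "int (card F + card G) \<le> int (rk u) - int (rk l) - 1"
        using card_chain_le[of "F \<union> G"] finF by (simp add: card_Un_disjoint)
      then show ?thesis by simp
    qed
    then show "\<forall>a\<in>(\<lambda>F. int (card F) - 1) ` link ?\<Delta> F. a \<le> int (rk u) - int (rk l) - 2 - int (card F)"
      by blast
  qed
  then show "k_connected (complex_dim (link ?\<Delta> F) - 1) (geometric_realization (link ?\<Delta> F))"
    using k_connected_compatible[OF Z F] unfolding link_eq_compatible[OF F]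
    by (rule_tac k_connected_mono) auto
qed

text \<open>A chain that is too short is not maximal, since its link is non-empty.\<close>

lemma poset_rank_remove:
  assumes Z: "Z = {} \<or> Z = {y}"
  shows "poset_rank (L - {l, u} - Z) le = int (rk u) - int (rk l) - 2"
proof -
  let ?\<Delta> = "order_complex (L - {l, u} - Z) le"
  have fin: "finite ?\<Delta>" using finite_order_complex[of "{l, u} \<union> Z"] by (simp add: set_diff_eq)
  have ne: "?\<Delta> \<noteq> {}" by (auto simp: order_complex_def chain_iff)
  define m where "m = Max (card ` ?\<Delta>)"
  have "m \<in> card ` ?\<Delta>" unfolding m_def by (rule Max_in) (use fin ne in auto)
  then obtain F where F: "F \<in> ?\<Delta>" "card F = m" by auto
  have F_max: "card G \<le> card F" if "G \<in> ?\<Delta>" for G using that fin F(2) by (simp add: m_def)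
  have "int (card F) = int (rk u) - int (rk l) - 1"
  proof (rule ccontr)
    assume "int (card F) \<noteq> int (rk u) - int (rk l) - 1"
    then have "- 1 \<le> int (rk u) - int (rk l) - 3 - int (card F)"
      using card_chain_le[OF F(1)] by linarith
    then obtain z where z: "z \<in> compatible Z F"
      using k_connected_realization_nonempty[OF k_connected_compatible[OF Z F(1)]] by blast
    then have "insert z F \<in> ?\<Delta>" "z \<notin> F" "finite F"
      using F(1) le_refl unfolding order_complex_def chain_iff compatible_def by blast+
    then show False using F_max[of "insert z F"] by simp
  qed
  then have "Max ((\<lambda>F. int (card F) - 1) ` ?\<Delta>) = int (rk u) - int (rk l) - 2"
    using fin F(1) by (intro Max_eqI) (auto intro!: image_eqI[of _ _ F] dest: card_chain_le)
  then show ?thesis by (simp add: poset_rank_def complex_dim_def)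
qed

theorem doubly_homotopy_CM_proper_part: "doubly_homotopy_CM (L - {l, u}) le"
  unfolding doubly_homotopy_CM_def
proof (intro conjI ballI)
  show "homotopy_CM (L - {l, u}) le" using homotopy_CM_remove[of "{}"] by simp
  fix y assume "y \<in> L - {l, u}"
  show "homotopy_CM (L - {l, u} - {y}) le" using homotopy_CM_remove by blast
  show "poset_rank (L - {l, u} - {y}) le = poset_rank (L - {l, u}) le"
    using poset_rank_remove[of "{y}"] poset_rank_remove[of "{}"] by simp
qed

end

section \<open>Absolute order and deletion of a point\<close>

text \<open>What types A and B have in common. By \<open>T_unique\<close> a reflection moving
  \<open>j\<close> is determined by the image of \<open>j\<close>; by \<open>T_exchange\<close> two
  distinct reflections moving \<open>j\<close> can be traded for a pair whose right factor fixes
  \<open>j\<close>. The latter fails in type D, where the product of \<open>((1, 2))\<close> and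
  \<open>((1, -2))\<close> sends 1 to -1, as no reflection does.\<close>

locale reflection_system =
  fixes G :: "('p \<Rightarrow> 'p) monoid" and T :: "('p \<Rightarrow> 'p) set"
  assumes G_group: "group G" and G_mult: "mult G = (\<circ>)" and G_one: "one G = id"
    and finite_G: "finite (carrier G)"
    and T_sub: "T \<subseteq> carrier G"
    and T_gen: "\<lbrakk>w \<in> carrier G; w j \<noteq> j\<rbrakk> \<Longrightarrow> \<exists>t\<in>T. t (w j) = j \<and> (\<forall>x. w x = x \<longrightarrow> t x = x)"
    and finite_moved: "w \<in> carrier G \<Longrightarrow> finite {x. w x \<noteq> x}"
    and T_invol: "t \<in> T \<Longrightarrow> t \<circ> t = id"
    and T_conj: "\<lbrakk>s \<in> T; t \<in> T\<rbrakk> \<Longrightarrow> s \<circ> t \<circ> s \<in> T"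
    and T_unique: "\<lbrakk>s \<in> T; t \<in> T; s j = t j; s j \<noteq> j\<rbrakk> \<Longrightarrow> s = t"
    and T_exchange: "\<lbrakk>s \<in> T; t \<in> T; s j \<noteq> j; t j \<noteq> j; s \<noteq> t\<rbrakk> \<Longrightarrow>
      \<exists>r\<in>T. \<exists>s'\<in>T. s \<circ> t = r \<circ> s' \<and> s' j = j"
begin

sublocale group G by (rule G_group)

abbreviation len :: "('p \<Rightarrow> 'p) \<Rightarrow> nat" where
  "len \<equiv> absolute_length G T"

section \<open>Words in reflections\<close>

definition wprod :: "('p \<Rightarrow> 'p) list \<Rightarrow> 'p \<Rightarrow> 'p" where
  "wprod ts = foldr (\<circ>) ts id"

lemma wprod_simps [simp]: "wprod [] = id" "wprod (t # ts) = t \<circ> wprod ts"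
  by (simp_all add: wprod_def)

lemma wprod_append: "wprod (ts @ us) = wprod ts \<circ> wprod us"
  by (induction ts) (simp_all add: comp_assoc)

lemma closed_comp: "u \<in> carrier G \<Longrightarrow> v \<in> carrier G \<Longrightarrow> u \<circ> v \<in> carrier G"
  using m_closed by (simp add: G_mult)

lemma id_closed: "id \<in> carrier G"
  using one_closed by (simp add: G_one)

lemma inv_comp: "u \<in> carrier G \<Longrightarrow> inv\<^bsub>G\<^esub> u \<circ> u = id" "u \<in> carrier G \<Longrightarrow> u \<circ> inv\<^bsub>G\<^esub> u = id"
  using l_inv r_inv by (simp_all add: G_mult G_one)

lemma inv_comp_cancel:
  fixes x :: "'p \<Rightarrow> 'p"
  shows "u \<in> carrier G \<Longrightarrow> inv\<^bsub>G\<^esub> u \<circ> (u \<circ> x) = x" "u \<in> carrier G \<Longrightarrow> u \<circ> (inv\<^bsub>G\<^esub> u \<circ> x) = x"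
  using inv_comp by (simp_all flip: comp_assoc)

lemma inj_carrier: "u \<in> carrier G \<Longrightarrow> inj u"
  by (metis inv_comp(1) inj_on_id inj_on_imageI2)

lemma carrier_eq_iff: "u \<in> carrier G \<Longrightarrow> u x = u y \<longleftrightarrow> x = y"
  using inj_carrier inj_eq by metis

lemma T_invol_cancel:
  fixes x :: "'p \<Rightarrow> 'p"
  shows "t \<in> T \<Longrightarrow> t \<circ> (t \<circ> x) = x" "t \<in> T \<Longrightarrow> t (t j) = j"
  using T_invol by (simp_all flip: comp_assoc) (metis comp_apply id_apply)

lemma wprod_closed: "set ts \<subseteq> T \<Longrightarrow> wprod ts \<in> carrier G"
  using T_sub by (induction ts) (auto intro: closed_comp id_closed)

lemma wprod_fixes: "set ts \<subseteq> {t. t j = j} \<Longrightarrow> wprod ts j = j"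
  by (induction ts) auto

text \<open>\<open>T_gen\<close> supplies a reflection that undoes \<open>w\<close> at
  \<open>j\<close> and keeps the fixed points of \<open>w\<close>, so the set of moved points
  shrinks.\<close>

lemma exists_word: "w \<in> carrier G \<Longrightarrow> \<exists>ts. set ts \<subseteq> T \<and> wprod ts = w"
proof (induction "card {x. w x \<noteq> x}" arbitrary: w rule: less_induct)
  case less
  show ?case
  proof (cases "w = id")
    case True
    then show ?thesis by (intro exI[of _ "[]"]) simp
  next
    case False
    then obtain j where j: "w j \<noteq> j" by (auto simp: fun_eq_iff)
    then obtain t where t: "t \<in> T" "t (w j) = j" "\<And>x. w x = x \<Longrightarrow> t x = x"
      using T_gen less.prems by blast
    have tw: "t \<circ> w \<in> carrier G" using t(1) T_sub less.prems closed_comp by blast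
    have "{x. (t \<circ> w) x \<noteq> x} \<subset> {x. w x \<noteq> x}"
      using t(2,3) j by auto
    then have "card {x. (t \<circ> w) x \<noteq> x} < card {x. w x \<noteq> x}"
      using finite_moved[OF less.prems] by (rule psubset_card_mono[rotated])
    then obtain ts where "set ts \<subseteq> T" "wprod ts = t \<circ> w" using less.hyps tw by blast
    then show ?thesis
      using t(1) T_invol_cancel(1)[OF t(1)] by (intro exI[of _ "t # ts"]) simp
  qed
qed

lemma len_eq: "len w = (LEAST k. \<exists>ts. length ts = k \<and> set ts \<subseteq> T \<and> wprod ts = w)"
  by (simp add: absolute_length_def G_mult G_one wprod_def)

lemma len_word:
  assumes "w \<in> carrier G" obtains ts where "set ts \<subseteq> T" "wprod ts = w" "length ts = len w"
proof -
  have "\<exists>k ts. length ts = k \<and> set ts \<subseteq> T \<and> wprod ts = w" using exists_word[OF assms] by blast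
  then have "\<exists>ts. length ts = len w \<and> set ts \<subseteq> T \<and> wprod ts = w"
    unfolding len_eq by (rule LeastI_ex)
  then show ?thesis using that by blast
qed

lemma len_le_length: "set ts \<subseteq> T \<Longrightarrow> len (wprod ts) \<le> length ts"
  unfolding len_eq by (rule Least_le) blast

lemma len_comp_le: "u \<in> carrier G \<Longrightarrow> v \<in> carrier G \<Longrightarrow> len (u \<circ> v) \<le> len u + len v"
proof -
  assume "u \<in> carrier G" "v \<in> carrier G"
  then obtain ts us where "set ts \<subseteq> T" "wprod ts = u" "length ts = len u"
    "set us \<subseteq> T" "wprod us = v" "length us = len v" by (metis len_word)
  then show ?thesis using len_le_length[of "ts @ us"] by (simp add: wprod_append)
qed

lemma len_T: "t \<in> T \<Longrightarrow> len t \<le> 1"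
  using len_le_length[of "[t]"] by simp

lemma len_id: "len id = 0"
  using len_le_length[of "[]"] by simp

lemma len_0: "w \<in> carrier G \<Longrightarrow> len w = 0 \<Longrightarrow> w = id"
  by (metis len_word length_0_conv wprod_simps(1))

lemma conj_left: "w \<in> carrier G \<Longrightarrow> t \<in> T \<Longrightarrow> \<exists>t'\<in>T. w \<circ> t = t' \<circ> w"
proof -
  have "t \<in> T \<Longrightarrow> \<exists>t'\<in>T. wprod ts \<circ> t = t' \<circ> wprod ts" if "set ts \<subseteq> T" for ts
    using that
  proof (induction ts)
    case (Cons s ts)
    have "set ts \<subseteq> T" using Cons.prems by simp
    then obtain t' where t': "t' \<in> T" "wprod ts \<circ> t = t' \<circ> wprod ts" using Cons.IH Cons.prems(1) by blast
    have s: "s \<in> T" using Cons.prems by simp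
    have "wprod (s # ts) \<circ> t = s \<circ> t' \<circ> s \<circ> wprod (s # ts)"
      using t'(2) T_invol_cancel(1)[OF s] by (simp add: comp_assoc)
    then show ?case using T_conj[OF s t'(1)] by blast
  qed auto
  then show "w \<in> carrier G \<Longrightarrow> t \<in> T \<Longrightarrow> \<exists>t'\<in>T. w \<circ> t = t' \<circ> w"
    using exists_word by metis
qed

lemma conj_right: "w \<in> carrier G \<Longrightarrow> t \<in> T \<Longrightarrow> \<exists>t'\<in>T. t \<circ> w = w \<circ> t'"
proof -
  assume w: "w \<in> carrier G" and t: "t \<in> T"
  then obtain t' where t': "t' \<in> T" "inv\<^bsub>G\<^esub> w \<circ> t = t' \<circ> inv\<^bsub>G\<^esub> w"
    using conj_left[OF inv_closed] by blast
  have "t \<circ> w = w \<circ> (inv\<^bsub>G\<^esub> w \<circ> t) \<circ> w"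
    using inv_comp_cancel(2)[OF w] by simp
  also have "\<dots> = w \<circ> t'" unfolding t'(2) using inv_comp[OF w] by (simp add: comp_assoc)
  finally show ?thesis using t'(1) by blast
qed

section \<open>Normal form of words and deletion of a point\<close>

text \<open>Letters that move \<open>j\<close> are pushed to the left. When two of them meet, they
  cancel if equal; otherwise \<open>T_exchange\<close> replaces them by a pair whose right letter
  fixes \<open>j\<close>. At most one letter moving \<open>j\<close> survives, at the front, and the
  word never grows.\<close>

lemma word_normal_form:
  assumes "set ts \<subseteq> T"
  shows "\<exists>ss. set ss \<subseteq> {t \<in> T. t j = j} \<and>
    (wprod ts = wprod ss \<and> length ss \<le> length ts \<or>
     (\<exists>t\<in>T. t j \<noteq> j \<and> wprod ts = t \<circ> wprod ss \<and> length ss + 1 \<le> length ts))"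
  using assms
proof (induction ts)
  case Nil
  then show ?case by (intro exI[of _ "[]"]) simp
next
  case (Cons s ts)
  then have s: "s \<in> T" "set ts \<subseteq> T" by simp_all
  obtain ss where ss: "set ss \<subseteq> {t \<in> T. t j = j}"
    and disj: "wprod ts = wprod ss \<and> length ss \<le> length ts \<or>
     (\<exists>t\<in>T. t j \<noteq> j \<and> wprod ts = t \<circ> wprod ss \<and> length ss + 1 \<le> length ts)"
    using Cons.IH[OF s(2)] by blast
  note s = s(1)
  from disj show ?case
  proof (elim disjE bexE conjE)
    assume "wprod ts = wprod ss" "length ss \<le> length ts"
    then show ?thesis
      using ss s by (cases "s j = j"; (intro exI[of _ "s # ss"], force)?; intro exI[of _ ss]) auto
  next
    fix t assume t: "t \<in> T" "t j \<noteq> j" "wprod ts = t \<circ> wprod ss" "length ss + 1 \<le> length ts"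
    show ?thesis
    proof (cases "s j = j")
      \<comment> \<open>A letter \<open>s\<close> fixing \<open>j\<close> passes \<open>t\<close> at
        the cost of conjugating it; the conjugate still moves \<open>j\<close> because
        \<open>s\<close> is injective and fixes \<open>j\<close>.\<close>
      case True
      have "s (t j) \<noteq> j" using True t(2) carrier_eq_iff[of s "t j" j] s T_sub by auto
      moreover have "wprod (s # ts) = (s \<circ> t \<circ> s) \<circ> wprod (s # ss)"
        using t(3) T_invol_cancel(1)[OF s] by (simp add: comp_assoc)
      ultimately show ?thesis
        using True s ss t T_conj[OF s t(1)]
        by (intro exI[of _ "s # ss"] conjI disjI2 bexI[of _ "s \<circ> t \<circ> s"]) auto
    next
      case False
      show ?thesis
      proof (cases "s = t")
        case True
        then have "wprod (s # ts) = wprod ss" using t T_invol_cancel(1)[OF s] by simp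
        then show ?thesis using ss t by (intro exI[of _ ss]) auto
      next
        case neq: False
        obtain r s' where r: "r \<in> T" "s' \<in> T" "s \<circ> t = r \<circ> s'" "s' j = j"
          using T_exchange[OF s t(1) False t(2) neq] by blast
        have eq: "wprod (s # ts) = r \<circ> wprod (s' # ss)"
          using t(3) r(3) by (simp flip: comp_assoc)
        show ?thesis
        proof (cases "r j = j")
          case True
          then show ?thesis using eq r ss t by (intro exI[of _ "r # s' # ss"]) auto
        next
          case False
          then show ?thesis using eq r ss t
            by (intro exI[of _ "s' # ss"] conjI disjI2 bexI[of _ r]) auto
        qed
      qed
    qed
  qed
qed

text \<open>On cycle notation this removes \<open>j\<close> from its cycle.\<close>

definition delete_point :: "'p \<Rightarrow> ('p \<Rightarrow> 'p) \<Rightarrow> 'p \<Rightarrow> 'p" where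
  "delete_point j u = (if u j = j then u else (THE t. t \<in> T \<and> t j = u j) \<circ> u)"

lemma delete_point_fixed: "u j = j \<Longrightarrow> delete_point j u = u"
  by (simp add: delete_point_def)

lemma delete_point_eqI:
  assumes "t \<in> T" "t j \<noteq> j" "u = t \<circ> v" "v j = j"
  shows "delete_point j u = v"
proof -
  have "u j = t j" using assms by simp
  moreover from this have "(THE t. t \<in> T \<and> t j = u j) = t"
    using assms T_unique by (intro the_equality) auto
  ultimately show ?thesis
    using assms T_invol_cancel(1)[OF assms(1)] by (simp add: delete_point_def)
qed

text \<open>In the normal form of a shortest word, the front letter is exactly the reflection that
  \<open>delete_point\<close> strips; so the length drops by one and no more.\<close>

lemma delete_point_moved:
  assumes u: "u \<in> carrier G" "u j \<noteq> j"
  obtains t where "t \<in> T" "t j = u j" "u = t \<circ> delete_point j u" "delete_point j u \<in> carrier G"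
    "delete_point j u j = j" "len u = len (delete_point j u) + 1"
proof -
  obtain ts where ts: "set ts \<subseteq> T" "wprod ts = u" "length ts = len u" using len_word[OF u(1)] .
  obtain ss where ss: "set ss \<subseteq> {t \<in> T. t j = j}"
    and disj: "wprod ts = wprod ss \<and> length ss \<le> length ts \<or>
     (\<exists>t\<in>T. t j \<noteq> j \<and> wprod ts = t \<circ> wprod ss \<and> length ss + 1 \<le> length ts)"
    using word_normal_form[OF ts(1)] by blast
  have ssj: "wprod ss j = j" and ssT: "set ss \<subseteq> T" using ss wprod_fixes[of ss j] by auto
  then obtain t where t: "t \<in> T" "t j \<noteq> j" "u = t \<circ> wprod ss" "length ss + 1 \<le> len u"
    using disj ts u(2) by auto
  have d: "delete_point j u = wprod ss" using delete_point_eqI[OF t(1,2,3) ssj] .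
  have "len (wprod ss) + 1 \<le> len u" using len_le_length[OF ssT] t(4) by linarith
  moreover have "len u \<le> 1 + len (wprod ss)"
    using len_comp_le[of t "wprod ss"] t(1,3) T_sub wprod_closed[OF ssT] len_T[OF t(1)] by auto
  ultimately show ?thesis
    using that[of t] t d ssj wprod_closed[OF ssT] by simp
qed

lemma delete_point_fixes: "u \<in> carrier G \<Longrightarrow> delete_point j u j = j"
  by (metis delete_point_fixed delete_point_moved)

section \<open>Deletion and factorizations with additive length\<close>

text \<open>The absolute order between \<open>u\<close> and \<open>u \<circ> x\<close>, with the
  quotient \<open>x\<close> named so that no inverses appear.\<close>

definition additive :: "('p \<Rightarrow> 'p) \<Rightarrow> ('p \<Rightarrow> 'p) \<Rightarrow> bool" where
  "additive u x \<longleftrightarrow> u \<in> carrier G \<and> x \<in> carrier G \<and> len (u \<circ> x) = len u + len x"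

lemma additiveI: "u \<in> carrier G \<Longrightarrow> x \<in> carrier G \<Longrightarrow> len u + len x \<le> len (u \<circ> x) \<Longrightarrow> additive u x"
  using len_comp_le[of u x] by (simp add: additive_def)

text \<open>The reflection is stripped on the left, whereas the order requires a factor on the
  right; conjugation carries it across.\<close>

lemma delete_point_additive:
  assumes "u \<in> carrier G"
  shows "\<exists>z. additive (delete_point j u) z \<and> u = delete_point j u \<circ> z"
proof (cases "u j = j")
  case True
  then show ?thesis
    using assms by (intro exI[of _ id]) (simp add: delete_point_fixed additive_def id_closed len_id)
next
  case False
  then obtain t where t: "t \<in> T" "u = t \<circ> delete_point j u" "delete_point j u \<in> carrier G"
    "len u = len (delete_point j u) + 1" using delete_point_moved[OF assms] by metis
  obtain t' where t': "t' \<in> T" "t \<circ> delete_point j u = delete_point j u \<circ> t'"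
    using conj_right[OF t(3,1)] by blast
  have "u = delete_point j u \<circ> t'" using t(2) t'(2) by simp
  moreover have "additive (delete_point j u) t'"
    using t t' len_T[OF t'(1)] T_sub \<open>u = delete_point j u \<circ> t'\<close> by (intro additiveI) auto
  ultimately show ?thesis by blast
qed

text \<open>If \<open>u\<close> moved \<open>j\<close>, so would \<open>x\<close>. The reflection
  stripped from \<open>u\<close> and the one stripped from \<open>x\<close>, conjugated to the
  front, would then send \<open>j\<close> to the same point, coincide by \<open>T_unique\<close> and
  cancel, which costs two units of length. Hence a point moved by a factor is also moved by the
  product.\<close>

lemma additive_fixes:
  assumes ux: "additive u x" and j: "u (x j) = j"
  shows "u j = j" "x j = j"
proof -
  have c: "u \<in> carrier G" "x \<in> carrier G" using ux by (auto simp: additive_def)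
  show uj: "u j = j"
  proof (rule ccontr)
    assume uj: "u j \<noteq> j"
    then have xj: "x j \<noteq> j" using j by auto
    let ?u = "delete_point j u" and ?x = "delete_point j x"
    obtain t where t: "t \<in> T" "t j = u j" "u = t \<circ> ?u" "?u \<in> carrier G" "?u j = j" "len u = len ?u + 1"
      using delete_point_moved[OF c(1) uj] by blast
    obtain s where s: "s \<in> T" "s j = x j" "x = s \<circ> ?x" "?x \<in> carrier G" "?x j = j" "len x = len ?x + 1"
      using delete_point_moved[OF c(2) xj] by blast
    obtain s2 where s2: "s2 \<in> T" "?u \<circ> s = s2 \<circ> ?u" using conj_left[OF t(4) s(1)] by blast
    have eq: "u \<circ> x = t \<circ> (s2 \<circ> (?u \<circ> ?x))"
      using t(3) s(3) s2(2) by (metis comp_assoc)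
    have "t (s2 j) = j"
      using fun_cong[OF eq, of j] j t(5) s(5) by simp
    then have "s2 j = t j" using T_invol_cancel(2)[OF t(1)] by metis
    then have "t = s2" using T_unique[OF t(1) s2(1), of j] t(2) uj by simp
    then have "u \<circ> x = ?u \<circ> ?x" using eq T_invol_cancel(1)[OF t(1)] by simp
    then have "len (u \<circ> x) \<le> len ?u + len ?x" using len_comp_le t(4) s(4) by simp
    then show False using ux t(6) s(6) by (simp add: additive_def)
  qed
  then show "x j = j" using carrier_eq_iff[OF c(1), of "x j" j] j by simp
qed

text \<open>If \<open>j\<close> is moved by \<open>u\<close> or \<open>x\<close>, it is moved by the
  product, whose length therefore drops by exactly one. When both factors move \<open>j\<close>,
  their two reflections are brought to the front as \<open>t \<circ> s2\<close> and exchanged for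
  \<open>r \<circ> s'\<close>; deletion strips \<open>r\<close>, and \<open>s'\<close>, conjugated
  past the deletion of \<open>u\<close>, takes the place of the reflection that \<open>x\<close>
  loses.\<close>

lemma delete_point_mono:
  assumes ux: "additive u x"
  shows "\<exists>z. additive (delete_point j u) z \<and> delete_point j (u \<circ> x) = delete_point j u \<circ> z"
proof -
  have c: "u \<in> carrier G" "x \<in> carrier G" "u \<circ> x \<in> carrier G"
    and lux: "len (u \<circ> x) = len u + len x" using ux closed_comp by (auto simp: additive_def)
  let ?u = "delete_point j u" and ?v = "delete_point j (u \<circ> x)" and ?x = "delete_point j x"
  show ?thesis
  proof (cases "x j = j")
    case xj: True
    show ?thesis
    proof (cases "u j = j")
      case True
      then show ?thesis using xj ux by (intro exI[of _ x]) (simp add: delete_point_fixed)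
    next
      case False
      obtain t where t: "t \<in> T" "t j = u j" "u = t \<circ> ?u" "?u \<in> carrier G" "?u j = j" "len u = len ?u + 1"
        using delete_point_moved[OF c(1) False] by blast
      have v: "?v = ?u \<circ> x"
      proof (rule delete_point_eqI[OF t(1)])
        show "t j \<noteq> j" using t(2) False by simp
        show "u \<circ> x = t \<circ> (?u \<circ> x)" using t(3) by (metis comp_assoc)
        show "(?u \<circ> x) j = j" using t(5) xj by simp
      qed
      have "(u \<circ> x) j \<noteq> j" using False xj by simp
      then have "len (u \<circ> x) = len ?v + 1" using delete_point_moved[OF c(3)] by blast
      then have "additive ?u x" using v lux t c by (intro additiveI) auto
      then show ?thesis using v by blast
    qed
  next
    case xj: False
    have vj: "(u \<circ> x) j \<noteq> j" using additive_fixes(2)[OF ux, of j] xj by auto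
    then have lv: "len (u \<circ> x) = len ?v + 1" using delete_point_moved[OF c(3)] by blast
    obtain s where s: "s \<in> T" "s j = x j" "x = s \<circ> ?x" "?x \<in> carrier G" "?x j = j" "len x = len ?x + 1"
      using delete_point_moved[OF c(2) xj] by blast
    show ?thesis
    proof (cases "u j = j")
      case True
      obtain s2 where s2: "s2 \<in> T" "u \<circ> s = s2 \<circ> u" using conj_left[OF c(1) s(1)] by blast
      have v: "?v = u \<circ> ?x"
      proof (rule delete_point_eqI[OF s2(1)])
        show eq: "u \<circ> x = s2 \<circ> (u \<circ> ?x)" using s(3) s2(2) by (metis comp_assoc)
        show "(u \<circ> ?x) j = j" using True s(5) by simp
        show "s2 j \<noteq> j" using vj fun_cong[OF eq, of j] True s(5) by simp
      qed
      have "additive u ?x" using v lv lux s c by (intro additiveI) auto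
      then show ?thesis using v True by (auto simp: delete_point_fixed)
    next
      case uj: False
      obtain t where t: "t \<in> T" "t j = u j" "u = t \<circ> ?u" "?u \<in> carrier G" "?u j = j" "len u = len ?u + 1"
        using delete_point_moved[OF c(1) uj] by blast
      obtain s2 where s2: "s2 \<in> T" "?u \<circ> s = s2 \<circ> ?u" using conj_left[OF t(4) s(1)] by blast
      have eq: "u \<circ> x = t \<circ> (s2 \<circ> (?u \<circ> ?x))"
        using t(3) s(3) s2(2) by (metis comp_assoc)
      have "s2 j \<noteq> j"
        using fun_cong[OF s2(2), of j] t(5) s(2) xj carrier_eq_iff[OF t(4), of "s j" j] by auto
      moreover have "t \<noteq> s2"
      proof
        assume "t = s2"
        then have "u \<circ> x = ?u \<circ> ?x" using eq T_invol_cancel(1)[OF t(1)] by simp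
        then show False using vj t(5) s(5) by simp
      qed
      ultimately obtain r s' where r: "r \<in> T" "s' \<in> T" "t \<circ> s2 = r \<circ> s'" "s' j = j"
        using T_exchange[OF t(1) s2(1)] t(2) uj by metis
      have v: "?v = s' \<circ> (?u \<circ> ?x)"
      proof (rule delete_point_eqI[OF r(1)])
        show eq': "u \<circ> x = r \<circ> (s' \<circ> (?u \<circ> ?x))" using eq r(3) by (metis comp_assoc)
        show "(s' \<circ> (?u \<circ> ?x)) j = j" using r(4) t(5) s(5) by simp
        then show "r j \<noteq> j" using vj fun_cong[OF eq', of j] by simp
      qed
      obtain s3 where s3: "s3 \<in> T" "s' \<circ> ?u = ?u \<circ> s3" using conj_right[OF t(4) r(2)] by blast
      have v': "?v = ?u \<circ> (s3 \<circ> ?x)" using v s3(2) by (metis comp_assoc)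
      have z: "s3 \<circ> ?x \<in> carrier G" "len (s3 \<circ> ?x) \<le> len x"
        using s3(1) T_sub s(4) closed_comp len_comp_le[of s3 ?x] len_T[OF s3(1)] s(6) by auto
      then have "additive ?u (s3 \<circ> ?x)" using v' lv lux t by (intro additiveI) auto
      then show ?thesis using v' by blast
    qed
  qed
qed

section \<open>The absolute order and its intervals\<close>

lemma absolute_le_iff:
  assumes "u \<in> carrier G" "v \<in> carrier G"
  shows "absolute_le G T u v \<longleftrightarrow> (\<exists>x. additive u x \<and> v = u \<circ> x)"
proof
  assume "absolute_le G T u v"
  then show "\<exists>x. additive u x \<and> v = u \<circ> x"
    using assms inv_comp_cancel[OF assms(1), of v]
    by (intro exI[of _ "inv\<^bsub>G\<^esub> u \<circ> v"]) (auto simp: absolute_le_def additive_def G_mult intro: closed_comp)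
next
  assume "\<exists>x. additive u x \<and> v = u \<circ> x"
  then show "absolute_le G T u v"
    using inv_comp_cancel(1)[OF assms(1)] by (auto simp: absolute_le_def additive_def G_mult)
qed

text \<open>Subadditivity is applied twice between equal outer terms, so both inequalities are
  equalities.\<close>

lemma additive_assoc:
  assumes "additive u x" "additive (u \<circ> x) y"
  shows "additive x y" "additive u (x \<circ> y)"
proof -
  have c: "u \<in> carrier G" "x \<in> carrier G" "y \<in> carrier G" "x \<circ> y \<in> carrier G"
    using assms closed_comp by (auto simp: additive_def)
  have "len u + len x + len y = len (u \<circ> (x \<circ> y))"
    using assms by (simp add: additive_def comp_assoc)
  moreover have "len (u \<circ> (x \<circ> y)) \<le> len u + len (x \<circ> y)" "len (x \<circ> y) \<le> len x + len y"
    using len_comp_le c by auto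
  ultimately show "additive x y" "additive u (x \<circ> y)" using c by (auto simp: additive_def)
qed

lemma additive_assoc':
  assumes "additive x y" "additive u (x \<circ> y)"
  shows "additive u x" "additive (u \<circ> x) y"
proof -
  have c: "u \<in> carrier G" "x \<in> carrier G" "y \<in> carrier G" "u \<circ> x \<in> carrier G"
    using assms closed_comp by (auto simp: additive_def)
  have "len u + len x + len y = len (u \<circ> x \<circ> y)"
    using assms by (simp add: additive_def comp_assoc)
  moreover have "len (u \<circ> x \<circ> y) \<le> len (u \<circ> x) + len y" "len (u \<circ> x) \<le> len u + len x"
    using len_comp_le c by auto
  ultimately show "additive u x" "additive (u \<circ> x) y" using c by (auto simp: additive_def)
qed

lemma absolute_le_trans:
  assumes "u \<in> carrier G" "v \<in> carrier G" "w \<in> carrier G"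
    and "absolute_le G T u v" "absolute_le G T v w"
  shows "absolute_le G T u w"
proof -
  obtain x y where "additive u x" "v = u \<circ> x" "additive v y" "w = v \<circ> y"
    using assms absolute_le_iff by metis
  then have "additive u (x \<circ> y)" "w = u \<circ> (x \<circ> y)"
    using additive_assoc(2)[of u x y] by (auto simp: comp_assoc)
  then show ?thesis using absolute_le_iff[OF assms(1,3)] by blast
qed

lemma absolute_le_refl: "u \<in> carrier G \<Longrightarrow> absolute_le G T u u"
  by (simp add: absolute_le_def G_mult inv_comp len_id)

lemma absolute_le_id: "u \<in> carrier G \<Longrightarrow> absolute_le G T id u"
  using absolute_le_iff[OF id_closed] by (auto simp: additive_def id_closed len_id)

lemma NC_iff: "w \<in> NC G T c \<longleftrightarrow> w \<in> carrier G \<and> absolute_le G T w c"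
  using absolute_le_id by (auto simp: NC_def G_one)

theorem doubly_homotopy_CM_NC:
  assumes c: "c \<in> carrier G" "c \<noteq> id"
  shows "doubly_homotopy_CM (NC G T c - {id, c}) (absolute_le G T)"
proof -
  interpret reducible_poset "NC G T c" "absolute_le G T" len id c
  proof
    show "finite (NC G T c)" by (rule finite_subset[OF _ finite_G]) (auto simp: NC_def)
    show "absolute_le G T x x" if "x \<in> NC G T c" for x using that absolute_le_refl by (simp add: NC_iff)
    show "absolute_le G T x z" if "x \<in> NC G T c" "y \<in> NC G T c" "z \<in> NC G T c"
      "absolute_le G T x y" "absolute_le G T y z" for x y z
      using that absolute_le_trans by (auto simp: NC_iff)
    show "id \<in> NC G T c" "c \<in> NC G T c" "id \<noteq> c"
      using c absolute_le_id absolute_le_refl id_closed by (auto simp: NC_iff)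
    show "absolute_le G T id x" "absolute_le G T x c" if "x \<in> NC G T c" for x
      using that absolute_le_id by (auto simp: NC_iff)
    show "len x < len y" if "x \<in> NC G T c" "y \<in> NC G T c" "absolute_le G T x y" "x \<noteq> y" for x y
    proof -
      obtain z where z: "additive x z" "y = x \<circ> z" using absolute_le_iff \<open>absolute_le G T x y\<close> \<open>x \<in> NC G T c\<close> \<open>y \<in> NC G T c\<close>
        unfolding NC_iff by blast
      then have "len z \<noteq> 0" using len_0[of z] that(4) by (auto simp: additive_def)
      then show ?thesis using z by (simp add: additive_def)
    qed
    fix p q y assume pqy: "p \<in> NC G T c" "q \<in> NC G T c" "y \<in> NC G T c"
      "absolute_le G T p y" "y \<noteq> p" "absolute_le G T y q"
    have cc: "p \<in> carrier G" "q \<in> carrier G" "y \<in> carrier G" using pqy by (auto simp: NC_iff)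
    obtain y1 where y1: "additive p y1" "y = p \<circ> y1" using pqy cc absolute_le_iff by metis
    obtain y2 where y2: "additive y y2" "q = y \<circ> y2" using pqy cc absolute_le_iff by metis
    have "y1 \<noteq> id" using y1(2) pqy(5) by auto
    then obtain j where j: "y1 j \<noteq> j" by (auto simp: fun_eq_iff)
    define \<rho> where "\<rho> x = p \<circ> delete_point j (inv\<^bsub>G\<^esub> p \<circ> x)" for x
    have \<rho>_comp: "\<rho> (p \<circ> x) = p \<circ> delete_point j x" for x
      using inv_comp_cancel(1)[OF cc(1)] by (simp add: \<rho>_def)
    have p_cancel: "p \<circ> x = p \<circ> x' \<longleftrightarrow> x = x'" for x x' :: "'p \<Rightarrow> 'p"
      using inv_comp_cancel(1)[OF cc(1)] by metis
    have \<rho>_add: "\<exists>z. additive p (delete_point j x) \<and> additive (p \<circ> delete_point j x) z \<and>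
        p \<circ> x = p \<circ> delete_point j x \<circ> z" if "additive p x" for x
    proof -
      have "x \<in> carrier G" using that by (simp add: additive_def)
      then obtain z where z: "additive (delete_point j x) z" "x = delete_point j x \<circ> z"
        using delete_point_additive by blast
      then have "additive p (delete_point j x \<circ> z)" using that by simp
      from additive_assoc'[OF z(1) this] show ?thesis
        using z(2) by (metis comp_assoc)
    qed
    show "\<exists>\<rho>. (\<forall>x\<in>NC G T c. absolute_le G T p x \<longrightarrow> absolute_le G T x q \<longrightarrow>
             \<rho> x \<in> NC G T c \<and> absolute_le G T p (\<rho> x) \<and> absolute_le G T (\<rho> x) x \<and>
             len x \<le> len (\<rho> x) + 1 \<and> \<rho> (\<rho> x) = \<rho> x) \<and>
           (\<forall>x\<in>NC G T c. \<forall>x'\<in>NC G T c. absolute_le G T p x \<longrightarrow> absolute_le G T x x' \<longrightarrow>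
             absolute_le G T x' q \<longrightarrow> absolute_le G T (\<rho> x) (\<rho> x')) \<and>
           \<rho> y \<noteq> y \<and> \<rho> q \<noteq> q"
    proof (rule exI[of _ \<rho>], intro conjI ballI impI)
      fix x assume x: "x \<in> NC G T c" "absolute_le G T p x" "absolute_le G T x q"
      then have xc: "x \<in> carrier G" by (simp add: NC_iff)
      obtain x1 where x1: "additive p x1" "x = p \<circ> x1" using x cc xc absolute_le_iff by metis
      have x1c: "x1 \<in> carrier G" using x1 by (simp add: additive_def)
      have \<rho>x: "\<rho> x = p \<circ> delete_point j x1" using \<rho>_comp x1(2) by simp
      obtain z where z: "additive p (delete_point j x1)" "additive (p \<circ> delete_point j x1) z"
        "p \<circ> x1 = p \<circ> delete_point j x1 \<circ> z" using \<rho>_add[OF x1(1)] by blast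
      have \<rho>c: "\<rho> x \<in> carrier G" using z(2) \<rho>x by (simp add: additive_def)
      show le: "absolute_le G T (\<rho> x) x"
        using absolute_le_iff[OF \<rho>c xc] z(2,3) \<rho>x x1(2) by auto
      show "absolute_le G T p (\<rho> x)" using absolute_le_iff[OF cc(1) \<rho>c] z(1) \<rho>x by auto
      show "\<rho> x \<in> NC G T c" using absolute_le_trans[OF \<rho>c xc c(1) le] x(1) \<rho>c by (simp add: NC_iff)
      show "\<rho> (\<rho> x) = \<rho> x"
        unfolding \<rho>x \<rho>_comp using delete_point_fixed[of "delete_point j x1" j] delete_point_fixes[OF x1c] by simp
      have "len x1 \<le> len (delete_point j x1) + 1"
      proof (cases "x1 j = j")
        case False
        then show ?thesis by (rule delete_point_moved[OF x1c]) simp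
      qed (simp add: delete_point_fixed)
      then show "len x \<le> len (\<rho> x) + 1"
        using x1 z(1) \<rho>x by (simp add: additive_def)
    next
      fix x x' assume x: "x \<in> NC G T c" "x' \<in> NC G T c" "absolute_le G T p x" "absolute_le G T x x'"
      then have xc: "x \<in> carrier G" "x' \<in> carrier G" by (auto simp: NC_iff)
      obtain x1 where x1: "additive p x1" "x = p \<circ> x1" using x cc xc absolute_le_iff by metis
      obtain w where w: "additive x w" "x' = x \<circ> w" using x xc absolute_le_iff by metis
      have a: "additive x1 w" "additive p (x1 \<circ> w)" using additive_assoc[OF x1(1)] w x1(2) by auto
      obtain z where z: "additive (delete_point j x1) z" "delete_point j (x1 \<circ> w) = delete_point j x1 \<circ> z"
        using delete_point_mono[OF a(1)] by blast
      have "additive p (delete_point j (x1 \<circ> w))" using \<rho>_add[OF a(2)] by blast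
      then have "additive (p \<circ> delete_point j x1) z"
        using additive_assoc'(2)[OF z(1)] z(2) by simp
      moreover have "\<rho> x' = \<rho> x \<circ> z" "\<rho> x = p \<circ> delete_point j x1"
        unfolding w(2) x1(2) comp_assoc \<rho>_comp z(2) by (simp_all add: comp_assoc)
      ultimately show "absolute_le G T (\<rho> x) (\<rho> x')"
        using absolute_le_iff[of "\<rho> x" "\<rho> x'"] closed_comp by (auto simp: additive_def)
    next
      have "delete_point j y1 \<noteq> y1"
        using delete_point_fixes[of y1 j] y1(1) j by (auto simp: additive_def)
      then show "\<rho> y \<noteq> y" unfolding y1(2) \<rho>_comp p_cancel .
      \<comment> \<open>The point \<open>j\<close> moved by \<open>y1\<close> is also moved by
        \<open>y1 \<circ> y2\<close>, so the reduction moves \<open>q\<close> together with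
        \<open>y\<close>.\<close>
      have "additive y1 y2" using additive_assoc(1)[OF y1(1)] y2(1) y1(2) by simp
      then have "y1 (y2 j) \<noteq> j" "y1 \<circ> y2 \<in> carrier G" using additive_fixes(1)[of y1 y2 j] j closed_comp
        by (auto simp: additive_def)
      then have "delete_point j (y1 \<circ> y2) \<noteq> y1 \<circ> y2"
        using delete_point_fixes[of "y1 \<circ> y2" j] by auto
      then show "\<rho> q \<noteq> q" unfolding y2(2) y1(2) comp_assoc \<rho>_comp p_cancel .
    qed
  qed
  show ?thesis by (rule doubly_homotopy_CM_proper_part)
qed

end

section \<open>Types A and B\<close>

lemma cycle_of_list_nth:
  assumes "distinct cs" "i < length cs"
  shows "cycle_of_list cs (cs ! i) = cs ! (Suc i mod length cs)"
proof -
  have "map (cycle_of_list cs) cs = rotate 1 cs"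
    using cyclic_rotation[OF assms(1), of 1] by simp
  then have "map (cycle_of_list cs) cs ! i = rotate 1 cs ! i" by simp
  then show ?thesis using assms(2) nth_rotate[OF assms(2), of 1] by simp
qed

section \<open>Type A\<close>

lemma refl_A_iff:
  "t \<in> refl_A n \<longleftrightarrow> (\<exists>a\<in>{1..n}. \<exists>b\<in>{1..n}. a \<noteq> b \<and> t = Transposition.transpose a b)"
proof
  assume "t \<in> refl_A n"
  then show "\<exists>a\<in>{1..n}. \<exists>b\<in>{1..n}. a \<noteq> b \<and> t = Transposition.transpose a b"
    unfolding refl_A_def
  proof (elim CollectE exE conjE)
    fix i j assume "t = Transposition.transpose i j" "1 \<le> i" "i < j" "j \<le> n"
    then show ?thesis by (intro bexI[of _ i] bexI[of _ j]) auto
  qed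
next
  assume "\<exists>a\<in>{1..n}. \<exists>b\<in>{1..n}. a \<noteq> b \<and> t = Transposition.transpose a b"
  then obtain a b where ab: "a \<in> {1..n}" "b \<in> {1..n}" "a \<noteq> b" "t = Transposition.transpose a b" by blast
  then have "t = Transposition.transpose (min a b) (max a b)"
    by (simp add: min_def max_def transpose_commute)
  then show "t \<in> refl_A n"
    using ab unfolding refl_A_def by (intro CollectI exI[of _ "min a b"] exI[of _ "max a b"]) auto
qed

lemma transpose_in_refl_A:
  "a \<in> {1..n} \<Longrightarrow> b \<in> {1..n} \<Longrightarrow> a \<noteq> b \<Longrightarrow> Transposition.transpose a b \<in> refl_A n"
  unfolding refl_A_iff by blast

lemma refl_A_moved:
  assumes "t \<in> refl_A n" "t j \<noteq> j"
  shows "t = Transposition.transpose j (t j)" "j \<in> {1..n}" "t j \<in> {1..n}"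
proof -
  obtain a b where ab: "a \<in> {1..n}" "b \<in> {1..n}" "a \<noteq> b" "t = Transposition.transpose a b"
    using assms(1) by (auto simp: refl_A_iff)
  then have "j = a \<or> j = b" using assms(2) by (auto simp: Transposition.transpose_def split: if_splits)
  then show "t = Transposition.transpose j (t j)" "j \<in> {1..n}" "t j \<in> {1..n}"
    using ab by (auto simp: transpose_commute)
qed

lemma reflection_system_A: "reflection_system (sym_group n) (refl_A n)"
proof (rule reflection_system.intro)
  show "mult (sym_group n) = (\<circ>)" "one (sym_group n) = id"
    by (simp_all add: sym_group_mult sym_group_one)
  show "group (sym_group n)" by (rule sym_group_is_group)
  show "finite (carrier (sym_group n))"
    using finite_permutations[of "{1..n}"] by (simp add: sym_group_def)
  show "refl_A n \<subseteq> carrier (sym_group n)"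
    by (auto simp: refl_A_iff sym_group_carrier intro!: permutes_swap_id)
  show "finite {x. w x \<noteq> x}" if "w \<in> carrier (sym_group n)" for w
    by (rule finite_subset[of _ "{1..n}"])
      (use that permutes_not_in[of w "{1..n}"] in \<open>unfold sym_group_carrier, blast, simp\<close>)
  show "\<exists>t\<in>refl_A n. t (w j) = j \<and> (\<forall>x. w x = x \<longrightarrow> t x = x)"
    if w: "w \<in> carrier (sym_group n)" and j: "w j \<noteq> j" for w j
  proof -
    have p: "w permutes {1..n}" using w by (simp add: sym_group_carrier)
    have jn: "j \<in> {1..n}" using permutes_not_in[OF p] j by blast
    then have "w j \<in> {1..n}" using permutes_in_image[OF p] by blast
    then have "Transposition.transpose (w j) j \<in> refl_A n" using jn j unfolding refl_A_iff by blast
    \<comment> \<open>A fixed point of \<open>w\<close> is neither \<open>j\<close> nor, by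
      injectivity, \<open>w j\<close>.\<close>
    moreover have "Transposition.transpose (w j) j x = x" if "w x = x" for x
      using that j inj_eq[OF permutes_inj[OF p], of x j] by (auto simp: Transposition.transpose_def)
    ultimately show ?thesis by (intro bexI[of _ "Transposition.transpose (w j) j"]) auto
  qed
  show "t \<circ> t = id" if "t \<in> refl_A n" for t using that by (auto simp: refl_A_iff)
  show "s \<circ> t \<circ> s \<in> refl_A n" if st: "s \<in> refl_A n" "t \<in> refl_A n" for s t
  proof -
    obtain a b c d where ab: "a \<in> {1..n}" "b \<in> {1..n}" "a \<noteq> b" "s = Transposition.transpose a b"
      and cd: "c \<in> {1..n}" "d \<in> {1..n}" "c \<noteq> d" "t = Transposition.transpose c d"
      using st unfolding refl_A_iff by blast
    have "s \<circ> t \<circ> s = Transposition.transpose (s c) (s d)"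
      using ab cd by (auto simp: Transposition.transpose_def fun_eq_iff)
    moreover have "s c \<in> {1..n}" "s d \<in> {1..n}" "s c \<noteq> s d" using ab cd by (auto simp: Transposition.transpose_def)
    ultimately show ?thesis unfolding refl_A_iff by blast
  qed
  show "s = t" if "s \<in> refl_A n" "t \<in> refl_A n" "s j = t j" "s j \<noteq> j" for s t j
    using that by (metis refl_A_moved(1))
  show "\<exists>r\<in>refl_A n. \<exists>s'\<in>refl_A n. s \<circ> t = r \<circ> s' \<and> s' j = j"
    if st: "s \<in> refl_A n" "t \<in> refl_A n" "s j \<noteq> j" "t j \<noteq> j" "s \<noteq> t" for s t j
  proof -
    define a b where "a = s j" "b = t j"
    have s: "s = Transposition.transpose j a" "j \<in> {1..n}" "a \<in> {1..n}"
      and t: "t = Transposition.transpose j b" "b \<in> {1..n}"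
      using refl_A_moved[OF st(1,3)] refl_A_moved[OF st(2,4)] unfolding a_b_def by blast+
    have "a \<noteq> b" "a \<noteq> j" "b \<noteq> j" using st(3,4,5) s(1) t(1) unfolding a_b_def[symmetric] by blast+
    \<comment> \<open>The identity \<open>(j a)(j b) = (j b)(a b)\<close>, whose right factor fixes
      \<open>j\<close>.\<close>
    then have "s \<circ> t = Transposition.transpose j b \<circ> Transposition.transpose a b"
      "Transposition.transpose a b j = j"
      unfolding s t by (auto simp: Transposition.transpose_def fun_eq_iff)
    moreover have "Transposition.transpose j b \<in> refl_A n" "Transposition.transpose a b \<in> refl_A n"
      using transpose_in_refl_A[OF s(2) t(2)] transpose_in_refl_A[OF s(3) t(2)] \<open>a \<noteq> b\<close> \<open>b \<noteq> j\<close> by auto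
    ultimately show ?thesis by blast
  qed
qed

lemma cox_A_carrier: "cox_A n \<in> carrier (sym_group n)"
  using cycle_permutes[of "[1..<Suc n]"]
  by (simp add: cox_A_def sym_group_carrier atLeastLessThanSuc_atLeastAtMost del: upt_Suc)

lemma cox_A_neq_id:
  assumes "n \<ge> 2" shows "cox_A n \<noteq> id"
proof -
  have "cox_A n ([1..<Suc n] ! 0) = [1..<Suc n] ! (Suc 0 mod n)"
    unfolding cox_A_def by (subst cycle_of_list_nth) (use assms in \<open>auto simp del: upt_Suc\<close>)
  then have "cox_A n 1 = 2" using assms by (simp del: upt_Suc)
  then show ?thesis by auto
qed

section \<open>Type B\<close>

text \<open>For \<open>b = - a\<close> this is the balanced 1-cycle \<open>[a]\<close>, otherwise the paired transposition
  \<open>((a, b))\<close>.\<close>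

definition signed_swap :: "int \<Rightarrow> int \<Rightarrow> int \<Rightarrow> int" where
  "signed_swap a b x = (if x = a then b else if x = b then a
     else if x = - a then - b else if x = - b then - a else x)"

definition signed_points :: "nat \<Rightarrow> int set" where
  "signed_points n = {- int n..int n} - {0}"

lemma signed_points_uminus: "- a \<in> signed_points n \<longleftrightarrow> a \<in> signed_points n"
  by (auto simp: signed_points_def)

lemma signed_swap_simps:
  assumes "a \<noteq> 0" "b \<noteq> 0"
  shows "signed_swap a b (- x) = - signed_swap a b x"
    and "signed_swap a b (signed_swap a b x) = x"
    and "signed_swap a b = signed_swap b a"
    and "signed_swap a b = signed_swap (- a) (- b)"
  using assms by (auto simp: signed_swap_def fun_eq_iff)

text \<open>Conjugation renames points: the swap is an involution compatible with sign, so each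
  comparison in the definition can be transported through it.\<close>

lemma signed_swap_conj:
  assumes "a \<noteq> 0" "b \<noteq> 0"
  shows "signed_swap a b \<circ> signed_swap c d \<circ> signed_swap a b =
    signed_swap (signed_swap a b c) (signed_swap a b d)"
proof
  fix x
  define s where "s = signed_swap a b"
  have s: "s (s x) = x" "s (- x) = - s x" for x
    using signed_swap_simps(1,2)[OF assms] by (auto simp: s_def)
  have eq: "s x = y \<longleftrightarrow> x = s y" for x y using s(1) by metis
  have "(s \<circ> signed_swap c d \<circ> s) x = signed_swap (s c) (s d) x"
    unfolding signed_swap_def comp_apply eq[of x] by (simp add: s)
  then show "(signed_swap a b \<circ> signed_swap c d \<circ> signed_swap a b) x =
      signed_swap (signed_swap a b c) (signed_swap a b d) x"
    by (simp add: s_def)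
qed

lemma refl_B_iff:
  "t \<in> refl_B n \<longleftrightarrow> (\<exists>a\<in>signed_points n. \<exists>b\<in>signed_points n. a \<noteq> b \<and> t = signed_swap a b)"
proof
  have sw1: "Transposition.transpose i (- i) = signed_swap i (- i)" for i
    by (auto simp: signed_swap_def Transposition.transpose_def fun_eq_iff)
  have sw2: "Transposition.transpose i j \<circ> Transposition.transpose (- i) (- j) = signed_swap i j"
    if "1 \<le> i" "i < j" for i j
    using that by (auto simp: signed_swap_def Transposition.transpose_def fun_eq_iff)
  have sw3: "Transposition.transpose i (- j) \<circ> Transposition.transpose (- i) j = signed_swap i (- j)"
    if "1 \<le> i" "i < j" for i j
    using that by (auto simp: signed_swap_def Transposition.transpose_def fun_eq_iff)
  {
    assume "t \<in> refl_B n"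
    then consider i where "t = Transposition.transpose i (- i)" "1 \<le> i" "i \<le> int n"
      | i j where "t = Transposition.transpose i j \<circ> Transposition.transpose (- i) (- j)" "1 \<le> i" "i < j" "j \<le> int n"
      | i j where "t = Transposition.transpose i (- j) \<circ> Transposition.transpose (- i) j" "1 \<le> i" "i < j" "j \<le> int n"
      unfolding refl_B_def by blast
    then show "\<exists>a\<in>signed_points n. \<exists>b\<in>signed_points n. a \<noteq> b \<and> t = signed_swap a b"
    proof cases
      case (1 i)
      then show ?thesis unfolding sw1
        by (intro bexI[of _ i] bexI[of _ "- i"]) (auto simp: signed_points_def)
    next
      case (2 i j)
      then show ?thesis using sw2[OF 2(2,3)]
        by (intro bexI[of _ i] bexI[of _ j]) (auto simp: signed_points_def)
    next
      case (3 i j)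
      then show ?thesis using sw3[OF 3(2,3)]
        by (intro bexI[of _ i] bexI[of _ "- j"]) (auto simp: signed_points_def)
    qed
  }
  {
    \<comment> \<open>The symmetries of \<open>signed_swap\<close> reduce every pair to
      \<open>0 < a\<close> and \<open>\<bar>a\<bar> \<le> \<bar>b\<bar>\<close>, where the three
      kinds of reflections are told apart by \<open>b\<close>.\<close>
    have pos: "signed_swap a b \<in> refl_B n"
      if ab: "a \<in> signed_points n" "b \<in> signed_points n" "a \<noteq> b" "\<bar>a\<bar> \<le> \<bar>b\<bar>" "a > 0" for a b
    proof -
      have bn: "\<bar>b\<bar> \<le> int n" "1 \<le> a" using ab by (auto simp: signed_points_def)
      consider "b = - a" | "b > a" | "b < 0" "a < - b" using ab by linarith
      then show ?thesis
      proof cases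
        case 1
        have "\<exists>i. signed_swap a b = Transposition.transpose i (- i) \<and> 1 \<le> i \<and> i \<le> int n"
          using sw1[of a] 1 ab bn by (intro exI[of _ a]) auto
        then show ?thesis unfolding refl_B_def by blast
      next
        case 2
        then have "\<exists>i j. signed_swap a b = Transposition.transpose i j \<circ> Transposition.transpose (- i) (- j) \<and>
            1 \<le> i \<and> i < j \<and> j \<le> int n"
          using sw2[of a b] ab bn by (intro exI[of _ a] exI[of _ b]) auto
        then show ?thesis unfolding refl_B_def by blast
      next
        case 3
        then have "\<exists>i j. signed_swap a b = Transposition.transpose i (- j) \<circ> Transposition.transpose (- i) j \<and>
            1 \<le> i \<and> i < j \<and> j \<le> int n"
          using sw3[of a "- b"] ab bn by (intro exI[of _ a] exI[of _ "- b"]) auto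
        then show ?thesis unfolding refl_B_def by blast
      qed
    qed
    have ordered: "signed_swap a b \<in> refl_B n"
      if ab: "a \<in> signed_points n" "b \<in> signed_points n" "a \<noteq> b" "\<bar>a\<bar> \<le> \<bar>b\<bar>" for a b
    proof (cases "a > 0")
      case False
      then have "- a > 0" "a \<noteq> 0" "b \<noteq> 0" using ab by (auto simp: signed_points_def)
      then show ?thesis
        using pos[of "- a" "- b"] ab signed_swap_simps(4)[of a b] by (simp add: signed_points_uminus)
    qed (use pos ab in blast)
    assume "\<exists>a\<in>signed_points n. \<exists>b\<in>signed_points n. a \<noteq> b \<and> t = signed_swap a b"
    then obtain a b where ab: "a \<in> signed_points n" "b \<in> signed_points n" "a \<noteq> b" "t = signed_swap a b" by blast
    then have "a \<noteq> 0" "b \<noteq> 0" by (auto simp: signed_points_def)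
    then show "t \<in> refl_B n"
      using ordered[of a b] ordered[of b a] ab signed_swap_simps(3)[of a b] by (cases "\<bar>a\<bar> \<le> \<bar>b\<bar>") auto
  }
qed

lemma signed_swap_in_refl_B:
  "a \<in> signed_points n \<Longrightarrow> b \<in> signed_points n \<Longrightarrow> a \<noteq> b \<Longrightarrow> signed_swap a b \<in> refl_B n"
  unfolding refl_B_iff by blast

lemma refl_B_moved:
  assumes "t \<in> refl_B n" "t j \<noteq> j"
  shows "t = signed_swap j (t j)" "j \<in> signed_points n" "t j \<in> signed_points n"
proof -
  obtain a b where ab: "a \<in> signed_points n" "b \<in> signed_points n" "a \<noteq> b" "t = signed_swap a b"
    using assms(1) by (auto simp: refl_B_iff)
  then have nz: "a \<noteq> 0" "b \<noteq> 0" by (auto simp: signed_points_def)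
  consider "j = a" | "j = b" | "j = - a" | "j = - b" using assms(2) ab(4) by (auto simp: signed_swap_def split: if_splits)
  then have "t = signed_swap j (t j) \<and> j \<in> signed_points n \<and> t j \<in> signed_points n"
  proof cases
    case 1
    then have "t j = b" using ab by (simp add: signed_swap_def)
    then show ?thesis using ab 1 by simp
  next
    case 2
    then have "t j = a" using ab by (simp add: signed_swap_def)
    then show ?thesis using ab 2 signed_swap_simps(3)[OF nz] by simp
  next
    case 3
    then have "t j = - b" using ab nz signed_swap_simps(1)[OF nz, of a] by (simp add: signed_swap_def)
    then show ?thesis using ab 3 signed_swap_simps(4)[OF nz] by (simp add: signed_points_uminus)
  next
    case 4
    then have "t j = - a" using ab nz signed_swap_simps(1)[OF nz, of b] by (simp add: signed_swap_def)
    then show ?thesis using ab 4 signed_swap_simps(3)[OF nz] signed_swap_simps(4)[OF nz(2,1)]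
      by (simp add: signed_points_uminus)
  qed
  then show "t = signed_swap j (t j)" "j \<in> signed_points n" "t j \<in> signed_points n" by auto
qed

lemma signed_carrier:
  "carrier (signed_sym_group n) = {p. p permutes signed_points n \<and> (\<forall>i. p (- i) = - p i)}"
  by (simp add: signed_sym_group_def signed_points_def)

text \<open>The identity of type A survives when \<open>j\<close>, \<open>a\<close>,
  \<open>b\<close> are distinct up to sign. The three coincidences are
  \<open>((j, a))((j, -a)) = [j][a]\<close>, \<open>[j]((j, b)) = ((j, b))[b]\<close> and
  \<open>((j, a))[j] = ((j, -a))[a]\<close>. The memberships of \<open>c\<close>, \<open>d\<close>,
  \<open>e\<close> only serve to show that these are signed points.\<close>

lemma signed_swap_exchange:
  assumes "j \<noteq> 0" "a \<noteq> 0" "b \<noteq> 0" "a \<noteq> b" "a \<noteq> j" "b \<noteq> j"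
  obtains c d e where "c \<in> {- j, - a, b}" "c \<noteq> j" "d \<in> {a, b}" "e \<in> {b, - d}" "d \<noteq> e"
    "signed_swap d e j = j" "signed_swap j a \<circ> signed_swap j b = signed_swap j c \<circ> signed_swap d e"
proof -
  consider "b = - a" | "b \<noteq> - a" "a = - j" | "b \<noteq> - a" "b = - j" | "b \<noteq> - a" "a \<noteq> - j" "b \<noteq> - j" by blast
  then show ?thesis
  proof cases
    case 1
    have "signed_swap j a \<circ> signed_swap j b = signed_swap j (- j) \<circ> signed_swap a (- a)"
      using assms 1 by (auto simp: signed_swap_def fun_eq_iff)
    then show ?thesis using assms 1 by (intro that[of "- j" a "- a"]) (auto simp: signed_swap_def)
  next
    case 2
    have "signed_swap j a \<circ> signed_swap j b = signed_swap j b \<circ> signed_swap b (- b)"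
      using assms 2 by (auto simp: signed_swap_def fun_eq_iff)
    then show ?thesis using assms 2 by (intro that[of b b "- b"]) (auto simp: signed_swap_def)
  next
    case 3
    have "signed_swap j a \<circ> signed_swap j b = signed_swap j (- a) \<circ> signed_swap a (- a)"
      using assms 3 by (auto simp: signed_swap_def fun_eq_iff)
    then show ?thesis using assms 3 by (intro that[of "- a" a "- a"]) (auto simp: signed_swap_def)
  next
    case 4
    have "signed_swap j a \<circ> signed_swap j b = signed_swap j b \<circ> signed_swap a b"
    proof -
      have "signed_swap j b \<circ> signed_swap j b = id"
        using signed_swap_simps(2)[OF assms(1,3)] by (simp add: fun_eq_iff)
      then have "signed_swap j a \<circ> signed_swap j b =
          signed_swap j b \<circ> (signed_swap j b \<circ> signed_swap j a \<circ> signed_swap j b)"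
        by (simp flip: comp_assoc)
      also have "signed_swap j b \<circ> signed_swap j a \<circ> signed_swap j b = signed_swap b a"
      proof -
        have "a \<noteq> - b" using 4(1) by auto
        then have "signed_swap j b j = b" "signed_swap j b a = a"
          using assms 4 by (simp_all add: signed_swap_def)
        then show ?thesis using signed_swap_conj[OF assms(1,3), of j a] by simp
      qed
      finally show ?thesis unfolding signed_swap_simps(3)[OF assms(2,3)] .
    qed
    then show ?thesis using assms 4 by (intro that[of b a b]) (auto simp: signed_swap_def)
  qed
qed

lemma reflection_system_B: "reflection_system (signed_sym_group n) (refl_B n)"
proof (rule reflection_system.intro)
  have finS: "finite (signed_points n)" by (simp add: signed_points_def)
  have nz: "a \<noteq> 0" if "a \<in> signed_points n" for a using that by (simp add: signed_points_def)
  show "mult (signed_sym_group n) = (\<circ>)" "one (signed_sym_group n) = id"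
    by (simp_all add: signed_sym_group_def)
  show "group (signed_sym_group n)" by (rule signed_sym_group_is_group)
  show "finite (carrier (signed_sym_group n))"
    unfolding signed_carrier by (rule finite_subset[OF _ finite_permutations[OF finS]]) auto
  show "refl_B n \<subseteq> carrier (signed_sym_group n)"
  proof
    fix t assume "t \<in> refl_B n"
    then obtain a b where ab: "a \<in> signed_points n" "b \<in> signed_points n" "a \<noteq> b" "t = signed_swap a b"
      by (auto simp: refl_B_iff)
    have inv: "t (t x) = x" "t (- x) = - t x" for x
      using signed_swap_simps(1,2)[OF nz[OF ab(1)] nz[OF ab(2)]] ab(4) by auto
    have "t permutes signed_points n"
      unfolding permutes_def
    proof (intro conjI allI impI)
      show "t x = x" if "x \<notin> signed_points n" for x
      proof -
        have "x \<noteq> a" "x \<noteq> b" "x \<noteq> - a" "x \<noteq> - b" using that ab by (auto simp: signed_points_uminus)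
        then show ?thesis using ab(4) by (simp add: signed_swap_def)
      qed
      show "\<exists>!x. t x = y" for y using inv(1) by metis
    qed
    then show "t \<in> carrier (signed_sym_group n)" using inv(2) by (simp add: signed_carrier)
  qed
  show "finite {x. w x \<noteq> x}" if "w \<in> carrier (signed_sym_group n)" for w
    by (rule finite_subset[OF _ finS])
      (use that permutes_not_in[of w "signed_points n"] in \<open>unfold signed_carrier, blast\<close>)
  show "\<exists>t\<in>refl_B n. t (w j) = j \<and> (\<forall>x. w x = x \<longrightarrow> t x = x)"
    if w: "w \<in> carrier (signed_sym_group n)" and j: "w j \<noteq> j" for w j
  proof -
    have p: "w permutes signed_points n" "\<And>i. w (- i) = - w i" using w by (auto simp: signed_carrier)
    have jn: "j \<in> signed_points n" using permutes_not_in[OF p(1)] j by blast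
    then have "w j \<in> signed_points n" using permutes_in_image[OF p(1)] by blast
    then have "signed_swap (w j) j \<in> refl_B n" using jn j unfolding refl_B_iff by blast
    moreover have "signed_swap (w j) j x = x" if x: "w x = x" for x
    proof -
      \<comment> \<open>Applied to \<open>x\<close> and to \<open>- x\<close>, which is fixed as
        well, this excludes all four points moved by the swap.\<close>
      have *: "x \<noteq> j" "x \<noteq> w j" if "w x = x" for x
        using that j inj_eq[OF permutes_inj[OF p(1)], of x j] by auto
      have "w (- x) = - x" using p(2) x by simp
      then show ?thesis using *[OF x] *[of "- x"] by (auto simp: signed_swap_def)
    qed
    ultimately show ?thesis by (intro bexI[of _ "signed_swap (w j) j"]) (auto simp: signed_swap_def)
  qed
  show "t \<circ> t = id" if "t \<in> refl_B n" for t
  proof -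
    obtain a b where "a \<in> signed_points n" "b \<in> signed_points n" "t = signed_swap a b"
      using \<open>t \<in> refl_B n\<close> unfolding refl_B_iff by blast
    then show ?thesis using signed_swap_simps(2)[of a b] nz by (simp add: fun_eq_iff)
  qed
  show "s \<circ> t \<circ> s \<in> refl_B n" if st: "s \<in> refl_B n" "t \<in> refl_B n" for s t
  proof -
    obtain a b c d where ab: "a \<in> signed_points n" "b \<in> signed_points n" "a \<noteq> b" "s = signed_swap a b"
      and cd: "c \<in> signed_points n" "d \<in> signed_points n" "c \<noteq> d" "t = signed_swap c d"
      using st unfolding refl_B_iff by blast
    have "s \<circ> t \<circ> s = signed_swap (s c) (s d)"
      using signed_swap_conj[OF nz[OF ab(1)] nz[OF ab(2)]] ab(4) cd(4) by simp
    moreover have "s x \<in> signed_points n" if "x \<in> signed_points n" for x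
      using that ab by (auto simp: signed_swap_def signed_points_uminus)
    moreover have "s c \<noteq> s d"
      using signed_swap_simps(2)[OF nz[OF ab(1)] nz[OF ab(2)]] ab(4) cd(3) by metis
    ultimately show ?thesis unfolding refl_B_iff using cd by blast
  qed
  show "s = t" if "s \<in> refl_B n" "t \<in> refl_B n" "s j = t j" "s j \<noteq> j" for s t j
    using that by (metis refl_B_moved(1))
  show "\<exists>r\<in>refl_B n. \<exists>s'\<in>refl_B n. s \<circ> t = r \<circ> s' \<and> s' j = j"
    if st: "s \<in> refl_B n" "t \<in> refl_B n" "s j \<noteq> j" "t j \<noteq> j" "s \<noteq> t" for s t j
  proof -
    define a b where "a = s j" "b = t j"
    have s: "s = signed_swap j a" "j \<in> signed_points n" "a \<in> signed_points n"
      and t: "t = signed_swap j b" "b \<in> signed_points n"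
      using refl_B_moved[OF st(1,3)] refl_B_moved[OF st(2,4)] unfolding a_b_def by blast+
    have ne: "a \<noteq> b" "a \<noteq> j" "b \<noteq> j" using st(3,4,5) s(1) t(1) unfolding a_b_def[symmetric] by blast+
    obtain c d e where cde: "c \<in> {- j, - a, b}" "c \<noteq> j" "d \<in> {a, b}" "e \<in> {b, - d}" "d \<noteq> e"
      "signed_swap d e j = j" "signed_swap j a \<circ> signed_swap j b = signed_swap j c \<circ> signed_swap d e"
      using signed_swap_exchange[OF nz[OF s(2)] nz[OF s(3)] nz[OF t(2)] ne] by blast
    have pts: "c \<in> signed_points n" "d \<in> signed_points n" "e \<in> signed_points n"
      using cde(1,3,4) s(2,3) t(2) by (auto simp: signed_points_uminus)
    have "signed_swap j c \<in> refl_B n" "signed_swap d e \<in> refl_B n"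
      using signed_swap_in_refl_B[OF s(2) pts(1)] signed_swap_in_refl_B[OF pts(2,3)] cde(2,5) by auto
    then show ?thesis using cde(6,7) s(1) t(1) by blast
  qed
qed

lemma cox_B_nth:
  assumes "i < 2 * n"
  shows "(map int [1..<Suc n] @ map (\<lambda>i. - int i) [1..<Suc n]) ! i =
    (if i < n then int i + 1 else - int (i - n) - 1)"
  using assms by (auto simp: nth_append simp del: upt_Suc)

text \<open>On the cyclic list of length \<open>2 * n\<close> negation is the shift by
  \<open>n\<close> places, which commutes with the shift by one that the cycle performs.\<close>

lemma cox_B_carrier:
  assumes "n \<ge> 1" shows "cox_B n \<in> carrier (signed_sym_group n)"
proof -
  define cs where "cs = map int [1..<Suc n] @ map (\<lambda>i. - int i) [1..<Suc n]"
  have c: "cox_B n = cycle_of_list cs" by (simp add: cox_B_def cs_def)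
  have len: "length cs = 2 * n" by (simp add: cs_def del: upt_Suc)
  have nth: "cs ! i = (if i < n then int i + 1 else - int (i - n) - 1)" if "i < 2 * n" for i
    using cox_B_nth[OF that] by (simp only: cs_def)
  have set: "set cs = signed_points n"
  proof (intro equalityI subsetI)
    fix x assume x: "x \<in> signed_points n"
    show "x \<in> set cs"
    proof (cases "x > 0")
      case True
      then have "x = int (nat x)" "nat x \<in> set [1..<Suc n]" using x by (auto simp: signed_points_def)
      then show ?thesis unfolding cs_def set_append set_map by blast
    next
      case False
      then have "x = - int (nat (- x))" "nat (- x) \<in> set [1..<Suc n]" using x by (auto simp: signed_points_def)
      then show ?thesis unfolding cs_def set_append set_map by blast
    qed
  qed (auto simp: cs_def signed_points_def)
  have dist: "distinct cs"
    by (auto simp: cs_def distinct_map inj_on_def simp del: upt_Suc)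
  have opp: "cs ! ((i + n) mod (2 * n)) = - cs ! i" if "i < 2 * n" for i
  proof (cases "i < n")
    case True
    then show ?thesis using nth[of "i + n"] nth[of i] by simp
  next
    case False
    then have "(i + n) mod (2 * n) = i - n" using that by (simp add: mod_if)
    then show ?thesis using False that nth[of i] nth[of "i - n"] by simp
  qed
  have step: "cox_B n (cs ! i) = cs ! (Suc i mod (2 * n))" if "i < 2 * n" for i
    using cycle_of_list_nth[OF dist] that by (simp add: c len)
  have "cox_B n (- x) = - cox_B n x" for x
  proof (cases "x \<in> set cs")
    case True
    then obtain i where i: "i < 2 * n" "x = cs ! i" by (metis in_set_conv_nth len)
    have "cox_B n (- x) = cs ! (Suc ((i + n) mod (2 * n)) mod (2 * n))"
      using opp[OF i(1)] step[of "(i + n) mod (2 * n)"] i assms by simp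
    also have "Suc ((i + n) mod (2 * n)) mod (2 * n) = (Suc i mod (2 * n) + n) mod (2 * n)"
      by (simp add: mod_Suc_eq mod_add_left_eq)
    also have "cs ! \<dots> = - cs ! (Suc i mod (2 * n))"
      using assms by (intro opp) simp
    finally show ?thesis using step[OF i(1)] i by simp
  next
    case False
    moreover from this have "- x \<notin> set cs" by (simp add: set signed_points_uminus)
    ultimately show ?thesis using id_outside_supp[of _ cs] by (simp add: c)
  qed
  then show ?thesis
    using cycle_permutes[of cs] by (simp add: signed_carrier c set)
qed

lemma cox_B_neq_id:
  assumes "n \<ge> 2" shows "cox_B n \<noteq> id"
proof -
  define cs where "cs = map int [1..<Suc n] @ map (\<lambda>i. - int i) [1..<Suc n]"
  have "distinct cs"
    by (auto simp: cs_def distinct_map inj_on_def simp del: upt_Suc)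
  moreover have "length cs = 2 * n" by (simp add: cs_def del: upt_Suc)
  ultimately have "cox_B n (cs ! 0) = cs ! 1"
    using cycle_of_list_nth[of cs 0] assms by (simp add: cox_B_def cs_def del: upt_Suc)
  then have "cox_B n 1 = 2"
    using cox_B_nth[of 0 n] cox_B_nth[of 1 n] assms by (simp only: cs_def) simp
  then show ?thesis by auto
qed

theorem theorem1p3:
  fixes n :: nat
  assumes "n \<ge> 3"
  shows "doubly_homotopy_CM (NC_A n - {id, cox_A n}) (le_A n) \<and>
         doubly_homotopy_CM (NC_B n - {id, cox_B n}) (le_B n)"
proof
  show "doubly_homotopy_CM (NC_A n - {id, cox_A n}) (le_A n)"
    unfolding NC_A_def le_A_def using assms
    by (intro reflection_system.doubly_homotopy_CM_NC[OF reflection_system_A] cox_A_carrier cox_A_neq_id) simp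
  show "doubly_homotopy_CM (NC_B n - {id, cox_B n}) (le_B n)"
    unfolding NC_B_def le_B_def using assms
    by (intro reflection_system.doubly_homotopy_CM_NC[OF reflection_system_B] cox_B_carrier cox_B_neq_id) simp_all
qed

end
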